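(* Assume $S_p^{\mu}$ is self-adjoint. Let $k\ge 2$ be an integer and $\lambda\in\sigma(S_p^{\mu})$, and assume that there exist a real number $r_\lambda>0$, sequences $\{\lambda_{N,i}\}$ with $\lambda_{N,i}\in\sigma(S_{p,N}^{\mu})$ $(i=1,\dots,k)$, and a positive integer $N_0$ such that for every $N>N_0$ $$|\lambda-\lambda_{N,i}|\le \frac{r_\lambda}{2}\quad (i=1,\dots,k)$$ and $$2r_\lambda\le \min\left\{\mathrm{dist}(\lambda,\sigma(S_p^{\mu})\setminus\{\lambda\}),\ \mathrm{dist}\left(\lambda,\ \sigma(S_{p,N}^{\mu})\setminus\bigcup_{i=1}^k\{\lambda_{N,i}\}\right)\right\}.$$ Let $\phi$ be an eigenvector of $S_p^\mu$ corresponding to $\lambda$. (i) If the coefficients $f_0,\dots,f_{p-1}$ are $C^\infty$, then for all sufficiently large $N$ an index $i_N\in\{1,\dots,k\}$ can be chosen such that for every positive integer $q$ there exists a positive constant $C_1$, depending only on $p$, $f_0,\dots,f_{p-1}$, $\lambda$, $r_\lambda$, $q$ and $\phi$, with $$|\lambda-\lambda_{N,i_N}|\le C_1N^{-q}$$ for all sufficiently large $N$. (ii) If, for some $d>0$, the coefficients $f_0,\dots,f_{p-1}$ are analytic on $\mathcal{D}_d=\{z\in\mathbf{C}: |\mathrm{Im}\,z|<d\}$, then for all sufficiently large $N$ an index $i_N\in\{1,\dots,k\}$ can be chosen such that for every $\varepsilon$ with $0<\varepsilon<d$ there exists a positive constant $C_2$, depending only on $p$, $f_0,\dots,f_{p-1}$,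 $\lambda$, $r_\lambda$, $d$, $\varepsilon$ and $\phi$, with $$|\lambda-\lambda_{N,i_N}|\le C_2N^{2p+1}\exp\left(-\frac{2\pi(d-\varepsilon)}{kL}N\right)$$ for all sufficiently large $N$.
   Context: Let $p$ be a positive integer and $L>0$. Let $S_p=\frac{d^p}{dx^p}+\sum_{j=0}^{p-1}\tilde f_j(x)\frac{d^j}{dx^j}$ on $\mathbf{R}$, where the $\tilde f_j$ are $C^\infty$ and $L$-periodic. For $\mu\in[0,2\pi/L)$ put $S_p^{\mu}=e^{-i\mu x}S_pe^{i\mu x}=\frac{d^p}{dx^p}+\sum_{j=0}^{p-1}f_j(x)\frac{d^j}{dx^j}$, where the $f_j$ are the resulting $L$-periodic coefficients; $S_p^\mu$ is regarded as an operator $H^p([0,L])_{\mathrm{per}}\to L_2([0,L])_{\mathrm{per}}$ (an unbounded operator in $L_2([0,L])_{\mathrm{per}}$ with domain $H^p([0,L])_{\mathrm{per}}$), where $L_2([0,L])_{\mathrm{per}}$ and $H^p([0,L])_{\mathrm{per}}$ are the Lebesgue and Sobolev spaces of periodic functions on $[0,L]$. Its spectrum is $\sigma(S_p^\mu)$, which consists of eigenvalues only. For a positive integer $N$, $\hat P_N$ is the Fourier truncation $\hat P_N\phi=\sum_{n=-N}^N\hat\phi_n e_n$, with $e_n(x)=\frac{1}{\sqrt L}\exp(-i\frac{2\pi n x}{L})$ and $\hat\phi_n=(\phi,e_n)_2$. Put $S_{p,N}^\mu=\hat P_NS_p^\mu\hat P_N$. The set $\sigma(S_{p,N}^\mu)$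 denotes the set of eigenvalues of $S_{p,N}^\mu$ in the finite-dimensional (matrix) eigenvalue problem $S_{p,N}^\mu\phi_N=\lambda_N\phi_N$ with $\phi_N\ne 0$ in the $(2N+1)$-dimensional range of $\hat P_N$. $\mathrm{dist}(z,A)=\inf_{a\in A}|z-a|$. *)

theory Defs
  imports "HOL-Analysis.Analysis"
begin

section \<open>Smooth and periodic functions\<close>

definition nth_deriv :: "nat \<Rightarrow> (real \<Rightarrow> complex) \<Rightarrow> real \<Rightarrow> complex" where
  "nth_deriv n u = ((\<lambda>v x. vector_derivative v (at x)) ^^ n) u"

definition smooth_fun :: "(real \<Rightarrow> complex) \<Rightarrow> bool" where
  "smooth_fun u \<longleftrightarrow> (\<forall>n x. nth_deriv n u differentiable (at x))"

definition has_period :: "real \<Rightarrow> (real \<Rightarrow> complex) \<Rightarrow> bool" where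
  "has_period L u \<longleftrightarrow> (\<forall>x. u (x + L) = u x)"

definition strip :: "real \<Rightarrow> complex set" where
  "strip d = {z. \<bar>Im z\<bar> < d}"

text \<open>A function on the real line is called analytic on the strip if it is the restriction
  of an analytic function there.\<close>

definition analytic_on_strip :: "real \<Rightarrow> (real \<Rightarrow> complex) \<Rightarrow> bool" where
  "analytic_on_strip d u \<longleftrightarrow>
     (\<exists>F. F analytic_on strip d \<and> (\<forall>x. F (complex_of_real x) = u x))"


section \<open>Periodic Lebesgue and Sobolev spaces\<close>

text \<open>Elements of the function spaces are represented by \<open>L\<close>-periodic functions on the whole
  real line. Identification of functions that agree almost everywhere is not built into a
  quotient type; instead every notion below is invariant under it.\<close>

definition L2_per :: "real \<Rightarrow> (real \<Rightarrow> complex) set" where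
  "L2_per L = {u. u \<in> borel_measurable lebesgue \<and> has_period L u \<and>
                  set_integrable lebesgue {0..L} (\<lambda>x. (norm (u x))\<^sup>2)}"

definition L2_inner :: "real \<Rightarrow> (real \<Rightarrow> complex) \<Rightarrow> (real \<Rightarrow> complex) \<Rightarrow> complex" where
  "L2_inner L u v = (LINT x:{0..L}|lebesgue. u x * cnj (v x))"

definition L2_norm :: "real \<Rightarrow> (real \<Rightarrow> complex) \<Rightarrow> real" where
  "L2_norm L u = sqrt (LINT x:{0..L}|lebesgue. (norm (u x))\<^sup>2)"

definition has_weak_deriv ::
  "real \<Rightarrow> nat \<Rightarrow> (real \<Rightarrow> complex) \<Rightarrow> (real \<Rightarrow> complex) \<Rightarrow> bool" where
  "has_weak_deriv L n u g \<longleftrightarrow> u \<in> L2_per L \<and> g \<in> L2_per L \<and>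
     (\<forall>\<psi>. smooth_fun \<psi> \<and> has_period L \<psi> \<longrightarrow>
        (LINT x:{0..L}|lebesgue. u x * nth_deriv n \<psi> x) =
        (- 1) ^ n * (LINT x:{0..L}|lebesgue. g x * \<psi> x))"

definition H_per :: "real \<Rightarrow> nat \<Rightarrow> (real \<Rightarrow> complex) set" where
  "H_per L p = {u \<in> L2_per L. \<forall>j\<le>p. \<exists>g. has_weak_deriv L j u g}"

text \<open>On \<open>H_per L p\<close>, for orders up to \<open>p\<close>, a weak derivative exists and is unique up to
  almost everywhere equality; this picks a representative.\<close>

definition weak_deriv :: "real \<Rightarrow> nat \<Rightarrow> (real \<Rightarrow> complex) \<Rightarrow> real \<Rightarrow> complex" where
  "weak_deriv L n u = (SOME g. has_weak_deriv L n u g)"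


section \<open>Unbounded operators in the periodic Lebesgue space\<close>

text \<open>An operator is given by its domain \<open>D\<close> and its action \<open>A\<close> on representatives.\<close>

definition op_graph ::
  "real \<Rightarrow> (real \<Rightarrow> complex) set \<Rightarrow> ((real \<Rightarrow> complex) \<Rightarrow> real \<Rightarrow> complex)
    \<Rightarrow> ((real \<Rightarrow> complex) \<times> (real \<Rightarrow> complex)) set" where
  "op_graph L D A = {(v, w). v \<in> D \<and> w \<in> L2_per L \<and> (AE x in lebesgue. w x = A v x)}"

definition adjoint_graph ::
  "real \<Rightarrow> (real \<Rightarrow> complex) set \<Rightarrow> ((real \<Rightarrow> complex) \<Rightarrow> real \<Rightarrow> complex)
    \<Rightarrow> ((real \<Rightarrow> complex) \<times> (real \<Rightarrow> complex)) set" where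
  "adjoint_graph L D A =
     {(v, w). v \<in> L2_per L \<and> w \<in> L2_per L \<and> (\<forall>u\<in>D. L2_inner L (A u) v = L2_inner L u w)}"

text \<open>Equality with the adjoint relation, domains included. Density of \<open>D\<close> need not be
  required separately: if \<open>D\<close> is not dense, the adjoint relation is not single-valued and
  hence cannot be the graph of an operator.\<close>

definition self_adjoint_op ::
  "real \<Rightarrow> (real \<Rightarrow> complex) set \<Rightarrow> ((real \<Rightarrow> complex) \<Rightarrow> real \<Rightarrow> complex) \<Rightarrow> bool" where
  "self_adjoint_op L D A \<longleftrightarrow> adjoint_graph L D A = op_graph L D A"

text \<open>\<open>A - z\<close> maps \<open>D\<close> onto the whole space and has a bounded inverse; injectivity is
  contained in the norm estimate.\<close>

definition resolvent_set ::
  "real \<Rightarrow> (real \<Rightarrow> complex) set \<Rightarrow> ((real \<Rightarrow> complex) \<Rightarrow> real \<Rightarrow> complex) \<Rightarrow> complex set" where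
  "resolvent_set L D A =
     {z. (\<forall>h\<in>L2_per L. \<exists>u\<in>D. AE x in lebesgue. A u x - z * u x = h x) \<and>
         (\<exists>C. \<forall>u\<in>D. L2_norm L u \<le> C * L2_norm L (\<lambda>x. A u x - z * u x))}"

definition spectrum_op ::
  "real \<Rightarrow> (real \<Rightarrow> complex) set \<Rightarrow> ((real \<Rightarrow> complex) \<Rightarrow> real \<Rightarrow> complex) \<Rightarrow> complex set" where
  "spectrum_op L D A = - resolvent_set L D A"

definition eigenvector_op ::
  "(real \<Rightarrow> complex) set \<Rightarrow> ((real \<Rightarrow> complex) \<Rightarrow> real \<Rightarrow> complex)
    \<Rightarrow> complex \<Rightarrow> (real \<Rightarrow> complex) \<Rightarrow> bool" where
  "eigenvector_op D A z u \<longleftrightarrow>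
     u \<in> D \<and> \<not> (AE x in lebesgue. u x = 0) \<and> (AE x in lebesgue. A u x = z * u x)"


section \<open>The differential operator and its Fourier truncation\<close>

text \<open>The differential expression with leading coefficient \<open>1\<close> and coefficients
  \<open>a 0, \<dots>, a (p - 1)\<close>, first classically, then as an operator with domain \<open>H_per L p\<close>.\<close>

definition diff_expr ::
  "nat \<Rightarrow> (nat \<Rightarrow> real \<Rightarrow> complex) \<Rightarrow> (real \<Rightarrow> complex) \<Rightarrow> real \<Rightarrow> complex" where
  "diff_expr p a u x = nth_deriv p u x + (\<Sum>j<p. a j x * nth_deriv j u x)"

definition diff_op ::
  "real \<Rightarrow> nat \<Rightarrow> (nat \<Rightarrow> real \<Rightarrow> complex) \<Rightarrow> (real \<Rightarrow> complex) \<Rightarrow> real \<Rightarrow> complex" where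
  "diff_op L p a u x = weak_deriv L p u x + (\<Sum>j<p. a j x * weak_deriv L j u x)"

text \<open>The coefficients of \<open>exp (- \<i> \<mu> x) S exp (\<i> \<mu> x)\<close>, where \<open>S\<close> has coefficients
  \<open>a 0, \<dots>, a (p - 1)\<close> and leading coefficient \<open>1\<close>: expand \<open>(d/dx + \<i> \<mu>) ^ j\<close> for \<open>j \<le> p\<close>.
  See \<open>diff_expr_conj\<close> below.\<close>

definition conj_coeff ::
  "nat \<Rightarrow> real \<Rightarrow> (nat \<Rightarrow> real \<Rightarrow> complex) \<Rightarrow> nat \<Rightarrow> real \<Rightarrow> complex" where
  "conj_coeff p \<mu> a m x =
     (\<Sum>j=m..p. of_nat (j choose m) * (\<i> * of_real \<mu>) ^ (j - m) * (if j = p then 1 else a j x))"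

definition spectrum_diff_op :: "real \<Rightarrow> nat \<Rightarrow> (nat \<Rightarrow> real \<Rightarrow> complex) \<Rightarrow> complex set" where
  "spectrum_diff_op L p f = spectrum_op L (H_per L p) (diff_op L p f)"

definition fourier_basis :: "real \<Rightarrow> int \<Rightarrow> real \<Rightarrow> complex" where
  "fourier_basis L n x =
     of_real (1 / sqrt L) * exp (- \<i> * of_real (2 * pi * of_int n * x / L))"

definition fourier_trunc :: "real \<Rightarrow> nat \<Rightarrow> (real \<Rightarrow> complex) \<Rightarrow> real \<Rightarrow> complex" where
  "fourier_trunc L N u x =
     (\<Sum>n = - int N..int N. L2_inner L u (fourier_basis L n) * fourier_basis L n x)"

definition trunc_op ::
  "real \<Rightarrow> nat \<Rightarrow> (nat \<Rightarrow> real \<Rightarrow> complex) \<Rightarrow> nat \<Rightarrow> (real \<Rightarrow> complex) \<Rightarrow> real \<Rightarrow> complex" where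
  "trunc_op L p f N u = fourier_trunc L N (diff_op L p f (fourier_trunc L N u))"

definition spectrum_trunc ::
  "real \<Rightarrow> nat \<Rightarrow> (nat \<Rightarrow> real \<Rightarrow> complex) \<Rightarrow> nat \<Rightarrow> complex set" where
  "spectrum_trunc L p f N =
     {z. \<exists>u \<in> fourier_trunc L N ` L2_per L.
           u \<noteq> (\<lambda>_. 0) \<and> trunc_op L p f N u = (\<lambda>x. z * u x)}"

text \<open>Extended real valued, so that the distance to the empty set is infinite
  (\<open>infdist\<close> would give \<open>0\<close>).\<close>

definition dist_to_set :: "complex \<Rightarrow> complex set \<Rightarrow> ereal" where
  "dist_to_set z A = (INF a\<in>A. ereal (cmod (z - a)))"

text \<open>The sequences \<open>\<Lambda> N i\<close> (\<open>1 \<le> i \<le> k\<close>) of eigenvalues of the truncations lie close to the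
  eigenvalue \<open>l\<close>, away from the rest of both spectra.\<close>

definition eigenvalue_cluster ::
  "real \<Rightarrow> nat \<Rightarrow> (nat \<Rightarrow> real \<Rightarrow> complex) \<Rightarrow> complex \<Rightarrow> real \<Rightarrow> nat
    \<Rightarrow> (nat \<Rightarrow> nat \<Rightarrow> complex) \<Rightarrow> nat \<Rightarrow> bool" where
  "eigenvalue_cluster L p f l r k \<Lambda> N0 \<longleftrightarrow>
     (\<forall>N\<ge>1. \<forall>i\<in>{1..k}. \<Lambda> N i \<in> spectrum_trunc L p f N) \<and>
     (\<forall>N>N0. (\<forall>i\<in>{1..k}. cmod (l - \<Lambda> N i) \<le> r / 2) \<and>
        ereal (2 * r) \<le> min (dist_to_set l (spectrum_diff_op L p f - {l}))
                             (dist_to_set l (spectrum_trunc L p f N - (\<Union>i\<in>{1..k}. {\<Lambda> N i}))))"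


section \<open>The conjugated coefficients\<close>

lemma nth_deriv_0 [simp]: "nth_deriv 0 u = u"
  by (simp add: nth_deriv_def)

lemma nth_deriv_Suc: "nth_deriv (Suc n) u x = vector_derivative (nth_deriv n u) (at x)"
  by (simp add: nth_deriv_def)

lemma nth_deriv_exp_mult:
  fixes u :: "real \<Rightarrow> complex"
  assumes "smooth_fun u"
  shows "nth_deriv n (\<lambda>y. exp (\<i> * of_real (\<mu> * y)) * u y) =
    (\<lambda>x. exp (\<i> * of_real (\<mu> * x)) *
      (\<Sum>m\<le>n. of_nat (n choose m) * (\<i> * of_real \<mu>) ^ (n - m) * nth_deriv m u x))"
proof (induction n)
  case 0
  show ?case by simp
next
  case (Suc n)
  let ?c = "\<i> * complex_of_real \<mu>"
  let ?E = "\<lambda>x::real. exp (\<i> * complex_of_real (\<mu> * x))"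
  let ?T = "\<lambda>n m. of_nat (n choose m) * ?c ^ (n - m)"
  have D: "(nth_deriv m u has_vector_derivative nth_deriv (Suc m) u x) (at x)" for m x
    using assms unfolding smooth_fun_def
    by (simp add: nth_deriv_Suc vector_derivative_works)
  have E: "(?E has_vector_derivative ?c * ?E x) (at x)" for x
  proof -
    have "((\<lambda>z. exp (\<i> * (of_real \<mu> * z))) has_field_derivative ?c * ?E x) (at (of_real x))"
      by (auto intro!: derivative_eq_intros simp: algebra_simps)
    from has_vector_derivative_real_field[OF this]
    show ?thesis by (simp add: o_def)
  qed
  have key: "?c * (\<Sum>m\<le>n. ?T n m * v m) + (\<Sum>m\<le>n. ?T n m * v (Suc m)) =
      (\<Sum>m\<le>Suc n. ?T (Suc n) m * v m)" for v :: "nat \<Rightarrow> complex"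
  proof -
    have "(\<Sum>m\<le>Suc n. ?T (Suc n) m * v m) =
        ?c ^ Suc n * v 0 + (\<Sum>m\<le>n. ?T (Suc n) (Suc m) * v (Suc m))"
      by (subst sum.atMost_Suc_shift) simp
    also have "(\<Sum>m\<le>n. ?T (Suc n) (Suc m) * v (Suc m)) =
        (\<Sum>m\<le>n. ?T n m * v (Suc m)) +
        (\<Sum>m\<le>n. of_nat (n choose Suc m) * ?c ^ (n - m) * v (Suc m))"
      by (simp add: algebra_simps sum.distrib)
    also have "?c ^ Suc n * v 0 + ((\<Sum>m\<le>n. ?T n m * v (Suc m)) +
          (\<Sum>m\<le>n. of_nat (n choose Suc m) * ?c ^ (n - m) * v (Suc m))) =
        (\<Sum>m\<le>n. ?T n m * v (Suc m)) +
        (\<Sum>m\<le>Suc n. of_nat (n choose m) * ?c ^ (Suc n - m) * v m)"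
      unfolding sum.atMost_Suc_shift[of "\<lambda>m. of_nat (n choose m) * ?c ^ (Suc n - m) * v m"]
      by simp
    also have "(\<Sum>m\<le>Suc n. of_nat (n choose m) * ?c ^ (Suc n - m) * v m) =
        ?c * (\<Sum>m\<le>n. ?T n m * v m)"
      by (simp add: sum_distrib_left Suc_diff_le mult_ac)
    finally show ?thesis by (simp add: add_ac)
  qed
  show ?case
  proof
    fix x
    have S: "((\<lambda>x. \<Sum>m\<le>n. ?T n m * nth_deriv m u x) has_vector_derivative
        (\<Sum>m\<le>n. ?T n m * nth_deriv (Suc m) u x)) (at x)"
      by (intro has_vector_derivative_sum has_vector_derivative_mult_right D)
    have "((\<lambda>x. ?E x * (\<Sum>m\<le>n. ?T n m * nth_deriv m u x)) has_vector_derivative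
        ?E x * (\<Sum>m\<le>n. ?T n m * nth_deriv (Suc m) u x) +
        ?c * ?E x * (\<Sum>m\<le>n. ?T n m * nth_deriv m u x)) (at x)"
      by (rule has_vector_derivative_mult[OF E S])
    also have "?E x * (\<Sum>m\<le>n. ?T n m * nth_deriv (Suc m) u x) +
        ?c * ?E x * (\<Sum>m\<le>n. ?T n m * nth_deriv m u x) =
        ?E x * (\<Sum>m\<le>Suc n. ?T (Suc n) m * nth_deriv m u x)"
      by (subst key [symmetric]) (simp add: algebra_simps)
    finally show "nth_deriv (Suc n) (\<lambda>y. ?E y * u y) x =
        ?E x * (\<Sum>m\<le>Suc n. ?T (Suc n) m * nth_deriv m u x)"
      unfolding nth_deriv_Suc Suc.IH by (rule vector_derivative_at)
  qed
qed

lemma diff_expr_conj: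
  assumes "smooth_fun u"
  shows "exp (- \<i> * of_real (\<mu> * x)) *
           diff_expr p a (\<lambda>y. exp (\<i> * of_real (\<mu> * y)) * u y) x =
         diff_expr p (conj_coeff p \<mu> a) u x"
proof -
  let ?c = "\<i> * complex_of_real \<mu>"
  let ?b = "\<lambda>j. if j = p then 1 else a j x"
  have split: "diff_expr p g v x = (\<Sum>j\<le>p. (if j = p then 1 else g j x) * nth_deriv j v x)"
    for g v
    by (simp add: diff_expr_def lessThan_Suc_atMost[symmetric] add.commute)
  have e: "exp (- \<i> * of_real (\<mu> * x)) * (exp (\<i> * of_real (\<mu> * x)) * z) = z" for z :: complex
    by (simp add: mult.assoc[symmetric] exp_add[symmetric])
  have "exp (- \<i> * of_real (\<mu> * x)) *
           diff_expr p a (\<lambda>y. exp (\<i> * of_real (\<mu> * y)) * u y) x =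
        exp (- \<i> * of_real (\<mu> * x)) * (exp (\<i> * of_real (\<mu> * x)) *
          (\<Sum>j\<le>p. ?b j * (\<Sum>m\<le>j. of_nat (j choose m) * ?c ^ (j - m) * nth_deriv m u x)))"
    unfolding split nth_deriv_exp_mult[OF assms] by (simp add: sum_distrib_left mult_ac)
  also have "\<dots> = (\<Sum>j\<le>p. \<Sum>m\<le>j. of_nat (j choose m) * ?c ^ (j - m) * ?b j * nth_deriv m u x)"
    unfolding e by (simp add: sum_distrib_left mult_ac)
  also have "\<dots> = (\<Sum>m\<le>p. \<Sum>j=m..p. of_nat (j choose m) * ?c ^ (j - m) * ?b j * nth_deriv m u x)"
    unfolding sum.Sigma[OF finite_atMost ballI[OF finite_atMost]]
      sum.Sigma[OF finite_atMost ballI[OF finite_atLeastAtMost]]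
    by (rule sum.reindex_bij_witness[where i = "\<lambda>(a,b). (b,a)" and j = "\<lambda>(a,b). (b,a)"]) auto
  also have "\<dots> = (\<Sum>m\<le>p. conj_coeff p \<mu> a m x * nth_deriv m u x)"
    by (simp add: conj_coeff_def sum_distrib_right)
  also have "\<dots> = diff_expr p (conj_coeff p \<mu> a) u x"
    unfolding split by (rule sum.cong) (auto simp: conj_coeff_def)
  finally show ?thesis .
qed

end

theory Submission
  imports Defs "HOL-Complex_Analysis.Complex_Analysis"
begin

text \<open>Because the operator is self-adjoint, its truncations are Hermitian matrices. For a Hermitian
  matrix \<open>M\<close> and real \<open>\<lambda>\<close>, a vector \<open>v \<noteq> 0\<close> that nearly solves \<open>M v = \<lambda> v\<close> forces an eigenvalue
  of \<open>M\<close> within \<open>\<parallel>M v - \<lambda> v\<parallel> / \<parallel>v\<parallel>\<close> of \<open>\<lambda>\<close> (\<open>hermitian_approx_eigenvalue\<close>). The vector to use is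
  the list of Fourier coefficients of \<open>\<phi>\<close> with index at most \<open>N\<close>. Written in Fourier coordinates,
  \<open>S \<phi> = \<lambda> \<phi>\<close> is an infinite linear system, so the residual consists of those terms
  of the system that carry coefficients of \<open>\<phi>\<close> with index beyond \<open>N\<close>. Up to a constant, each entry of the residual is
  bounded by the supremum of that tail, weighted with \<open>(1 + \<bar>n\<bar>) ^ (p - 1)\<close>
  (\<open>truncation_residual\<close>), and there are \<open>2 N + 1\<close> entries; so the convergence rate is, up to a
  factor \<open>N\<close>, the decay rate of the weighted Fourier coefficients of \<open>\<phi>\<close>.

  For the decay, isolate the leading derivative in the system. With
  \<open>b n = (1 + \<bar>n\<bar>) ^ (p - 1) \<bar>\<phi>\<^sub>n\<bar>\<close> this gives \<open>(1 + \<bar>n\<bar>) b n \<le> (\<Sum>m. F (n - m) b m)\<close>, where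
  \<open>F\<close> is built from the Fourier coefficients of the \<open>f j\<close>. If \<open>F\<close> is summable against a
  submultiplicative weight \<open>v\<close>, the gain of one power of \<open>n\<close> on the left makes \<open>v b\<close> bounded
  (\<open>weighted_convolution_bound\<close>). Both regularity classes are instances: for smooth
  coefficients \<open>v n = (1 + \<bar>n\<bar>) ^ (q + 1)\<close>, by integration by parts; for coefficients analytic in
  the strip \<open>v n = exp (a \<bar>n\<bar>)\<close> with \<open>a = 2 \<pi> (d - \<epsilon>) / L\<close>, by shifting the line of integration.

  The eigenvalue found this way tends to \<open>\<lambda>\<close>, hence is eventually closer than \<open>2 r\<close>, and the
  separation hypothesis puts it among the \<open>\<Lambda> N i\<close>. In the analytic case the bound obtained is
  \<open>C N exp (- a N)\<close>, which implies the stated one because \<open>N \<le> N ^ (2 p + 1)\<close> and \<open>k \<ge> 1\<close>.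

  Two facts on Fourier series carry the translation into coordinates: an integrable function
  whose coefficients all vanish is zero almost everywhere (\<open>fcoef_zero_imp_AE_zero\<close>), and
  if one factor of a product has summable coefficients, the coefficients of the product are given by
  convolution (\<open>fcoef_mult\<close>).\<close>

section \<open>Exponentials and Fourier coefficients\<close>

text \<open>The coefficients below are normalised so that \<open>u\<close> has the series
  \<open>\<Sum>n. fcoef L u n * wave L (- n)\<close>: the minus sign matches \<open>fourier_basis\<close>, and dividing by \<open>L\<close>
  keeps square roots out of the convolution formula. In this convention differentiation
  multiplies the coefficient with index \<open>n\<close> by \<open>freq L n\<close>.\<close>

definition wave :: "real \<Rightarrow> int \<Rightarrow> real \<Rightarrow> complex" where
  "wave L n x = exp (\<i> * of_real (2 * pi * of_int n * x / L))"

definition freq :: "real \<Rightarrow> int \<Rightarrow> complex" where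
  "freq L n = - \<i> * of_real (2 * pi * of_int n / L)"

definition fcoef :: "real \<Rightarrow> (real \<Rightarrow> complex) \<Rightarrow> int \<Rightarrow> complex" where
  "fcoef L u n = (\<integral>x. u x * wave L n x \<partial>lebesgue_on {0..L}) / of_real L"

lemma set_integral_period: "(LINT x:{0..L}|lebesgue. g x) = (\<integral>x. g x \<partial>lebesgue_on {0..L})"
  for g :: "real \<Rightarrow> 'a::{banach,second_countable_topology}"
  by (simp add: set_lebesgue_integral_def integral_restrict_space)

lemma norm_wave [simp]: "norm (wave L n x) = 1"
  by (simp add: wave_def)

lemma wave_mult: "wave L m x * wave L n x = wave L (m + n) x"
proof -
  have "2 * pi * of_int (m + n) * x / L = 2 * pi * of_int m * x / L + 2 * pi * of_int n * x / L"
    by (simp add: distrib_left distrib_right add_divide_distrib)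
  thus ?thesis unfolding wave_def by (simp only: exp_add[symmetric] of_real_add distrib_left)
qed

lemma wave_0 [simp]: "wave L 0 x = 1"
  by (simp add: wave_def)

lemma cnj_wave: "cnj (wave L n x) = wave L (- n) x"
  by (simp add: wave_def exp_cnj)

lemma has_period_wave: "L > 0 \<Longrightarrow> has_period L (wave L n)"
proof -
  assume L: "L > 0"
  have "wave L n (x + L) = wave L n x * exp (2 * of_int n * of_real pi * \<i>)" for x
  proof -
    have "2 * pi * of_int n * (x + L) / L = 2 * pi * of_int n * x / L + 2 * pi * of_int n"
      using L by (simp add: field_simps)
    thus ?thesis by (simp add: wave_def exp_add[symmetric] distrib_left mult_ac)
  qed
  moreover have "exp (2 * of_int n * of_real pi * \<i>) = 1"
    using exp_integer_2pi[of "of_int n"] by simp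
  ultimately show ?thesis by (simp add: has_period_def)
qed

lemma fourier_basis_wave: "fourier_basis L n x = of_real (1 / sqrt L) * wave L (- n) x"
  by (simp add: fourier_basis_def wave_def)

lemma fourier_trunc_fcoef:
  assumes "L > 0"
  shows "fourier_trunc L N u x = (\<Sum>n=-int N..int N. fcoef L u n * wave L (- n) x)"
  unfolding fourier_trunc_def
proof (rule sum.cong[OF refl])
  fix n
  have "L2_inner L u (fourier_basis L n) = of_real (1 / sqrt L) * (\<integral>x. u x * wave L n x \<partial>lebesgue_on {0..L})"
    unfolding L2_inner_def set_integral_period fourier_basis_wave
    by (subst integral_mult_right_zero[symmetric], rule Bochner_Integration.integral_cong)
      (simp_all add: cnj_wave mult_ac)
  moreover have "complex_of_real (1 / sqrt L) * of_real (1 / sqrt L) = 1 / of_real L"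
    using assms by (simp flip: of_real_mult)
  ultimately show "L2_inner L u (fourier_basis L n) * fourier_basis L n x = fcoef L u n * wave L (- n) x"
    unfolding fourier_basis_wave fcoef_def by (simp add: field_simps)
qed

section \<open>Smooth periodic functions\<close>

lemma smooth_fun_deriv:
  "smooth_fun u \<Longrightarrow> (nth_deriv n u has_vector_derivative nth_deriv (Suc n) u x) (at x)"
  unfolding smooth_fun_def by (simp add: nth_deriv_Suc vector_derivative_works)

text \<open>A sequence of successive derivatives determines \<open>nth_deriv\<close>; this and the next lemma are
  how the iterated derivatives of concrete functions are computed.\<close>

lemma nth_derivI:
  assumes "\<And>x. D 0 x = u x" "\<And>n x. (D n has_vector_derivative D (Suc n) x) (at x)"
  shows "nth_deriv n u = D n"
proof (induction n)
  case 0
  show ?case using assms(1) by auto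
next
  case (Suc n)
  show ?case
    by (rule ext) (simp add: nth_deriv_Suc Suc.IH vector_derivative_at[OF assms(2)])
qed

lemma smooth_funI:
  assumes "\<And>x. D 0 x = u x" "\<And>n x. (D n has_vector_derivative D (Suc n) x) (at x)"
  shows "smooth_fun u"
  unfolding smooth_fun_def nth_derivI[where D = D, OF assms]
  using assms(2) differentiableI_vector by blast

lemma wave_deriv: "((\<lambda>x. c * wave L n x) has_vector_derivative c * (- freq L n) * wave L n x) (at x)"
proof -
  have "((\<lambda>z. exp (- freq L n * z)) has_field_derivative - freq L n * exp (- freq L n * of_real x)) (at (of_real x))"
    by (auto intro!: derivative_eq_intros)
  from has_vector_derivative_real_field[OF this]
  have "(wave L n has_vector_derivative - freq L n * wave L n x) (at x)"
    by (simp add: o_def wave_def[abs_def] freq_def mult_ac)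
  from has_vector_derivative_mult_right[OF this, of c] show ?thesis by (simp add: mult_ac)
qed

lemma wave_deriv_power:
  "((\<lambda>x. (- freq L n) ^ j * wave L n x) has_vector_derivative (- freq L n) ^ Suc j * wave L n x) (at x)"
  using wave_deriv[of "(- freq L n) ^ j" L n x] by (simp add: mult.commute)

lemma nth_deriv_wave: "nth_deriv j (wave L n) = (\<lambda>x. (- freq L n) ^ j * wave L n x)"
  by (rule nth_derivI[where D = "\<lambda>j x. (- freq L n) ^ j * wave L n x"])
    (simp, rule wave_deriv_power)

lemma smooth_fun_wave: "smooth_fun (wave L n)"
  by (rule smooth_funI[where D = "\<lambda>j x. (- freq L n) ^ j * wave L n x"])
    (simp, rule wave_deriv_power)

lemma smooth_fun_lincomb:
  assumes "\<And>i. i \<in> A \<Longrightarrow> smooth_fun (u i)"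
  shows "smooth_fun (\<lambda>x. \<Sum>i\<in>A. c i * u i x)"
proof (rule smooth_funI[where D = "\<lambda>n x. \<Sum>i\<in>A. c i * nth_deriv n (u i) x"])
  show "((\<lambda>x. \<Sum>i\<in>A. c i * nth_deriv n (u i) x) has_vector_derivative
      (\<Sum>i\<in>A. c i * nth_deriv (Suc n) (u i) x)) (at x)" for n x
    by (intro has_vector_derivative_sum has_vector_derivative_mult_right smooth_fun_deriv assms)
qed simp

lemma nth_deriv_nth_deriv: "nth_deriv n (nth_deriv m u) = nth_deriv (n + m) u"
  by (simp add: nth_deriv_def funpow_add)

lemma smooth_fun_nth_deriv: "smooth_fun u \<Longrightarrow> smooth_fun (nth_deriv m u)"
  by (simp add: smooth_fun_def nth_deriv_nth_deriv)

lemma continuous_nth_deriv: "smooth_fun u \<Longrightarrow> continuous_on S (nth_deriv n u)"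
  unfolding smooth_fun_def
  by (simp add: continuous_at_imp_continuous_on differentiable_imp_continuous_within)

lemma continuous_smooth: "smooth_fun u \<Longrightarrow> continuous_on S u"
  using continuous_nth_deriv[of u S 0] by simp

lemma has_period_nth_deriv:
  assumes "smooth_fun u" "has_period L u"
  shows "has_period L (nth_deriv n u)"
proof (induction n)
  case (Suc n)
  have "nth_deriv (Suc n) u (x + L) = nth_deriv (Suc n) u x" for x
  proof -
    have "((nth_deriv n u \<circ> (\<lambda>y. y + L)) has_vector_derivative 1 *\<^sub>R nth_deriv (Suc n) u (x + L)) (at x)"
      by (rule vector_diff_chain_at)
        (auto intro!: derivative_eq_intros smooth_fun_deriv assms)
    moreover have "nth_deriv n u \<circ> (\<lambda>y. y + L) = nth_deriv n u"
      using Suc by (auto simp: has_period_def)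
    ultimately have "(nth_deriv n u has_vector_derivative nth_deriv (Suc n) u (x + L)) (at x)" by simp
    with smooth_fun_deriv[OF assms(1), of n x] show ?thesis
      using vector_derivative_unique_at by blast
  qed
  thus ?case by (simp add: has_period_def)
qed (use assms in simp)

lemma continuous_integrable_period:
  fixes g :: "real \<Rightarrow> 'a::euclidean_space"
  shows "continuous_on {0..L} g \<Longrightarrow> integrable (lebesgue_on {0..L}) g"
  using continuous_imp_integrable[of 0 L g] by simp

lemma integral_period_deriv:
  fixes g :: "real \<Rightarrow> complex"
  assumes "L \<ge> 0" "\<And>x. (g has_vector_derivative g' x) (at x)" "continuous_on {0..L} g'"
  shows "(\<integral>x. g' x \<partial>lebesgue_on {0..L}) = g L - g 0"
proof -
  have "(g' has_integral (g L - g 0)) {0..L}"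
    using assms by (intro fundamental_theorem_of_calculus) (auto intro: has_vector_derivative_at_within)
  hence "integral {0..L} g' = g L - g 0" by (rule integral_unique)
  thus ?thesis
    using lebesgue_integral_eq_integral[OF continuous_integrable_period[OF assms(3)]] by simp
qed

text \<open>The boundary terms cancel by periodicity, so classical derivatives are weak derivatives.\<close>

lemma integral_by_parts_period:
  assumes L: "L > 0" and u: "smooth_fun u" "has_period L u" and \<psi>: "smooth_fun \<psi>" "has_period L \<psi>"
  shows "(\<integral>x. u x * nth_deriv j \<psi> x \<partial>lebesgue_on {0..L}) =
         (- 1) ^ j * (\<integral>x. nth_deriv j u x * \<psi> x \<partial>lebesgue_on {0..L})"
  using u
proof (induction j arbitrary: u)
  case (Suc j)
  let ?\<psi> = "nth_deriv j \<psi>" let ?\<psi>' = "nth_deriv (Suc j) \<psi>" let ?u' = "nth_deriv 1 u"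
  note cont = continuous_nth_deriv[OF \<psi>(1)] continuous_nth_deriv[OF Suc.prems(1)] continuous_smooth[OF Suc.prems(1)]
  have "u L * ?\<psi> L = u 0 * ?\<psi> 0"
    using Suc.prems(2) has_period_nth_deriv[OF \<psi>, of j] by (metis has_period_def add_0)
  moreover have "(\<integral>x. u x * ?\<psi>' x + ?u' x * ?\<psi> x \<partial>lebesgue_on {0..L}) = u L * ?\<psi> L - u 0 * ?\<psi> 0"
    using smooth_fun_deriv[OF Suc.prems(1), of 0] L
    by (intro integral_period_deriv has_vector_derivative_mult smooth_fun_deriv \<psi>
        continuous_intros cont) auto
  moreover have "(\<integral>x. u x * ?\<psi>' x + ?u' x * ?\<psi> x \<partial>lebesgue_on {0..L}) =
      (\<integral>x. u x * ?\<psi>' x \<partial>lebesgue_on {0..L}) + (\<integral>x. ?u' x * ?\<psi> x \<partial>lebesgue_on {0..L})"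
    by (intro Bochner_Integration.integral_add continuous_integrable_period continuous_intros cont)
  ultimately have "(\<integral>x. u x * ?\<psi>' x \<partial>lebesgue_on {0..L}) = - (\<integral>x. ?u' x * ?\<psi> x \<partial>lebesgue_on {0..L})"
    by (simp add: eq_neg_iff_add_eq_0)
  also have "(\<integral>x. ?u' x * ?\<psi> x \<partial>lebesgue_on {0..L}) =
      (- 1) ^ j * (\<integral>x. nth_deriv j ?u' x * \<psi> x \<partial>lebesgue_on {0..L})"
    by (intro Suc.IH smooth_fun_nth_deriv has_period_nth_deriv Suc.prems)
  finally show ?case by (simp add: nth_deriv_nth_deriv)
qed simp

section \<open>Periodic Lebesgue space\<close>

lemma L2_per_measurable: "u \<in> L2_per L \<Longrightarrow> u \<in> borel_measurable (lebesgue_on {0..L})"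
  unfolding L2_per_def by (auto intro: measurable_restrict_space1)

lemma L2_per_square: "u \<in> L2_per L \<Longrightarrow> integrable (lebesgue_on {0..L}) (\<lambda>x. (norm (u x))\<^sup>2)"
  unfolding L2_per_def set_integrable_def by (auto simp: integrable_restrict_space)

lemma finite_measure_period: "finite_measure (lebesgue_on {0..L :: real})"
  by (rule finite_measure_lebesgue_on) auto

lemma L2_per_prod_integrable:
  assumes "u \<in> L2_per L" "v \<in> L2_per L"
  shows "integrable (lebesgue_on {0..L}) (\<lambda>x. u x * v x)"
proof (rule Bochner_Integration.integrable_bound)
  show "integrable (lebesgue_on {0..L}) (\<lambda>x. (norm (u x))\<^sup>2 + (norm (v x))\<^sup>2)"
    by (intro Bochner_Integration.integrable_add L2_per_square assms)
  show "(\<lambda>x. u x * v x) \<in> borel_measurable (lebesgue_on {0..L})"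
    by (intro borel_measurable_times L2_per_measurable assms)
  have "norm (u x * v x) \<le> (norm (u x))\<^sup>2 + (norm (v x))\<^sup>2" for x
  proof -
    have "0 \<le> norm (u x) * norm (v x)" by simp
    thus ?thesis using sum_squares_bound[of "norm (u x)" "norm (v x)"] unfolding norm_mult by linarith
  qed
  thus "AE x in lebesgue_on {0..L}. norm (u x * v x) \<le> norm ((norm (u x))\<^sup>2 + (norm (v x))\<^sup>2)"
    by simp
qed

lemma smooth_L2_per:
  assumes "smooth_fun u" "has_period L u"
  shows "u \<in> L2_per L"
proof -
  have "u \<in> borel_measurable lborel"
    using borel_measurable_continuous_onI[OF continuous_smooth[OF assms(1)]] by simp
  hence "u \<in> borel_measurable lebesgue" by (rule measurable_completion)
  moreover have "integrable (lebesgue_on {0..L}) (\<lambda>x. (norm (u x))\<^sup>2)"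
    by (intro continuous_integrable_period continuous_intros continuous_smooth assms)
  ultimately show ?thesis
    using assms(2) by (simp add: L2_per_def set_integrable_def integrable_restrict_space)
qed

lemma L2_per_integrable: "u \<in> L2_per L \<Longrightarrow> integrable (lebesgue_on {0..L}) u"
  using L2_per_prod_integrable[of u L "wave L 0"] smooth_L2_per[OF smooth_fun_wave[of L 0], of L]
  by (simp add: has_period_def)

lemma smooth_has_weak_deriv:
  assumes "L > 0" "smooth_fun u" "has_period L u"
  shows "has_weak_deriv L j u (nth_deriv j u)"
  unfolding has_weak_deriv_def set_integral_period
  using integral_by_parts_period[OF assms]
  by (auto intro!: smooth_L2_per smooth_fun_nth_deriv has_period_nth_deriv assms)

lemma smooth_H_per: "L > 0 \<Longrightarrow> smooth_fun u \<Longrightarrow> has_period L u \<Longrightarrow> u \<in> H_per L p"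
  unfolding H_per_def using smooth_has_weak_deriv smooth_L2_per by blast

text \<open>Use the exponential itself as the test function.\<close>

lemma fcoef_weak_deriv:
  assumes L: "L > 0" and "has_weak_deriv L j u g"
  shows "fcoef L g n = freq L n ^ j * fcoef L u n"
proof -
  have "(\<integral>x. u x * nth_deriv j (wave L n) x \<partial>lebesgue_on {0..L}) =
      (- 1) ^ j * (\<integral>x. g x * wave L n x \<partial>lebesgue_on {0..L})"
    using assms smooth_fun_wave has_period_wave[OF L]
    unfolding has_weak_deriv_def set_integral_period by blast
  moreover have "(\<integral>x. u x * nth_deriv j (wave L n) x \<partial>lebesgue_on {0..L}) =
      (- freq L n) ^ j * (\<integral>x. u x * wave L n x \<partial>lebesgue_on {0..L})"
    unfolding nth_deriv_wave
    by (subst integral_mult_right_zero[symmetric]) (simp add: mult_ac)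
  moreover have "(- freq L n) ^ j = (- 1) ^ j * freq L n ^ j" by (rule power_minus)
  ultimately have "(- 1) ^ j * (freq L n ^ j * (\<integral>x. u x * wave L n x \<partial>lebesgue_on {0..L})) =
      (- 1) ^ j * (\<integral>x. g x * wave L n x \<partial>lebesgue_on {0..L})" by (simp add: mult_ac)
  thus ?thesis unfolding fcoef_def by simp
qed

lemma integrable_mult_wave:
  assumes "integrable (lebesgue_on {0..L}) u"
  shows "integrable (lebesgue_on {0..L}) (\<lambda>x. u x * wave L n x)"
proof (rule Bochner_Integration.integrable_bound[OF assms])
  have "wave L n \<in> borel_measurable (lebesgue_on {0..L})"
    using continuous_integrable_period[OF continuous_smooth[OF smooth_fun_wave]] by auto
  thus "(\<lambda>x. u x * wave L n x) \<in> borel_measurable (lebesgue_on {0..L})"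
    using assms by (intro borel_measurable_times) auto
qed (simp add: norm_mult)

lemma norm_fcoef_le:
  assumes "L > 0" "integrable (lebesgue_on {0..L}) u"
  shows "norm (fcoef L u n) \<le> (\<integral>x. norm (u x) \<partial>lebesgue_on {0..L}) / L"
proof -
  have "norm (\<integral>x. u x * wave L n x \<partial>lebesgue_on {0..L}) \<le> (\<integral>x. norm (u x * wave L n x) \<partial>lebesgue_on {0..L})"
    by (rule integral_norm_bound)
  thus ?thesis unfolding fcoef_def using assms(1) by (simp add: norm_divide norm_mult divide_right_mono)
qed

lemma fcoef_wave: "L > 0 \<Longrightarrow> fcoef L (wave L (- m)) n = (if m = n then 1 else 0)"
proof -
  assume L: "L > 0"
  have *: "fcoef L (wave L (- m)) n = (\<integral>x. wave L (n - m) x \<partial>lebesgue_on {0..L}) / of_real L"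
    unfolding fcoef_def by (simp add: wave_mult)
  show ?thesis
  proof (cases "m = n")
    case True
    thus ?thesis using L unfolding * by (simp add: wave_def[abs_def] measure_restrict_space[of "{0..L}" lebesgue] scaleR_conv_of_real)
  next
    case False
    hence k: "freq L (n - m) \<noteq> 0" using L by (simp add: freq_def)
    have "(\<integral>x. wave L (n - m) x \<partial>lebesgue_on {0..L}) =
        (- 1 / freq L (n - m)) * wave L (n - m) L - (- 1 / freq L (n - m)) * wave L (n - m) 0"
      using wave_deriv[of "- 1 / freq L (n - m)" L "n - m"] k L
      by (intro integral_period_deriv) (auto intro!: continuous_smooth smooth_fun_wave)
    moreover have "wave L (n - m) L = wave L (n - m) 0"
      using has_period_wave[OF L] by (metis add_0 has_period_def)
    ultimately show ?thesis using False unfolding * by simp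
  qed
qed

lemma fcoef_lincomb:
  assumes "\<And>i. i \<in> A \<Longrightarrow> integrable (lebesgue_on {0..L}) (u i)"
  shows "fcoef L (\<lambda>x. \<Sum>i\<in>A. c i * u i x) n = (\<Sum>i\<in>A. c i * fcoef L (u i) n)"
proof -
  have int: "integrable (lebesgue_on {0..L}) (\<lambda>x. c i * (u i x * wave L n x))" if "i \<in> A" for i
    using integrable_mult_wave[OF assms[OF that]] by (rule integrable_mult_right)
  have "(\<integral>x. (\<Sum>i\<in>A. c i * u i x) * wave L n x \<partial>lebesgue_on {0..L}) =
      (\<integral>x. (\<Sum>i\<in>A. c i * (u i x * wave L n x)) \<partial>lebesgue_on {0..L})"
    by (simp add: sum_distrib_right mult.assoc)
  also have "\<dots> = (\<Sum>i\<in>A. \<integral>x. c i * (u i x * wave L n x) \<partial>lebesgue_on {0..L})"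
    by (rule Bochner_Integration.integral_sum[OF int])
  also have "\<dots> = (\<Sum>i\<in>A. c i * (\<integral>x. u i x * wave L n x \<partial>lebesgue_on {0..L}))"
    by (simp only: integral_mult_right_zero)
  finally show ?thesis unfolding fcoef_def by (simp only: sum_divide_distrib times_divide_eq_right)
qed

lemma fcoef_trig_poly:
  assumes "L > 0" "finite A"
  shows "fcoef L (\<lambda>x. \<Sum>n\<in>A. c n * wave L (- n) x) m = (if m \<in> A then c m else 0)"
proof -
  have "fcoef L (\<lambda>x. \<Sum>n\<in>A. c n * wave L (- n) x) m = (\<Sum>n\<in>A. c n * fcoef L (wave L (- n)) m)"
    by (intro fcoef_lincomb continuous_integrable_period continuous_smooth smooth_fun_wave)
  also have "\<dots> = (\<Sum>n\<in>A. if n = m then c n else 0)"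
    using fcoef_wave[OF assms(1)] by (intro sum.cong) auto
  finally show ?thesis using assms(2) by simp
qed

lemma L2_perI:
  assumes "u \<in> borel_measurable lebesgue" "has_period L u"
    "integrable (lebesgue_on {0..L}) (\<lambda>x. (norm (u x))\<^sup>2)"
  shows "u \<in> L2_per L"
  using assms by (simp add: L2_per_def set_integrable_def integrable_restrict_space)

lemma L2_per_lebesgue_measurable: "u \<in> L2_per L \<Longrightarrow> u \<in> borel_measurable lebesgue"
  and L2_per_period: "u \<in> L2_per L \<Longrightarrow> has_period L u"
  by (simp_all add: L2_per_def)

lemma L2_per_add:
  assumes u: "u \<in> L2_per L" and v: "v \<in> L2_per L"
  shows "(\<lambda>x. u x + v x) \<in> L2_per L"
proof (rule L2_perI)
  show m: "(\<lambda>x. u x + v x) \<in> borel_measurable lebesgue"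
    by (rule borel_measurable_add[OF L2_per_lebesgue_measurable[OF u] L2_per_lebesgue_measurable[OF v]])
  show "has_period L (\<lambda>x. u x + v x)"
    using L2_per_period[OF u] L2_per_period[OF v] by (simp add: has_period_def)
  show "integrable (lebesgue_on {0..L}) (\<lambda>x. (norm (u x + v x))\<^sup>2)"
  proof (rule Bochner_Integration.integrable_bound)
    show "integrable (lebesgue_on {0..L}) (\<lambda>x. 2 * ((norm (u x))\<^sup>2 + (norm (v x))\<^sup>2))"
      by (rule integrable_mult_right[OF Bochner_Integration.integrable_add[OF L2_per_square[OF u] L2_per_square[OF v]]])
    show "(\<lambda>x. (norm (u x + v x))\<^sup>2) \<in> borel_measurable (lebesgue_on {0..L})"
      by (rule measurable_restrict_space1[OF borel_measurable_power[OF measurable_compose[OF m borel_measurable_norm]]])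
    have "(norm (u x + v x))\<^sup>2 \<le> 2 * ((norm (u x))\<^sup>2 + (norm (v x))\<^sup>2)" for x
    proof -
      have "(norm (u x + v x))\<^sup>2 \<le> (norm (u x) + norm (v x))\<^sup>2"
        by (intro power_mono norm_triangle_ineq norm_ge_zero)
      also have "\<dots> \<le> 2 * ((norm (u x))\<^sup>2 + (norm (v x))\<^sup>2)"
        using sum_squares_bound[of "norm (u x)" "norm (v x)"] by (simp add: power2_sum)
      finally show ?thesis .
    qed
    thus "AE x in lebesgue_on {0..L}. norm ((norm (u x + v x))\<^sup>2) \<le> norm (2 * ((norm (u x))\<^sup>2 + (norm (v x))\<^sup>2))"
      by simp
  qed
qed

lemma L2_per_sum:
  assumes "\<And>j. j \<in> J \<Longrightarrow> u j \<in> L2_per L"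
  shows "(\<lambda>x. \<Sum>j\<in>J. u j x) \<in> L2_per L"
  using assms
proof (induction J rule: infinite_finite_induct)
  case (insert j J)
  thus ?case using L2_per_add[of "u j" L "\<lambda>x. \<Sum>j\<in>J. u j x"] by simp
qed (auto simp: L2_per_def has_period_def set_integrable_def)

lemma smooth_mult_L2_per:
  assumes a: "smooth_fun a" "has_period L a" and g: "g \<in> L2_per L"
  shows "(\<lambda>x. a x * g x) \<in> L2_per L"
proof (rule L2_perI)
  show m: "(\<lambda>x. a x * g x) \<in> borel_measurable lebesgue"
    by (rule borel_measurable_times[OF L2_per_lebesgue_measurable[OF smooth_L2_per[OF a]] L2_per_lebesgue_measurable[OF g]])
  show "has_period L (\<lambda>x. a x * g x)"
    using L2_per_period[OF g] a(2) by (simp add: has_period_def)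
  have "compact (a ` {0..L})"
    by (intro compact_continuous_image continuous_smooth a) simp
  then obtain K where K: "\<And>x. x \<in> {0..L} \<Longrightarrow> norm (a x) \<le> K"
    using compact_imp_bounded bounded_iff by (metis imageI)
  show "integrable (lebesgue_on {0..L}) (\<lambda>x. (norm (a x * g x))\<^sup>2)"
  proof (rule Bochner_Integration.integrable_bound)
    show "integrable (lebesgue_on {0..L}) (\<lambda>x. K\<^sup>2 * (norm (g x))\<^sup>2)"
      by (rule integrable_mult_right[OF L2_per_square[OF g]])
    show "(\<lambda>x. (norm (a x * g x))\<^sup>2) \<in> borel_measurable (lebesgue_on {0..L})"
      by (rule measurable_restrict_space1[OF borel_measurable_power[OF measurable_compose[OF m borel_measurable_norm]]])
    show "AE x in lebesgue_on {0..L}. norm ((norm (a x * g x))\<^sup>2) \<le> norm (K\<^sup>2 * (norm (g x))\<^sup>2)"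
    proof (rule AE_I2)
      fix x assume "x \<in> space (lebesgue_on {0..L})"
      hence "norm (a x) \<le> K" using K by simp
      hence "(norm (a x))\<^sup>2 * (norm (g x))\<^sup>2 \<le> K\<^sup>2 * (norm (g x))\<^sup>2"
        by (intro mult_right_mono power_mono) auto
      thus "norm ((norm (a x * g x))\<^sup>2) \<le> norm (K\<^sup>2 * (norm (g x))\<^sup>2)"
        by (simp add: norm_mult power_mult_distrib)
    qed
  qed
qed

text \<open>The inner product sees a function on one period only, whereas an eigenvector is required to
  be nonzero on the whole line; countably many translates of a null set bridge the gap.\<close>

lemma AE_zero_period_imp_AE_zero:
  assumes L: "L > 0" and u: "has_period L u" and ae: "AE x in lebesgue_on {0..L}. u x = 0"
  shows "AE x in lebesgue. u x = 0"
proof -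
  have "AE x in lebesgue. x \<in> {0..L} \<longrightarrow> u x = 0"
    using ae by (subst (asm) AE_restrict_space_iff) simp_all
  then obtain Z where Z: "negligible Z" "{x. \<not> (x \<in> {0..L} \<longrightarrow> u x = 0)} \<subseteq> Z"
    by (auto simp: eventually_ae_filter_negligible)
  have nat: "u (x + real k * L) = u x" for x k
  proof (induction k)
    case (Suc k)
    have "u (x + real (Suc k) * L) = u ((x + real k * L) + L)" by (simp add: algebra_simps)
    also have "\<dots> = u x" using u Suc by (simp only: has_period_def)
    finally show ?case .
  qed simp
  have int: "u (x + of_int k * L) = u x" for x k
  proof (cases "k \<ge> 0")
    case True
    thus ?thesis using nat[of x "nat k"] by simp
  next
    case False
    thus ?thesis using nat[of "x + of_int k * L" "nat (- k)"] by simp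
  qed
  define N where "N = (\<Union>k::int. (+) (of_int k * L) ` Z)"
  have "negligible N"
    unfolding N_def by (rule negligible_countable_Union) (auto intro: negligible_translation Z)
  moreover have "{x. u x \<noteq> 0} \<subseteq> N"
  proof
    fix x assume x: "x \<in> {x. u x \<noteq> 0}"
    define k where "k = \<lfloor>x / L\<rfloor>"
    define y where "y = x - of_int k * L"
    have "of_int k \<le> x / L" "x / L < of_int k + 1" unfolding k_def by linarith+
    hence "0 \<le> y" "y \<le> L" using L by (auto simp: y_def field_simps)
    moreover have "u y \<noteq> 0" using x int[of y k] by (simp add: y_def)
    ultimately have "y \<in> Z" using Z(2) by auto
    moreover have "x = of_int k * L + y" by (simp add: y_def)
    ultimately have "x \<in> (+) (of_int k * L) ` Z" by (rule rev_image_eqI)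
    thus "x \<in> N" unfolding N_def by (rule UN_I[OF UNIV_I])
  qed
  ultimately show ?thesis unfolding eventually_ae_filter_negligible by (intro exI[of _ N] conjI)
qed


section \<open>Completeness of the exponentials\<close>

text \<open>Trigonometric polynomials, as an inductive set so that closure under products (hence under
  real polynomials) is a short induction.\<close>

inductive_set trig :: "real \<Rightarrow> (real \<Rightarrow> complex) set" for L where
  trig_wave: "wave L n \<in> trig L"
| trig_add: "u \<in> trig L \<Longrightarrow> v \<in> trig L \<Longrightarrow> (\<lambda>x. u x + v x) \<in> trig L"
| trig_scale: "u \<in> trig L \<Longrightarrow> (\<lambda>x. c * u x) \<in> trig L"

lemma trig_const: "(\<lambda>x. c) \<in> trig L"
  using trig_scale[OF trig_wave[of L 0], of c] by simp

lemma trig_mult: "u \<in> trig L \<Longrightarrow> v \<in> trig L \<Longrightarrow> (\<lambda>x. u x * v x) \<in> trig L"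
proof (induction rule: trig.induct)
  case (trig_wave m)
  from this show ?case
  proof (induction rule: trig.induct)
    case (trig_wave n)
    show ?case unfolding wave_mult by (rule trig.trig_wave)
  next
    case (trig_add u v)
    from trig.trig_add[OF this(3,4)] show ?case by (simp add: distrib_left)
  next
    case (trig_scale u c)
    from trig.trig_scale[OF this(2), of c] show ?case by (simp add: mult_ac)
  qed
next
  case (trig_add u w)
  from trig.trig_add[OF trig_add.IH(1)[OF trig_add.prems] trig_add.IH(2)[OF trig_add.prems]]
  show ?case by (simp add: distrib_right)
next
  case (trig_scale u c)
  from trig.trig_scale[OF trig_scale.IH[OF trig_scale.prems], of c] show ?case by (simp add: mult_ac)
qed

lemma trig_power: "u \<in> trig L \<Longrightarrow> (\<lambda>x. u x ^ k) \<in> trig L"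
  by (induction k) (auto intro: trig_const trig_mult)

lemma trig_orthogonal:
  assumes \<phi>: "integrable (lebesgue_on {0..L}) \<phi>" and z: "\<And>n. fcoef L \<phi> n = 0" and L: "L > 0"
    and u: "u \<in> trig L"
  shows "integrable (lebesgue_on {0..L}) (\<lambda>x. \<phi> x * u x) \<and> (\<integral>x. \<phi> x * u x \<partial>lebesgue_on {0..L}) = 0"
  using u
proof (induction rule: trig.induct)
  case (trig_wave n)
  show ?case using integrable_mult_wave[OF \<phi>] z[of n] L by (simp add: fcoef_def)
next
  case (trig_add u v)
  thus ?case by (simp add: distrib_left)
next
  case (trig_scale u c)
  have "(\<lambda>x. \<phi> x * (c * u x)) = (\<lambda>x. c * (\<phi> x * u x))" by (simp add: mult.left_commute)
  thus ?case using trig_scale.IH by (simp only: integrable_mult_right integral_mult_right_zero mult_zero_right simp_thms)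
qed

text \<open>Polynomials on the unit interval that converge boundedly to the indicator of
  \<open>t < 1 / 2\<close>; Bernoulli's inequality gives both halves. Composed with a trigonometric
  polynomial they remain trigonometric polynomials.\<close>

lemma power_step_limit:
  fixes t :: real
  assumes "0 \<le> t" "t \<le> 1" "t \<noteq> 1/2"
  shows "(\<lambda>n. (1 - t ^ n) ^ (2 ^ n)) \<longlonglongrightarrow> (if t < 1/2 then 1 else 0)"
proof -
  have two: "real (2 ^ n) * t ^ n = (2 * t) ^ n" for n by (simp add: power_mult_distrib)
  have y: "0 \<le> t ^ n" "t ^ n \<le> 1" for n using assms by (auto simp: power_le_one)
  show ?thesis
  proof (cases "t < 1/2")
    case True
    have lo: "(\<lambda>n. 1 - (2 * t) ^ n) \<longlonglongrightarrow> 1 - 0"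
      using True assms by (intro tendsto_intros LIMSEQ_realpow_zero) auto
    have le: "1 - (2 * t) ^ n \<le> (1 - t ^ n) ^ (2 ^ n)" for n
    proof -
      have "1 + real (2 ^ n) * (- (t ^ n)) \<le> (1 + (- (t ^ n))) ^ (2 ^ n)"
        using y(2)[of n] by (intro Bernoulli_inequality) linarith
      thus ?thesis unfolding two by (simp only: minus_mult_right[symmetric] two add_uminus_conv_diff)
    qed
    have le1: "(1 - t ^ n) ^ (2 ^ n) \<le> 1" for n using y[of n] by (intro power_le_one) auto
    have "(\<lambda>n. (1 - t ^ n) ^ (2 ^ n)) \<longlonglongrightarrow> 1"
      by (rule tendsto_sandwich[OF always_eventually[OF allI[OF le]] always_eventually[OF allI[OF le1]]
            lo[unfolded diff_zero] tendsto_const])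
    thus ?thesis using True by simp
  next
    case False
    hence t: "2 * t > 1" using assms by auto
    have up: "(1 - t ^ n) ^ (2 ^ n) \<le> (1 / (2 * t)) ^ n" for n
    proof -
      have "1 + real (2 ^ n) * t ^ n \<le> (1 + t ^ n) ^ (2 ^ n)"
        using y(1)[of n] by (intro Bernoulli_inequality) linarith
      hence "(2 * t) ^ n \<le> (1 + t ^ n) ^ (2 ^ n)" unfolding two by linarith
      hence "(1 - t ^ n) ^ (2 ^ n) * (2 * t) ^ n \<le> (1 - t ^ n) ^ (2 ^ n) * (1 + t ^ n) ^ (2 ^ n)"
        by (rule mult_left_mono) (use y(2)[of n] in simp)
      also have "\<dots> = (1 - t ^ n * t ^ n) ^ (2 ^ n)"
        unfolding power_mult_distrib[symmetric]
        by (rule arg_cong[where f = "\<lambda>z. z ^ (2 ^ n)"]) (simp add: algebra_simps)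
      also have "\<dots> \<le> 1" using y[of n] mult_le_one[OF y(2)[of n] y[of n]]
        by (intro power_le_one) auto
      finally show ?thesis using t by (simp only: power_divide power_one) (subst pos_le_divide_eq, auto)
    qed
    have lim: "(\<lambda>n. (1 / (2 * t)) ^ n) \<longlonglongrightarrow> 0" using t by (intro LIMSEQ_realpow_zero) auto
    have nonneg: "0 \<le> (1 - t ^ n) ^ (2 ^ n)" for n by (rule zero_le_power) (use y(2)[of n] in linarith)
    have "(\<lambda>n. (1 - t ^ n) ^ (2 ^ n)) \<longlonglongrightarrow> 0"
      by (rule tendsto_sandwich[OF always_eventually[OF allI[OF nonneg]] always_eventually[OF allI[OF up]]
            tendsto_const lim])
    thus ?thesis using False by simp
  qed
qed

lemma cos_compare_shifted:
  fixes s \<theta> :: real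
  assumes "0 < s" "s < pi" "- s < \<theta>" "\<theta> < 2 * pi - s"
  shows "\<theta> < s \<Longrightarrow> cos s < cos \<theta>" "s < \<theta> \<Longrightarrow> cos \<theta> < cos s"
proof -
  assume "\<theta> < s"
  thus "cos s < cos \<theta>"
    using cos_monotone_0_pi[of "\<bar>\<theta>\<bar>" s] assms by (cases "\<theta> \<ge> 0") auto
next
  assume "s < \<theta>"
  thus "cos \<theta> < cos s"
    using cos_monotone_0_pi[of s \<theta>] cos_monotone_0_pi[of s "2 * pi - \<theta>"] assms
    by (cases "\<theta> \<le> pi") (auto simp: cos_diff)
qed

text \<open>The function \<open>t\<close> in the proof is a trigonometric polynomial with values in the unit
  interval, and within one period it is below \<open>1 / 2\<close> exactly on \<open>(0, a)\<close>. Feeding it into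
  \<open>power_step_limit\<close> gives trigonometric polynomials converging boundedly to the indicator of
  that interval.\<close>

lemma initial_interval_orthogonal:
  assumes L: "L > 0" and \<phi>: "integrable (lebesgue_on {0..L}) \<phi>" and z: "\<And>n. fcoef L \<phi> n = 0"
    and a: "0 < a" "a < L"
  shows "(\<integral>x. indicator {..a} x * \<phi> x \<partial>lebesgue_on {0..L}) = 0"
proof -
  define s where "s = pi * a / L"
  have s: "0 < s" "s < pi" using L a by (auto simp: s_def field_simps)
  define \<theta> where "\<theta> x = 2 * pi * x / L - s" for x
  define t where "t x = 1 / 2 + cos s / 4 - cos (\<theta> x) / 4" for x
  define q where "q n x = (1 - t x ^ n) ^ (2 ^ n)" for n x
  have "0 \<le> t x \<and> t x \<le> 1" for x
    using cos_le_one[of s] cos_ge_minus_one[of s] cos_le_one[of "\<theta> x"] cos_ge_minus_one[of "\<theta> x"]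
    unfolding t_def by (intro conjI; linarith)
  hence t01: "0 \<le> t x" "t x \<le> 1" for x by auto
  have wave_cos: "complex_of_real (cos (\<theta> x)) =
      exp (- \<i> * of_real s) / 2 * wave L 1 x + exp (\<i> * of_real s) / 2 * wave L (- 1) x" for x
  proof -
    have "complex_of_real (cos (\<theta> x)) = cos (of_real (\<theta> x))" by (simp add: cos_of_real)
    also have "\<dots> = (exp (\<i> * of_real (\<theta> x)) + exp (- \<i> * of_real (\<theta> x))) / 2"
      by (simp add: cos_exp_eq)
    also have "exp (\<i> * of_real (\<theta> x)) = exp (- \<i> * of_real s) * wave L 1 x"
      by (simp add: wave_def exp_add[symmetric] \<theta>_def algebra_simps)
    also have "exp (- \<i> * of_real (\<theta> x)) = exp (\<i> * of_real s) * wave L (- 1) x"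
      by (simp add: wave_def exp_add[symmetric] \<theta>_def algebra_simps)
    finally show ?thesis by (simp add: add_divide_distrib)
  qed
  have cos_trig: "(\<lambda>x. complex_of_real (cos (\<theta> x))) \<in> trig L"
    unfolding wave_cos by (intro trig.intros)
  have t_trig: "(\<lambda>x. complex_of_real (t x)) \<in> trig L"
    using trig_add[OF trig_const[of "of_real (1 / 2 + cos s / 4)"] trig_scale[OF cos_trig, of "- (1 / 4)"]]
    by (simp add: t_def)
  have q_trig: "(\<lambda>x. complex_of_real (q n x)) \<in> trig L" for n
    using trig_power[OF trig_add[OF trig_const[of 1] trig_scale[OF trig_power[OF t_trig, of n], of "- 1"]], of "2 ^ n"]
    by (simp add: q_def)
  have q01: "0 \<le> q n x" "q n x \<le> 1" for n x
    using t01[of x] unfolding q_def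
    by (auto intro!: zero_le_power power_le_one simp: power_le_one)
  have zero: "(\<integral>x. \<phi> x * of_real (q n x) \<partial>lebesgue_on {0..L}) = 0"
    and meas: "(\<lambda>x. \<phi> x * of_real (q n x)) \<in> borel_measurable (lebesgue_on {0..L})" for n
    using trig_orthogonal[OF \<phi> z L q_trig, of n] by auto
  have lim: "(\<lambda>n. \<phi> x * of_real (q n x)) \<longlonglongrightarrow> indicator {..a} x * \<phi> x"
    if x: "x \<in> {0..L}" "x \<notin> {0, a, L}" for x
  proof -
    have \<theta>: "- s < \<theta> x" "\<theta> x < 2 * pi - s" "\<theta> x < s \<longleftrightarrow> x < a" "s < \<theta> x \<longleftrightarrow> a < x"
      using x L by (auto simp: \<theta>_def s_def field_simps)
    have t: "t x < 1 / 2 \<longleftrightarrow> x < a" "t x \<noteq> 1 / 2"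
      using cos_compare_shifted[OF s \<theta>(1,2)] \<theta>(3,4) x unfolding t_def by (cases "x < a"; force)+
    have "(\<lambda>n. q n x) \<longlonglongrightarrow> (if t x < 1 / 2 then 1 else 0)"
      unfolding q_def by (rule power_step_limit[OF t01 t(2)])
    hence "(\<lambda>n. \<phi> x * of_real (q n x)) \<longlonglongrightarrow> \<phi> x * of_real (if t x < 1 / 2 then 1 else 0)"
      by (intro tendsto_intros)
    thus ?thesis using t(1) x by (auto simp: indicator_def)
  qed
  have "(\<lambda>n. \<integral>x. \<phi> x * of_real (q n x) \<partial>lebesgue_on {0..L}) \<longlonglongrightarrow>
      (\<integral>x. indicator {..a} x * \<phi> x \<partial>lebesgue_on {0..L})"
  proof (rule integral_dominated_convergence[where w = "\<lambda>x. norm (\<phi> x)"])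
    have "indicator {..a} \<in> borel_measurable (lebesgue_on {0..L})"
      by (intro measurable_restrict_space1 borel_measurable_indicator) simp
    thus "(\<lambda>x. indicator {..a} x * \<phi> x) \<in> borel_measurable (lebesgue_on {0..L})"
      using \<phi> by (intro borel_measurable_times) auto
    have "AE x in lebesgue. x \<notin> {0, a, L}"
      by (rule AE_not_in) (auto intro: finite_imp_null_set_lborel simp: null_sets_completionI)
    hence "AE x in lebesgue. x \<in> {0..L} \<longrightarrow> (\<lambda>n. \<phi> x * of_real (q n x)) \<longlonglongrightarrow> indicator {..a} x * \<phi> x"
      by eventually_elim (use lim in blast)
    thus "AE x in lebesgue_on {0..L}. (\<lambda>n. \<phi> x * of_real (q n x)) \<longlonglongrightarrow> indicator {..a} x * \<phi> x"
      by (subst AE_restrict_space_iff) simp_all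
    show "AE x in lebesgue_on {0..L}. norm (\<phi> x * of_real (q n x)) \<le> norm (\<phi> x)" for n
      using q01[of n] by (auto simp: norm_mult mult_left_le)
  qed (use meas \<phi> in auto)
  thus ?thesis using zero LIMSEQ_unique[of "\<lambda>_. 0 :: complex"] by simp
qed

text \<open>Orthogonality to the initial intervals extends to all measurable sets by a
  \<open>\<pi>\<close>-\<open>\<lambda>\<close> argument, and a function whose integral over every measurable set vanishes is zero.\<close>

lemma fcoef_zero_imp_AE_zero:
  assumes L: "L > 0" and \<phi>: "integrable (lebesgue_on {0..L}) \<phi>" and z: "\<And>n. fcoef L \<phi> n = 0"
  shows "AE x in lebesgue_on {0..L}. \<phi> x = 0"
proof -
  define \<phi>0 where "\<phi>0 x = indicator {0..L} x *\<^sub>R \<phi> x" for x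
  have int0: "integrable lebesgue \<phi>0"
    using \<phi> by (simp add: \<phi>0_def[abs_def] integrable_restrict_space)
  have total: "(\<integral>x. \<phi>0 x \<partial>lebesgue) = 0"
    using z[of 0] L by (simp add: \<phi>0_def integral_restrict_space fcoef_def)
  have atMost: "(LINT x:{..a}|lebesgue. \<phi>0 x) = 0" for a
  proof -
    have eq: "(LINT x:{..a}|lebesgue. \<phi>0 x) = (\<integral>x. indicator {..a} x * \<phi> x \<partial>lebesgue_on {0..L})"
      unfolding set_lebesgue_integral_def
      by (subst integral_restrict_space) (auto simp: \<phi>0_def indicator_def intro!: Bochner_Integration.integral_cong)
    consider "a \<le> 0" | "0 < a" "a < L" | "L \<le> a" by linarith
    thus ?thesis
    proof cases
      case 1
      have "AE x in lebesgue. x \<notin> {0 :: real}"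
        by (rule AE_not_in) (auto intro: finite_imp_null_set_lborel simp: null_sets_completionI)
      hence "AE x in lebesgue. indicator {..a} x *\<^sub>R \<phi>0 x = 0"
        by eventually_elim (use 1 in \<open>auto simp: \<phi>0_def indicator_def\<close>)
      thus ?thesis unfolding set_lebesgue_integral_def by (rule integral_eq_zero_AE)
    next
      case 2
      thus ?thesis using initial_interval_orthogonal[OF L \<phi> z] eq by simp
    next
      case 3
      have "(LINT x:{..a}|lebesgue. \<phi>0 x) = (\<integral>x. \<phi>0 x \<partial>lebesgue)"
        unfolding set_lebesgue_integral_def
        by (intro Bochner_Integration.integral_cong) (use 3 in \<open>auto simp: \<phi>0_def indicator_def\<close>)
      thus ?thesis using total by simp
    qed
  qed
  have int_set: "set_integrable lebesgue B \<phi>0" if "B \<in> sets lebesgue" for B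
    unfolding set_integrable_def using int0 that by (rule integrable_mult_indicator[rotated])
  have borel: "(LINT x:B|lebesgue. \<phi>0 x) = 0" if "B \<in> sets borel" for B
  proof -
    have sub: "sigma_sets UNIV (range (\<lambda>a. {..a :: real})) = sets borel"
      by (simp add: borel_eq_atMost)
    have leb: "B \<in> sets lebesgue" if "B \<in> sigma_sets UNIV (range (\<lambda>a. {..a :: real}))" for B
      using that unfolding sub by auto
    have "Int_stable (range (\<lambda>a. {..a :: real}))"
      by (auto simp: Int_stable_def)
    moreover have "range (\<lambda>a. {..a :: real}) \<subseteq> Pow UNIV" by simp
    moreover have "B \<in> sigma_sets UNIV (range (\<lambda>a. {..a :: real}))" using that sub by simp
    ultimately show ?thesis
    proof (induction rule: sigma_sets_induct_disjoint)
      case (basic A)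
      thus ?case using atMost by auto
    next
      case empty
      show ?case by (simp add: set_lebesgue_integral_def)
    next
      case (compl A)
      have "UNIV - A \<in> sets lebesgue"
        using sets.compl_sets[OF leb[OF compl(1)]] by simp
      hence "(LINT x:UNIV|lebesgue. \<phi>0 x) = (LINT x:A|lebesgue. \<phi>0 x) + (LINT x:(UNIV - A)|lebesgue. \<phi>0 x)"
        using set_integral_Un[of A "UNIV - A" lebesgue \<phi>0] leb[OF compl(1)] by (simp add: int_set)
      thus ?case using compl(2) total by (simp add: set_lebesgue_integral_def)
    next
      case (union A)
      have meas: "A i \<in> sets lebesgue" for i
        using union(2) by (intro leb) blast
      have "(LINT x:(\<Union>i. A i)|lebesgue. \<phi>0 x) = (\<Sum>i. (LINT x:(A i)|lebesgue. \<phi>0 x))"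
        using union(1) meas
        by (intro lebesgue_integral_countable_add int_set sets.countable_UN') (auto simp: disjoint_family_on_def)
      thus ?case using union(3) by simp
    qed
  qed
  have leb: "(LINT x:A|lebesgue. \<phi>0 x) = 0" if A_leb: "A \<in> sets lebesgue" for A
  proof -
    from A_leb obtain S N N' where A: "A = S \<union> N" "N \<subseteq> N'" "N' \<in> null_sets lborel" "S \<in> sets lborel"
      by (rule sets_completionE)
    have "AE x in lebesgue. x \<notin> N'" by (rule AE_not_in) (use A in \<open>auto intro: null_sets_completionI\<close>)
    hence ae: "AE x in lebesgue. indicat_real A x *\<^sub>R \<phi>0 x = indicat_real S x *\<^sub>R \<phi>0 x"
      by eventually_elim (use A in \<open>auto simp: indicator_def\<close>)
    have "(LINT x:A|lebesgue. \<phi>0 x) = (LINT x:S|lebesgue. \<phi>0 x)"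
      unfolding set_lebesgue_integral_def
      by (rule integral_cong_AE[OF _ _ ae])
        (use int_set[of A] int_set[of S] A A_leb in \<open>auto simp: set_integrable_def\<close>)
    thus ?thesis using borel A(4) by simp
  qed
  show ?thesis
  proof (rule sigma_finite_measure.density_zero[OF finite_measure.axioms(1)[OF finite_measure_period] \<phi>])
    fix A assume "A \<in> sets (lebesgue_on {0..L})"
    hence A: "A \<in> sets lebesgue" "A \<subseteq> {0..L}" by (auto simp: sets_restrict_space)
    have "(LINT x:A|lebesgue_on {0..L}. \<phi> x) = (LINT x:A|lebesgue. \<phi>0 x)"
      unfolding set_lebesgue_integral_def
      by (subst integral_restrict_space) (auto simp: \<phi>0_def indicator_def intro!: Bochner_Integration.integral_cong)
    thus "(LINT x:A|lebesgue_on {0..L}. \<phi> x) = 0" using leb[OF A(1)] by simp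
  qed
qed

section \<open>Absolutely convergent Fourier series\<close>

lemma filterlim_int_intervals:
  "filterlim (\<lambda>M. {- int M..int M}) (finite_subsets_at_top UNIV) sequentially"
  unfolding filterlim_finite_subsets_at_top
proof (intro allI impI)
  fix X :: "int set" assume "finite X \<and> X \<subseteq> UNIV"
  hence X: "finite X" by simp
  define K where "K = (\<Sum>k\<in>X. nat \<bar>k\<bar>)"
  have K: "\<bar>k\<bar> \<le> int K" if "k \<in> X" for k
  proof -
    have "nat \<bar>k\<bar> \<le> K" unfolding K_def using X that by (intro member_le_sum) auto
    thus ?thesis by linarith
  qed
  show "\<forall>\<^sub>F M in sequentially. finite {- int M..int M} \<and> X \<subseteq> {- int M..int M} \<and> {- int M..int M} \<subseteq> UNIV"
    using eventually_ge_at_top[of K]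
  proof eventually_elim
    case (elim M)
    have "k \<in> {- int M..int M}" if "k \<in> X" for k
      using K[OF that] elim by (simp add: abs_le_iff)
    thus ?case by auto
  qed
qed

lemma has_sum_int_LIMSEQ:
  assumes "(f has_sum S) (UNIV :: int set)"
  shows "(\<lambda>M. \<Sum>k=-int M..int M. f k) \<longlonglongrightarrow> S"
  using filterlim_compose[OF assms[unfolded has_sum_def] filterlim_int_intervals] .

lemma has_sum_int_shift:
  fixes f :: "int \<Rightarrow> 'a :: topological_comm_monoid_add"
  shows "((\<lambda>m. f (n - m)) has_sum S) UNIV \<longleftrightarrow> (f has_sum S) UNIV"
  by (rule has_sum_reindex_bij_betw)
    (rule bij_betw_byWitness[where f' = "\<lambda>m. n - m"], auto)

lemma has_sum_sum_index:
  fixes g :: "'b \<Rightarrow> 'a \<Rightarrow> 'c :: topological_comm_monoid_add"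
  assumes "\<And>j. j \<in> J \<Longrightarrow> (g j has_sum S j) A"
  shows "((\<lambda>x. \<Sum>j\<in>J. g j x) has_sum (\<Sum>j\<in>J. S j)) A"
  using assms by (induction J rule: infinite_finite_induct) (auto intro: has_sum_add)

lemma summable_on_int_abs:
  fixes g :: "nat \<Rightarrow> real"
  assumes "summable g" "\<And>n. g n \<ge> 0"
  shows "(\<lambda>k. g (nat \<bar>k\<bar>)) summable_on (UNIV :: int set)"
proof -
  have g: "g summable_on UNIV" using assms by (rule summable_nonneg_imp_summable_on)
  have "(\<lambda>k. g (nat \<bar>k\<bar>)) summable_on range int"
    using g by (subst summable_on_reindex) (auto simp: o_def)
  moreover have "(\<lambda>k. g (nat \<bar>k\<bar>)) summable_on range (\<lambda>n. - int n)"
    using g by (subst summable_on_reindex) (auto simp: o_def inj_on_def)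
  moreover have "range int \<union> range (\<lambda>n. - int n) = (UNIV :: int set)"
  proof -
    have "k \<in> range int \<union> range (\<lambda>n. - int n)" for k :: int
    proof (cases "k \<ge> 0")
      case True
      hence "k = int (nat k)" by simp
      thus ?thesis by blast
    next
      case False
      hence "k = - int (nat (- k))" by simp
      thus ?thesis by blast
    qed
    thus ?thesis by blast
  qed
  ultimately show ?thesis using summable_on_union by metis
qed

lemma measure_period: "L \<ge> 0 \<Longrightarrow> measure (lebesgue_on {0..L}) {0..L} = (L :: real)"
  by (simp add: measure_restrict_space[of "{0..L}" lebesgue])

lemma partial_sum_bound:
  assumes "(\<lambda>k. norm (c k)) summable_on (UNIV :: int set)"
  shows "norm (\<Sum>k=-int M..int M. c k * wave L (- k) x) \<le> (\<Sum>\<^sub>\<infinity>k. norm (c k))"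
proof -
  have "norm (\<Sum>k=-int M..int M. c k * wave L (- k) x) \<le> (\<Sum>k=-int M..int M. norm (c k))"
    by (rule order_trans[OF norm_sum]) (simp add: norm_mult)
  also have "\<dots> \<le> (\<Sum>\<^sub>\<infinity>k. norm (c k))"
    by (rule finite_sum_le_infsum[OF assms]) auto
  finally show ?thesis .
qed

lemma integral_partial_sum:
  assumes "integrable (lebesgue_on {0..L}) g"
  shows "(\<integral>x. (\<Sum>k\<in>A. c k * wave L (- k) x) * g x * wave L n x \<partial>lebesgue_on {0..L}) / of_real L =
    (\<Sum>k\<in>A. c k * fcoef L g (n - k))"
    and "integrable (lebesgue_on {0..L}) (\<lambda>x. (\<Sum>k\<in>A. c k * wave L (- k) x) * g x * wave L n x)"
proof -
  have i: "integrable (lebesgue_on {0..L}) (\<lambda>x. c k * (g x * wave L (n - k) x))" for k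
    by (rule integrable_mult_right[OF integrable_mult_wave[OF assms]])
  have eq: "(\<Sum>k\<in>A. c k * wave L (- k) x) * g x * wave L n x = (\<Sum>k\<in>A. c k * (g x * wave L (n - k) x))" for x
  proof -
    have "c k * wave L (- k) x * g x * wave L n x = c k * (g x * wave L (n - k) x)" for k
      using wave_mult[of L "- k" x n] by (simp add: mult_ac)
    thus ?thesis unfolding sum_distrib_right by (intro sum.cong refl)
  qed
  show "integrable (lebesgue_on {0..L}) (\<lambda>x. (\<Sum>k\<in>A. c k * wave L (- k) x) * g x * wave L n x)"
    unfolding eq by (rule Bochner_Integration.integrable_sum[OF i])
  show "(\<integral>x. (\<Sum>k\<in>A. c k * wave L (- k) x) * g x * wave L n x \<partial>lebesgue_on {0..L}) / of_real L =
    (\<Sum>k\<in>A. c k * fcoef L g (n - k))"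
    unfolding eq Bochner_Integration.integral_sum[OF i] integral_mult_right_zero fcoef_def
    by (simp only: sum_divide_distrib times_divide_eq_right)
qed

text \<open>Dominated convergence, along symmetric partial sums.\<close>

lemma fcoef_series_mult:
  assumes L: "L > 0" and c: "(\<lambda>k. norm (c k)) summable_on UNIV"
    and s: "s \<in> borel_measurable (lebesgue_on {0..L})"
      "AE x in lebesgue_on {0..L}. ((\<lambda>k. c k * wave L (- k) x) has_sum s x) UNIV"
    and g: "integrable (lebesgue_on {0..L}) g"
  shows "((\<lambda>k. c k * fcoef L g (n - k)) has_sum fcoef L (\<lambda>x. s x * g x) n) UNIV"
proof -
  define C where "C = (\<Sum>\<^sub>\<infinity>k. norm (c k))"
  let ?P = "\<lambda>M x. \<Sum>k=-int M..int M. c k * wave L (- k) x"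
  have "(\<lambda>M. (\<integral>x. ?P M x * g x * wave L n x \<partial>lebesgue_on {0..L})) \<longlonglongrightarrow>
      (\<integral>x. s x * g x * wave L n x \<partial>lebesgue_on {0..L})"
  proof (rule integral_dominated_convergence[where w = "\<lambda>x. C * norm (g x)"])
    have "wave L n \<in> borel_measurable (lebesgue_on {0..L})"
      using continuous_integrable_period[OF continuous_smooth[OF smooth_fun_wave]] by auto
    thus "(\<lambda>x. s x * g x * wave L n x) \<in> borel_measurable (lebesgue_on {0..L})"
      using g by (intro borel_measurable_times s) auto
    show "(\<lambda>x. ?P M x * g x * wave L n x) \<in> borel_measurable (lebesgue_on {0..L})" for M
      using integral_partial_sum(2)[OF g] by (rule borel_measurable_integrable)
    show "integrable (lebesgue_on {0..L}) (\<lambda>x. C * norm (g x))"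
      by (rule integrable_mult_right[OF integrable_norm[OF g]])
    show "AE x in lebesgue_on {0..L}. (\<lambda>M. ?P M x * g x * wave L n x) \<longlonglongrightarrow> s x * g x * wave L n x"
      using s(2)
    proof eventually_elim
      case (elim x)
      show ?case by (intro tendsto_mult_right has_sum_int_LIMSEQ[OF elim])
    qed
    show "AE x in lebesgue_on {0..L}. norm (?P M x * g x * wave L n x) \<le> C * norm (g x)" for M
    proof (rule AE_I2)
      fix x
      show "norm (?P M x * g x * wave L n x) \<le> C * norm (g x)"
        using mult_right_mono[OF partial_sum_bound[OF c, where M = M and L = L and x = x], of "norm (g x)"]
        by (simp add: norm_mult C_def)
    qed
  qed
  hence "(\<lambda>M. (\<integral>x. ?P M x * g x * wave L n x \<partial>lebesgue_on {0..L}) / of_real L) \<longlonglongrightarrow>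
      fcoef L (\<lambda>x. s x * g x) n"
    unfolding fcoef_def by (rule tendsto_divide[OF _ tendsto_const]) (use L in simp)
  hence lim: "(\<lambda>M. \<Sum>k=-int M..int M. c k * fcoef L g (n - k)) \<longlonglongrightarrow> fcoef L (\<lambda>x. s x * g x) n"
    unfolding integral_partial_sum(1)[OF g] .
  define B where "B = (\<integral>x. norm (g x) \<partial>lebesgue_on {0..L}) / L"
  have "(\<lambda>k. norm (c k * fcoef L g (n - k))) summable_on UNIV"
  proof (rule Infinite_Sum.abs_summable_on_comparison_test')
    show "(\<lambda>k. norm (c k) * B) summable_on UNIV" by (intro summable_on_cmult_left c)
    show "norm (c k * fcoef L g (n - k)) \<le> norm (c k) * B" for k
      unfolding norm_mult B_def by (rule mult_left_mono[OF norm_fcoef_le[OF L g]]) simp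
  qed
  hence "(\<lambda>k. c k * fcoef L g (n - k)) summable_on UNIV" by (rule abs_summable_summable)
  hence hs: "((\<lambda>k. c k * fcoef L g (n - k)) has_sum (\<Sum>\<^sub>\<infinity>k. c k * fcoef L g (n - k))) UNIV"
    by (rule has_sum_infsum)
  with LIMSEQ_unique[OF lim has_sum_int_LIMSEQ[OF hs]] show ?thesis by simp
qed

text \<open>The sum of the series has the same coefficients as \<open>f\<close>, so completeness identifies the
  two.\<close>

lemma absolutely_convergent_fourier_series:
  assumes L: "L > 0" and f: "integrable (lebesgue_on {0..L}) f"
    and c: "(\<lambda>k. norm (fcoef L f k)) summable_on UNIV"
  shows "AE x in lebesgue_on {0..L}. ((\<lambda>k. fcoef L f k * wave L (- k) x) has_sum f x) UNIV"
proof -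
  define s where "s x = (\<Sum>\<^sub>\<infinity>k. fcoef L f k * wave L (- k) x)" for x
  have "(\<lambda>k. norm (fcoef L f k * wave L (- k) x)) summable_on UNIV" for x
    using c by (simp add: norm_mult)
  hence s: "((\<lambda>k. fcoef L f k * wave L (- k) x) has_sum s x) UNIV" for x
    unfolding s_def by (rule has_sum_infsum[OF abs_summable_summable])
  have wave_meas: "wave L n \<in> borel_measurable (lebesgue_on {0..L})" for n
    using continuous_integrable_period[OF continuous_smooth[OF smooth_fun_wave]] by auto
  have s_meas: "s \<in> borel_measurable (lebesgue_on {0..L})"
  proof (rule borel_measurable_LIMSEQ_metric)
    show "(\<lambda>M. \<Sum>k=-int M..int M. fcoef L f k * wave L (- k) x) \<longlonglongrightarrow> s x" for x
      by (rule has_sum_int_LIMSEQ[OF s])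
    show "(\<lambda>x. \<Sum>k=-int M..int M. fcoef L f k * wave L (- k) x) \<in> borel_measurable (lebesgue_on {0..L})" for M
      by (intro borel_measurable_sum borel_measurable_times wave_meas borel_measurable_const)
  qed
  have s_int: "integrable (lebesgue_on {0..L}) s"
  proof (rule finite_measure.integrable_const_bound[OF finite_measure_period _ s_meas])
    show "AE x in lebesgue_on {0..L}. norm (s x) \<le> (\<Sum>\<^sub>\<infinity>k. norm (fcoef L f k))"
      by (intro AE_I2 norm_infsum_le[OF s has_sum_infsum[OF c]]) (simp add: norm_mult)
  qed
  have s_coef: "fcoef L s n = fcoef L f n" for n
  proof -
    have one: "integrable (lebesgue_on {0..L}) (wave L 0)"
      by (intro continuous_integrable_period continuous_smooth smooth_fun_wave)
    have "((\<lambda>k. fcoef L f k * fcoef L (wave L 0) (n - k)) has_sum fcoef L (\<lambda>x. s x * wave L 0 x) n) UNIV"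
      by (intro fcoef_series_mult L c s_meas AE_I2 s one)
    moreover have "fcoef L f k * fcoef L (wave L 0) (n - k) = (if k = n then fcoef L f n else 0)" for k
      using fcoef_wave[OF L, of 0 "n - k"] by auto
    hence "((\<lambda>k. fcoef L f k * fcoef L (wave L 0) (n - k)) has_sum fcoef L f n) UNIV"
      by (simp only:) (rule has_sum_finite_neutralI[where B = "{n}"], auto)
    ultimately have "fcoef L (\<lambda>x. s x * wave L 0 x) n = fcoef L f n" by (rule has_sum_unique)
    thus ?thesis by simp
  qed
  have "fcoef L (\<lambda>x. f x - s x) n = 0" for n
  proof -
    have "(\<integral>x. (f x - s x) * wave L n x \<partial>lebesgue_on {0..L}) =
        (\<integral>x. f x * wave L n x \<partial>lebesgue_on {0..L}) - (\<integral>x. s x * wave L n x \<partial>lebesgue_on {0..L})"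
      unfolding left_diff_distrib
      by (intro Bochner_Integration.integral_diff integrable_mult_wave f s_int)
    thus ?thesis using s_coef[of n] L by (simp add: fcoef_def)
  qed
  hence "AE x in lebesgue_on {0..L}. f x - s x = 0"
    by (intro fcoef_zero_imp_AE_zero[OF L] Bochner_Integration.integrable_diff f s_int)
  thus ?thesis
    by eventually_elim (use s in auto)
qed

lemma fcoef_mult:
  assumes L: "L > 0" and f: "integrable (lebesgue_on {0..L}) f"
    and c: "(\<lambda>k. norm (fcoef L f k)) summable_on UNIV"
    and g: "integrable (lebesgue_on {0..L}) g"
  shows "((\<lambda>m. fcoef L f (n - m) * fcoef L g m) has_sum fcoef L (\<lambda>x. f x * g x) n) UNIV"
proof -
  have "((\<lambda>k. fcoef L f k * fcoef L g (n - k)) has_sum fcoef L (\<lambda>x. f x * g x) n) UNIV"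
    by (rule fcoef_series_mult[OF L c borel_measurable_integrable[OF f]
          absolutely_convergent_fourier_series[OF L f c] g])
  thus ?thesis
    using has_sum_int_shift[of "\<lambda>k. fcoef L f k * fcoef L g (n - k)" n] by simp
qed

section \<open>Decay of Fourier coefficients\<close>

text \<open>Trades the weight for a derivative; the summand \<open>1\<close> takes care of \<open>n = 0\<close>, where the
  frequency vanishes.\<close>

lemma weight_le_freq:
  assumes L: "L > 0"
  shows "(1 + \<bar>real_of_int n\<bar>) ^ j \<le> 1 + (L / pi) ^ j * norm (freq L n) ^ j"
proof (cases "n = 0")
  case False
  have "(1 + \<bar>real_of_int n\<bar>) ^ j \<le> (2 * \<bar>real_of_int n\<bar>) ^ j"
    by (rule power_mono) (use False in linarith, simp)
  also have "2 * \<bar>real_of_int n\<bar> = L / pi * norm (freq L n)"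
    using L by (simp add: freq_def norm_mult norm_divide)
  also have "(L / pi * norm (freq L n)) ^ j = (L / pi) ^ j * norm (freq L n) ^ j"
    by (rule power_mult_distrib)
  finally show ?thesis by linarith
qed (use L in auto)

lemma smooth_fcoef_decay:
  assumes L: "L > 0" and u: "smooth_fun u" "has_period L u"
  obtains C where "\<And>n. (1 + \<bar>real_of_int n\<bar>) ^ j * norm (fcoef L u n) \<le> C"
proof -
  let ?g = "nth_deriv j u"
  have ig: "integrable (lebesgue_on {0..L}) ?g" "integrable (lebesgue_on {0..L}) u"
    by (intro continuous_integrable_period continuous_nth_deriv continuous_smooth u)+
  define A where "A = (\<integral>x. norm (u x) \<partial>lebesgue_on {0..L}) / L"
  define B where "B = (\<integral>x. norm (?g x) \<partial>lebesgue_on {0..L}) / L"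
  have "(1 + \<bar>real_of_int n\<bar>) ^ j * norm (fcoef L u n) \<le> A + (L / pi) ^ j * B" for n
  proof -
    have "(1 + \<bar>real_of_int n\<bar>) ^ j * norm (fcoef L u n) \<le>
        (1 + (L / pi) ^ j * norm (freq L n) ^ j) * norm (fcoef L u n)"
      by (rule mult_right_mono[OF weight_le_freq[OF L]]) simp
    also have "\<dots> = norm (fcoef L u n) + (L / pi) ^ j * norm (fcoef L ?g n)"
      unfolding fcoef_weak_deriv[OF L smooth_has_weak_deriv[OF L u]]
      by (simp add: norm_mult norm_power distrib_right)
    also have "\<dots> \<le> A + (L / pi) ^ j * B"
      unfolding A_def B_def by (intro add_mono mult_left_mono norm_fcoef_le L ig) (use L in simp)
    finally show ?thesis .
  qed
  thus thesis by (rule that)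
qed

lemma summable_inverse_squares_int:
  "(\<lambda>k. 1 / (1 + \<bar>real_of_int k\<bar>) ^ 2) summable_on UNIV"
proof -
  have "summable (\<lambda>n. 1 / (1 + real n) ^ 2)"
    using inverse_power_summable[of 2, where ?'a = real] summable_Suc_iff[of "\<lambda>n. inverse (real n ^ 2)"]
    by (simp add: field_simps)
  from summable_on_int_abs[OF this] show ?thesis by simp
qed

lemma smooth_fcoef_summable:
  assumes "L > 0" "smooth_fun u" "has_period L u"
  shows "(\<lambda>k. norm (fcoef L u k) * (1 + \<bar>real_of_int k\<bar>) ^ q) summable_on UNIV"
proof -
  obtain C where C: "\<And>n. (1 + \<bar>real_of_int n\<bar>) ^ (q + 2) * norm (fcoef L u n) \<le> C"
    using smooth_fcoef_decay[OF assms, of "q + 2"] by blast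
  have "(\<lambda>k. C * (1 / (1 + \<bar>real_of_int k\<bar>) ^ 2)) summable_on UNIV"
    by (intro summable_on_cmult_right summable_inverse_squares_int)
  thus ?thesis
  proof (rule summable_on_comparison_test)
    fix k
    have "norm (fcoef L u k) * (1 + \<bar>real_of_int k\<bar>) ^ q * (1 + \<bar>real_of_int k\<bar>) ^ 2 \<le> C"
      using C[of k] unfolding power_add by (simp only: mult_ac)
    thus "norm (fcoef L u k) * (1 + \<bar>real_of_int k\<bar>) ^ q \<le> C * (1 / (1 + \<bar>real_of_int k\<bar>) ^ 2)"
      by (simp add: pos_le_divide_eq)
  qed simp
qed

lemma strip_halfplanes: "strip d = {z. Im z < d} \<inter> {z. Im z > - d}"
  by (auto simp: strip_def)

lemma open_strip: "open (strip d)"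
  unfolding strip_halfplanes by (intro open_Int open_halfspace_Im_lt open_halfspace_Im_gt)

lemma convex_strip: "convex (strip d)"
  unfolding strip_halfplanes by (intro convex_Int convex_halfspace_Im_lt convex_halfspace_Im_gt)

text \<open>Periodicity on the real axis carries over to the strip by the identity theorem.\<close>

lemma periodic_extension_to_strip:
  assumes d: "d > 0" and u: "has_period L u" and F: "F holomorphic_on strip d"
    and Fu: "\<And>x. F (complex_of_real x) = u x" and z: "z \<in> strip d"
  shows "F (z + of_real L) = F z"
proof -
  have shift: "w + of_real L \<in> strip d" if "w \<in> strip d" for w using that by (simp add: strip_def)
  have "(\<lambda>w. F (w + of_real L) - F w) holomorphic_on strip d"
    by (intro holomorphic_intros F holomorphic_on_compose_gen[OF _ F, of "\<lambda>w. w + of_real L", unfolded o_def])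
      (use shift in auto)
  moreover have "(0 :: complex) islimpt range complex_of_real"
    unfolding islimpt_approachable
  proof (intro allI impI)
    fix e :: real assume "e > 0"
    thus "\<exists>x'\<in>range complex_of_real. x' \<noteq> 0 \<and> dist x' 0 < e"
      by (intro bexI[of _ "complex_of_real (e / 2)"] rangeI) auto
  qed
  moreover have "range complex_of_real \<subseteq> strip d" using d by (auto simp: strip_def)
  moreover have "F (w + of_real L) - F w = 0" if "w \<in> range complex_of_real" for w
    using that u Fu by (auto simp: has_period_def simp flip: of_real_add)
  ultimately have "F (z + of_real L) - F z = 0"
    using analytic_continuation[of "\<lambda>w. F (w + of_real L) - F w" "strip d" "range complex_of_real" 0 z]
      open_strip convex_connected[OF convex_strip] d z by (auto simp: strip_def)
  thus ?thesis by simp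
qed

text \<open>Shifting the line of integration needs no contour here: a primitive \<open>H\<close> exists on the
  convex strip, \<open>H (z + L) - H z\<close> has derivative zero, and this constant is the integral over every
  horizontal segment of length \<open>L\<close>.\<close>

lemma integral_period_shift_contour:
  assumes L: "L > 0" and G: "G holomorphic_on strip d"
    and per: "\<And>z. z \<in> strip d \<Longrightarrow> G (z + of_real L) = G z" and t: "\<bar>t\<bar> < d"
  shows "(\<integral>x. G (of_real x + \<i> * of_real t) \<partial>lebesgue_on {0..L}) = (\<integral>x. G (of_real x) \<partial>lebesgue_on {0..L})"
proof -
  obtain H where H: "\<And>z. z \<in> strip d \<Longrightarrow> (H has_field_derivative G z) (at z within strip d)"
    using holomorphic_convex_primitive'[OF convex_strip open_strip G] by blast
  have H': "(H has_field_derivative G z) (at z)" if "z \<in> strip d" for z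
    using H[OF that] at_within_open[OF that open_strip] by simp
  have shift: "w + of_real L \<in> strip d" if "w \<in> strip d" for w using that by (simp add: strip_def)
  have "\<exists>c. \<forall>z\<in>strip d. H (z + of_real L) - H z = c"
  proof (rule has_field_derivative_zero_constant[OF convex_strip])
    fix z assume z: "z \<in> strip d"
    have "((\<lambda>w. H (w + of_real L)) has_field_derivative G (z + of_real L) * 1) (at z)"
      by (rule DERIV_chain'[where f = "\<lambda>w. w + of_real L", OF _ H'[OF shift[OF z]]])
        (auto intro!: derivative_eq_intros)
    from DERIV_diff[OF this H'[OF z]] per[OF z]
    show "((\<lambda>w. H (w + of_real L) - H w) has_field_derivative 0) (at z within strip d)"
      by (simp add: has_field_derivative_at_within)
  qed
  then obtain c where c: "\<And>z. z \<in> strip d \<Longrightarrow> H (z + of_real L) - H z = c" by blast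
  have "(\<integral>x. G (of_real x + \<i> * of_real s) \<partial>lebesgue_on {0..L}) = c" if s: "\<bar>s\<bar> < d" for s
  proof -
    have mem: "of_real x + \<i> * of_real s \<in> strip d" for x using s by (simp add: strip_def)
    have cont: "continuous_on {0..L} (\<lambda>x. G (of_real x + \<i> * of_real s))"
      by (rule continuous_on_compose2[OF holomorphic_on_imp_continuous_on[OF G]])
        (use mem in \<open>auto intro!: continuous_intros\<close>)
    have "((\<lambda>x. H (of_real x + \<i> * of_real s)) has_vector_derivative G (of_real x + \<i> * of_real s)) (at x)" for x
    proof -
      have "((\<lambda>w. H (w + \<i> * of_real s)) has_field_derivative G (of_real x + \<i> * of_real s) * 1) (at (of_real x))"
        by (rule DERIV_chain'[where f = "\<lambda>w. w + \<i> * of_real s", OF _ H'[OF mem]])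
          (auto intro!: derivative_eq_intros)
      from has_vector_derivative_real_field[OF this] show ?thesis by simp
    qed
    hence "(\<integral>x. G (of_real x + \<i> * of_real s) \<partial>lebesgue_on {0..L}) =
        H (of_real L + \<i> * of_real s) - H (of_real 0 + \<i> * of_real s)"
      using L by (intro integral_period_deriv cont) auto
    also have "\<dots> = c" using c[OF mem[of 0]] by (simp add: add.commute)
    finally show ?thesis .
  qed
  from this[OF t] this[of 0] t show ?thesis by simp
qed

text \<open>Shift by \<open>\<delta>\<close> upwards or downwards, according to the sign of \<open>n\<close>, so that the exponential
  has modulus \<open>exp (- 2 \<pi> \<delta> \<bar>n\<bar> / L)\<close> on the new line.\<close>

lemma analytic_fcoef_decay:
  assumes L: "L > 0" and \<delta>: "0 < \<delta>" "\<delta> < d" and u: "has_period L u" "analytic_on_strip d u"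
  obtains C where "C \<ge> 0" "\<And>n. norm (fcoef L u n) \<le> C * exp (- (2 * pi * \<delta> / L) * \<bar>real_of_int n\<bar>)"
proof -
  obtain F where "F analytic_on strip d" and Fu: "\<And>x. F (complex_of_real x) = u x"
    using u(2) unfolding analytic_on_strip_def by blast
  hence F: "F holomorphic_on strip d" by (simp add: analytic_imp_holomorphic)
  have d: "d > 0" using \<delta> by simp
  define R where "R = cbox (Complex 0 (- \<delta>)) (Complex L \<delta>)"
  have "R \<subseteq> strip d" using \<delta> by (auto simp: R_def cbox_def Basis_complex_def strip_def)
  hence "compact (F ` R)"
    unfolding R_def by (intro compact_continuous_image compact_cbox)
      (rule continuous_on_subset[OF holomorphic_on_imp_continuous_on[OF F]])
  then obtain C where C: "\<And>z. z \<in> R \<Longrightarrow> norm (F z) \<le> C"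
    using compact_imp_bounded bounded_iff by (metis imageI)
  have C0: "C \<ge> 0"
  proof -
    have "Complex 0 0 \<in> R" using L \<delta> by (auto simp: R_def cbox_def Basis_complex_def)
    from C[OF this] norm_ge_zero show ?thesis by (rule order_trans[rotated])
  qed
  have "norm (fcoef L u n) \<le> C * exp (- (2 * pi * \<delta> / L) * \<bar>real_of_int n\<bar>)" for n
  proof -
    define G where "G z = F z * exp (\<i> * (of_real (2 * pi * of_int n / L) * z))" for z
    define t where "t = (if n \<ge> 0 then \<delta> else - \<delta>)"
    have t: "\<bar>t\<bar> < d" "real_of_int n * t = \<delta> * \<bar>real_of_int n\<bar>" "- \<delta> \<le> t" "t \<le> \<delta>"
      using \<delta> by (auto simp: t_def)
    have G: "G holomorphic_on strip d" unfolding G_def by (intro holomorphic_intros F)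
    have "wave L n L = wave L n 0" using has_period_wave[OF L, of n] by (metis add_0 has_period_def)
    hence e1: "exp (\<i> * of_real (2 * pi * of_int n * L / L)) = 1" by (simp add: wave_def)
    have per: "G (z + of_real L) = G z" if "z \<in> strip d" for z
    proof -
      have e: "complex_of_real (2 * pi * of_int n / L) * of_real L = of_real (2 * pi * of_int n * L / L)"
        by (simp only: of_real_mult[symmetric] times_divide_eq_left)
      have "exp (\<i> * (of_real (2 * pi * of_int n / L) * (z + of_real L))) =
          exp (\<i> * (of_real (2 * pi * of_int n / L) * z)) * exp (\<i> * of_real (2 * pi * of_int n * L / L))"
        by (simp only: distrib_left e exp_add)
      thus ?thesis using periodic_extension_to_strip[OF d u(1) F Fu that] e1 unfolding G_def by simp
    qed
    have "fcoef L u n = (\<integral>x. G (of_real x) \<partial>lebesgue_on {0..L}) / of_real L"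
      unfolding fcoef_def G_def Fu wave_def by (simp add: mult_ac)
    also have "\<dots> = (\<integral>x. G (of_real x + \<i> * of_real t) \<partial>lebesgue_on {0..L}) / of_real L"
      using integral_period_shift_contour[OF L G per t(1)] by simp
    finally have eq: "fcoef L u n = (\<integral>x. G (of_real x + \<i> * of_real t) \<partial>lebesgue_on {0..L}) / of_real L" .
    define E where "E = exp (- (2 * pi * \<delta> / L) * \<bar>real_of_int n\<bar>)"
    have bound: "norm (G (of_real x + \<i> * of_real t)) \<le> C * E" if x: "x \<in> {0..L}" for x
    proof -
      have "of_real x + \<i> * of_real t \<in> R" using x t by (auto simp: R_def cbox_def Basis_complex_def)
      hence fC: "norm (F (of_real x + \<i> * of_real t)) \<le> C" by (rule C)
      have "Re (\<i> * (of_real (2 * pi * of_int n / L) * (of_real x + \<i> * of_real t))) =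
          - (2 * pi / L) * (real_of_int n * t)" by simp
      also have "\<dots> = - (2 * pi * \<delta> / L) * \<bar>real_of_int n\<bar>" unfolding t(2) by simp
      finally have nE: "norm (exp (\<i> * (of_real (2 * pi * of_int n / L) * (of_real x + \<i> * of_real t)))) = E"
        unfolding norm_exp_eq_Re E_def by simp
      show ?thesis unfolding G_def norm_mult nE by (rule mult_right_mono[OF fC]) (simp add: E_def)
    qed
    have mem: "of_real x + \<i> * of_real t \<in> strip d" for x using t(1) by (simp add: strip_def)
    have cont: "continuous_on {0..L} (\<lambda>x. G (of_real x + \<i> * of_real t))"
      by (rule continuous_on_compose2[OF holomorphic_on_imp_continuous_on[OF G]])
        (use mem in \<open>auto intro!: continuous_intros\<close>)
    have "norm (\<integral>x. G (of_real x + \<i> * of_real t) \<partial>lebesgue_on {0..L}) \<le>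
        (\<integral>x. norm (G (of_real x + \<i> * of_real t)) \<partial>lebesgue_on {0..L})"
      by (rule integral_norm_bound)
    also have "\<dots> \<le> (\<integral>x. C * E \<partial>lebesgue_on {0..L})"
      by (intro integral_mono integrable_norm continuous_integrable_period cont continuous_intros)
        (use bound in auto)
    also have "\<dots> = L * (C * E)" using L by (simp add: measure_period)
    finally show ?thesis
      unfolding eq E_def[symmetric] using L by (simp add: norm_divide divide_le_eq mult_ac)
  qed
  thus thesis using C0 that by blast
qed

section \<open>A bootstrap for convolution inequalities\<close>

text \<open>Submultiplicativity gives \<open>(1 + \<bar>n\<bar>) v n b n \<le> S G\<close>, where \<open>G\<close> is the supremum of
  \<open>v b\<close> and \<open>S\<close> the sum of \<open>F v\<close>. Once \<open>1 + \<bar>n\<bar> \<ge> 2 S\<close> this reads \<open>v n b n \<le> G / 2\<close>, so the supremum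
  is controlled by the finitely many remaining indices. The argument is circular unless \<open>G\<close> is
  known to be finite, and this is what the truncated weight in the proof provides.\<close>

lemma weighted_convolution_bound:
  fixes b F v :: "int \<Rightarrow> real"
  assumes b0: "\<And>n. 0 \<le> b n" and bB: "\<And>n. b n \<le> B0" and F0: "\<And>n. 0 \<le> F n"
    and v1: "\<And>n. 1 \<le> v n" and vmul: "\<And>m k. v (m + k) \<le> v m * v k"
    and sumF: "(\<lambda>k. F k * v k) summable_on UNIV"
    and conv: "\<And>n. (1 + \<bar>real_of_int n\<bar>) * b n \<le> (\<Sum>\<^sub>\<infinity>m. F (n - m) * b m)"
  obtains B where "\<And>n. v n * b n \<le> B"
proof -
  define S where "S = (\<Sum>\<^sub>\<infinity>k. F k * v k)"
  have v0: "0 \<le> v n" for n using v1[of n] by simp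
  have S0: "S \<ge> 0" unfolding S_def by (intro infsum_nonneg) (simp add: F0 v0)
  have bij: "bij_betw (\<lambda>m. n - m) UNIV (UNIV :: int set)" for n
    by (rule bij_betw_byWitness[where f' = "\<lambda>m. n - m"]) auto
  have shift: "(\<lambda>m. F (n - m) * v (n - m)) summable_on UNIV"
    "(\<Sum>\<^sub>\<infinity>m. F (n - m) * v (n - m)) = S" for n
    using summable_on_reindex_bij_betw[OF bij, of "\<lambda>k. F k * v k" n]
      infsum_reindex_bij_betw[OF bij, of "\<lambda>k. F k * v k" n] sumF by (simp_all add: S_def)
  obtain n0 :: nat where n0: "2 * S \<le> real n0" using real_arch_simple by blast
  define K0 where "K0 = (\<Sum>n\<in>{-int n0..int n0}. v n * b n)"
  have K0: "K0 \<ge> 0" unfolding K0_def by (intro sum_nonneg) (simp add: b0 v0)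
  have "v n * b n \<le> K0" for n
  proof -
    define M where "M = v n"
    define w where "w k = min (v k) M" for k
    have M1: "M \<ge> 1" by (simp add: M_def v1)
    have w0: "0 \<le> w k" "w k \<le> v k" "w k \<le> M" for k using v0[of k] M1 by (auto simp: w_def)
    \<comment> \<open>Truncating the weight keeps the one property that the convolution needs, and makes the
      supremum below finite beforehand.\<close>
    have wv: "w k \<le> v (k - m) * w m" for k m
    proof (cases "v m \<le> M")
      case True
      thus ?thesis using vmul[of "k - m" m] w0(2)[of k] by (simp add: w_def min_def)
    next
      case False
      hence "w m = M" by (simp add: w_def)
      thus ?thesis using order_trans[OF w0(3)[of k]] mult_right_mono[OF v1[of "k - m"], of M] M1 by simp
    qed
    define G where "G = (SUP k. w k * b k)"
    have bdd: "bdd_above (range (\<lambda>k. w k * b k))"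
      by (rule bdd_aboveI2[where M = "M * B0"]) (use w0 b0 bB M1 in \<open>auto intro!: mult_mono\<close>)
    have G: "w k * b k \<le> G" for k unfolding G_def by (rule cSUP_upper[OF _ bdd]) auto
    have G0: "G \<ge> 0" using G[of 0] w0(1)[of 0] b0[of 0] by (meson mult_nonneg_nonneg order_trans)
    have key: "(1 + \<bar>real_of_int k\<bar>) * (w k * b k) \<le> S * G" for k
    proof -
      have s1: "(\<lambda>m. F (k - m) * v (k - m) * G) summable_on UNIV"
        by (intro summable_on_cmult_left shift)
      have le: "w k * (F (k - m) * b m) \<le> F (k - m) * v (k - m) * G" for m
      proof -
        have "w k * (F (k - m) * b m) \<le> (v (k - m) * w m) * (F (k - m) * b m)"
          by (intro mult_right_mono wv) (simp add: F0 b0)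
        also have "\<dots> = F (k - m) * v (k - m) * (w m * b m)" by simp
        also have "\<dots> \<le> F (k - m) * v (k - m) * G"
          by (intro mult_left_mono G) (simp add: F0 v0)
        finally show ?thesis .
      qed
      have s2: "(\<lambda>m. w k * (F (k - m) * b m)) summable_on UNIV"
        by (rule summable_on_comparison_test[OF s1]) (use le w0 F0 b0 in auto)
      have "(1 + \<bar>real_of_int k\<bar>) * (w k * b k) = w k * ((1 + \<bar>real_of_int k\<bar>) * b k)" by simp
      also have "\<dots> \<le> w k * (\<Sum>\<^sub>\<infinity>m. F (k - m) * b m)" by (intro mult_left_mono conv w0)
      also have "\<dots> = (\<Sum>\<^sub>\<infinity>m. w k * (F (k - m) * b m))"
        by (subst infsum_cmult_right') simp
      also have "\<dots> \<le> (\<Sum>\<^sub>\<infinity>m. F (k - m) * v (k - m) * G)"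
        by (intro infsum_mono s1 s2 le)
      also have "\<dots> = S * G" by (simp add: infsum_cmult_left' shift)
      finally show ?thesis .
    qed
    have "w k * b k \<le> max K0 (G / 2)" for k
    proof (cases "\<bar>k\<bar> \<le> int n0")
      case True
      hence "v k * b k \<le> K0"
        unfolding K0_def by (intro member_le_sum) (auto simp: b0 v0)
      moreover have "w k * b k \<le> v k * b k" by (intro mult_right_mono w0 b0)
      ultimately show ?thesis by linarith
    next
      case False
      hence "2 * S \<le> 1 + \<bar>real_of_int k\<bar>" using n0 by linarith
      hence "2 * S * (w k * b k) \<le> S * G"
        using key[of k] mult_right_mono[of "2 * S" "1 + \<bar>real_of_int k\<bar>" "w k * b k"] w0(1)[of k] b0[of k]
        by (meson mult_nonneg_nonneg order_trans)
      hence "S * (2 * (w k * b k)) \<le> S * G" by (simp add: mult_ac)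
      moreover have "(1 + \<bar>real_of_int k\<bar>) * (w k * b k) \<ge> w k * b k"
        using mult_right_mono[of 1 "1 + \<bar>real_of_int k\<bar>" "w k * b k"] w0(1)[of k] b0[of k] by simp
      ultimately have "2 * (w k * b k) \<le> G"
        using key[of k] S0 G0 by (cases "S = 0") auto
      thus ?thesis by simp
    qed
    hence "G \<le> max K0 (G / 2)" unfolding G_def by (intro cSUP_least) auto
    hence "G \<le> K0" using G0 K0 by (auto simp: max_def split: if_splits)
    thus ?thesis using G[of n] by (simp add: w_def M_def)
  qed
  thus thesis by (rule that)
qed

section \<open>Approximate eigenvalues of Hermitian matrices\<close>

lemma hermitian_matrix_symmetric:
  fixes B :: "'a \<Rightarrow> 'a \<Rightarrow> complex"
  assumes "finite I" "\<And>i j. i \<in> I \<Longrightarrow> j \<in> I \<Longrightarrow> B j i = cnj (B i j)"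
  shows "(\<Sum>i\<in>I. (\<Sum>j\<in>I. B i j * a j) * cnj (b i)) = (\<Sum>i\<in>I. a i * cnj (\<Sum>j\<in>I. B i j * b j))"
proof -
  have "(\<Sum>i\<in>I. (\<Sum>j\<in>I. B i j * a j) * cnj (b i)) = (\<Sum>i\<in>I. \<Sum>j\<in>I. B i j * a j * cnj (b i))"
    by (simp add: sum_distrib_right)
  also have "\<dots> = (\<Sum>j\<in>I. \<Sum>i\<in>I. B i j * a j * cnj (b i))" by (rule sum.swap)
  also have "\<dots> = (\<Sum>j\<in>I. a j * cnj (\<Sum>i\<in>I. B j i * b i))"
  proof (rule sum.cong[OF refl])
    fix j assume j: "j \<in> I"
    have "(\<Sum>i\<in>I. B i j * a j * cnj (b i)) = (\<Sum>i\<in>I. a j * cnj (B j i * b i))"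
      using assms(2)[OF j] by (intro sum.cong refl) (auto simp: mult_ac)
    thus "(\<Sum>i\<in>I. B i j * a j * cnj (b i)) = a j * cnj (\<Sum>i\<in>I. B j i * b i)"
      by (simp add: sum_distrib_left)
  qed
  finally show ?thesis .
qed

text \<open>The index set varies with \<open>N\<close>, so vectors are functions that vanish off a finite set, and
  compactness comes from Tychonoff's theorem.\<close>

lemma compact_unit_sphere_functions:
  assumes "finite I"
  shows "compact {c :: 'a \<Rightarrow> complex. (\<forall>i. i \<notin> I \<longrightarrow> c i = 0) \<and> (\<Sum>i\<in>I. (cmod (c i))\<^sup>2) = 1}"
    (is "compact ?K")
proof -
  let ?P = "PiE UNIV (\<lambda>i. if i \<in> I then cball 0 1 else {0 :: complex})"
  have "compactin (product_topology (\<lambda>i. euclidean) UNIV) ?P"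
    by (subst compactin_PiE) auto
  hence P: "compact ?P" by (simp add: euclidean_product_topology)
  have C: "closed {c :: 'a \<Rightarrow> complex. (\<Sum>i\<in>I. (cmod (c i))\<^sup>2) = 1}"
    by (intro closed_Collect_eq continuous_intros continuous_on_product_coordinates)
  have "?K = ?P \<inter> {c. (\<Sum>i\<in>I. (cmod (c i))\<^sup>2) = 1}"
  proof -
    have "cmod (c i) \<le> 1" if "(\<Sum>i\<in>I. (cmod (c i))\<^sup>2) = 1" "i \<in> I" for c i
    proof -
      have "(cmod (c i))\<^sup>2 \<le> 1"
        using member_le_sum[of i I "\<lambda>i. (cmod (c i))\<^sup>2"] that assms by simp
      thus ?thesis using power2_le_imp_le[of "cmod (c i)" 1] by simp
    qed
    thus ?thesis by (auto simp: PiE_iff split: if_splits)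
  qed
  thus ?thesis using compact_Int_closed[OF P C] by simp
qed

text \<open>Put \<open>B = M - l\<close> and minimise \<open>\<parallel>B c\<parallel>\<close> over unit vectors. If \<open>m\<close> is the minimum, a minimiser
  satisfies \<open>B\<^sup>2 u = m\<^sup>2 u\<close>, and factoring \<open>B\<^sup>2 - m\<^sup>2\<close> shows that \<open>- m\<close> or \<open>m\<close> is an eigenvalue of
  \<open>B\<close>. By minimality \<open>m \<parallel>v\<parallel> \<le> \<parallel>B v\<parallel>\<close>.\<close>

lemma hermitian_approx_eigenvalue:
  fixes M :: "'a \<Rightarrow> 'a \<Rightarrow> complex" and l :: real
  assumes I: "finite I" and herm: "\<And>i j. i \<in> I \<Longrightarrow> j \<in> I \<Longrightarrow> M j i = cnj (M i j)"
    and v: "\<exists>i\<in>I. v i \<noteq> 0"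
  obtains \<mu> c where "\<exists>i\<in>I. c i \<noteq> 0" "\<And>i. i \<in> I \<Longrightarrow> (\<Sum>j\<in>I. M i j * c j) = \<mu> * c i"
    "(cmod (complex_of_real l - \<mu>))\<^sup>2 * (\<Sum>i\<in>I. (cmod (v i))\<^sup>2) \<le>
       (\<Sum>i\<in>I. (cmod ((\<Sum>j\<in>I. M i j * v j) - complex_of_real l * v i))\<^sup>2)"
proof -
  define B where "B i j = M i j - (if i = j then complex_of_real l else 0)" for i j
  define app where "app c i = (\<Sum>j\<in>I. B i j * c j)" for c i
  define nsq where "nsq c = (\<Sum>i\<in>I. (cmod (c i))\<^sup>2)" for c :: "'a \<Rightarrow> complex"
  define ip where "ip a b = (\<Sum>i\<in>I. a i * cnj (b i))" for a b :: "'a \<Rightarrow> complex"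
  have app_M: "app c i = (\<Sum>j\<in>I. M i j * c j) - complex_of_real l * c i" if "i \<in> I" for c i
  proof -
    have "app c i = (\<Sum>j\<in>I. M i j * c j) - (\<Sum>j\<in>I. if i = j then complex_of_real l * c j else 0)"
      unfolding app_def B_def sum_subtractf[symmetric]
      by (intro sum.cong refl) (auto simp: algebra_simps)
    thus ?thesis using that I by simp
  qed
  have symm: "ip (app a) b = ip a (app b)" for a b
    unfolding ip_def app_def
  proof (rule hermitian_matrix_symmetric[OF I])
    fix i j assume "i \<in> I" "j \<in> I"
    from herm[OF this] show "B j i = cnj (B i j)" unfolding B_def by simp
  qed
  have ip_self: "ip a a = of_real (nsq a)" for a
    unfolding ip_def nsq_def by (simp add: complex_norm_square del: of_real_power)
  have nsq0: "nsq a \<ge> 0" for a unfolding nsq_def by (simp add: sum_nonneg)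
  have nsq_zero: "nsq a = 0 \<longleftrightarrow> (\<forall>i\<in>I. a i = 0)" for a
    unfolding nsq_def by (simp add: sum_nonneg_eq_0_iff I)
  have nsq_add: "nsq (\<lambda>i. a i + of_real t * b i) = nsq a + 2 * t * Re (ip a b) + t\<^sup>2 * nsq b" for a b t
  proof -
    have eq: "(cmod (x + of_real t * y))\<^sup>2 = (cmod x)\<^sup>2 + 2 * t * Re (x * cnj y) + t\<^sup>2 * (cmod y)\<^sup>2" for x y
      unfolding cmod_power2 by (simp add: algebra_simps power2_eq_square)
    show ?thesis
      unfolding nsq_def ip_def Re_sum sum_distrib_left sum.distrib[symmetric]
      by (intro sum.cong refl eq)
  qed
  have app_scale: "app (\<lambda>i. s * a i) i = s * app a i" for s a i
    unfolding app_def by (simp add: sum_distrib_left mult_ac)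
  have app_add: "app (\<lambda>i. a i + s * b i) i = app a i + s * app b i" for s a b i
    unfolding app_def by (simp add: sum_distrib_left sum.distrib algebra_simps)
  have nsq_scale: "nsq (\<lambda>i. of_real s * a i) = s\<^sup>2 * nsq a" for s a
    unfolding nsq_def by (simp add: sum_distrib_left norm_mult power_mult_distrib)
  have nsq_cong: "nsq a = nsq b" if "\<And>i. i \<in> I \<Longrightarrow> a i = b i" for a b
    unfolding nsq_def using that by (intro sum.cong) auto
  have app_cong: "app a i = app b i" if "\<And>i. i \<in> I \<Longrightarrow> a i = b i" for a b i
    unfolding app_def using that by (intro sum.cong) auto
  let ?K = "{c :: 'a \<Rightarrow> complex. (\<forall>i. i \<notin> I \<longrightarrow> c i = 0) \<and> nsq c = 1}"
  have K: "compact ?K" unfolding nsq_def by (rule compact_unit_sphere_functions[OF I])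
  define unit where "unit w = (\<lambda>i. of_real (1 / sqrt (nsq w)) * (if i \<in> I then w i else 0))"
    for w :: "'a \<Rightarrow> complex"
  have unit_nsq: "nsq (unit w) = nsq w / nsq w" for w
  proof -
    have "nsq (unit w) = (1 / sqrt (nsq w))\<^sup>2 * nsq (\<lambda>i. if i \<in> I then w i else 0)"
      unfolding unit_def by (rule nsq_scale)
    also have "nsq (\<lambda>i. if i \<in> I then w i else 0) = nsq w" by (rule nsq_cong) auto
    finally show ?thesis using nsq0[of w] by (simp add: power_divide)
  qed
  have unit_app: "nsq (app (unit w)) = nsq (app w) / nsq w" for w
  proof -
    have "nsq (app (unit w)) = nsq (\<lambda>i. of_real (1 / sqrt (nsq w)) * app (\<lambda>i. if i \<in> I then w i else 0) i)"
      unfolding unit_def by (intro nsq_cong app_scale)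
    also have "\<dots> = nsq (app (\<lambda>i. if i \<in> I then w i else 0)) / nsq w"
      using nsq0[of w] by (subst nsq_scale) (simp add: power_divide)
    also have "nsq (app (\<lambda>i. if i \<in> I then w i else 0)) = nsq (app w)"
      by (intro nsq_cong app_cong) auto
    finally show ?thesis .
  qed
  have unit_in: "unit w \<in> ?K" if "nsq w \<noteq> 0" for w
    using that unit_nsq[of w] by (auto simp: unit_def)
  have vpos: "nsq v \<noteq> 0" using v nsq_zero by auto
  have cont: "continuous_on ?K (\<lambda>c. nsq (app c))"
    unfolding nsq_def app_def
    by (intro continuous_intros continuous_on_subset[OF continuous_on_product_coordinates]) auto
  obtain u where u: "u \<in> ?K" and umin: "\<And>w. w \<in> ?K \<Longrightarrow> nsq (app u) \<le> nsq (app w)"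
    using continuous_attains_inf[OF K _ cont] unit_in[OF vpos] by blast
  define m2 where "m2 = nsq (app u)"
  have u1: "nsq u = 1" using u by simp
  have low: "m2 * nsq w \<le> nsq (app w)" for w
  proof (cases "nsq w = 0")
    case False
    then show ?thesis
      using umin[OF unit_in[OF False]] nsq0[of w] unfolding unit_app m2_def by (simp add: field_simps)
  qed (use nsq0 in simp)
  \<comment> \<open>The minimum is a critical point: vary it in the direction of the defect \<open>z\<close>.\<close>
  define z where "z = (\<lambda>i. app (app u) i + of_real (- m2) * u i)"
  have zz: "nsq z = Re (ip (app u) (app z)) - m2 * Re (ip u z)"
  proof -
    have "ip z b = ip (app (app u)) b + of_real (- m2) * ip u b" for b
      unfolding ip_def z_def sum_distrib_left sum.distrib[symmetric]
      by (intro sum.cong refl) (simp only: distrib_right mult.assoc)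
    from this[of z] have "Re (ip z z) = Re (ip (app u) (app z)) - m2 * Re (ip u z)" by (simp add: symm)
    thus ?thesis by (simp add: ip_self)
  qed
  have quad: "0 \<le> 2 * t * nsq z + t\<^sup>2 * (nsq (app z) - m2 * nsq z)" for t
  proof -
    have "nsq (app (\<lambda>i. u i + of_real t * z i)) = nsq (\<lambda>i. app u i + of_real t * app z i)"
      by (intro nsq_cong app_add)
    thus ?thesis
      using low[of "\<lambda>i. u i + of_real t * z i"] unfolding nsq_add zz
      by (simp add: u1 m2_def algebra_simps)
  qed
  have "nsq z = 0"
  proof (rule ccontr)
    assume "nsq z \<noteq> 0"
    hence pos: "nsq z > 0" using nsq0[of z] by simp
    define D where "D = nsq (app z) - m2 * nsq z"
    have D: "D \<ge> 0" using low[of z] by (simp add: D_def)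
  \<comment> \<open>Dividing by \<open>D + 1\<close> instead of \<open>D\<close> avoids the case \<open>D = 0\<close>.\<close>
    define t where "t = - nsq z / (D + 1)"
    have "t < 0" using pos D by (simp add: t_def divide_neg_pos)
    moreover have "2 * nsq z + t * D > 0"
    proof -
      have "nsq z * D / (D + 1) \<le> nsq z" using D pos by (simp add: field_simps)
      thus ?thesis using pos by (simp add: t_def)
    qed
    ultimately have "t * (2 * nsq z + t * D) < 0" by (rule mult_neg_pos)
    moreover have "0 \<le> t * (2 * nsq z + t * D)"
      using quad[of t] by (simp add: D_def power2_eq_square algebra_simps)
    ultimately show False by simp
  qed
  hence BB: "app (app u) i = of_real m2 * u i" if "i \<in> I" for i
    using that nsq_zero[of z] by (simp add: z_def)
  define m where "m = sqrt m2"
  have m: "m\<^sup>2 = m2" "complex_of_real m * complex_of_real m = of_real m2"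
    using nsq0 by (simp_all add: m_def m2_def flip: of_real_mult)
  have bound: "m2 * nsq v \<le> (\<Sum>i\<in>I. (cmod ((\<Sum>j\<in>I. M i j * v j) - complex_of_real l * v i))\<^sup>2)"
    using low[of v] app_M[of _ v] by (simp add: nsq_def)
  \<comment> \<open>Factor \<open>B\<^sup>2 - m\<^sup>2 = (B - m) (B + m)\<close>.\<close>
  define w where "w = (\<lambda>i. app u i + of_real m * u i)"
  show thesis
  proof (cases "\<forall>i\<in>I. w i = 0")
    case True
    show thesis
    proof (rule that[of u "of_real (l - m)"])
      show "\<exists>i\<in>I. u i \<noteq> 0" using u1 nsq_zero[of u] by auto
      show "(\<Sum>j\<in>I. M i j * u j) = of_real (l - m) * u i" if "i \<in> I" for i
      proof -
        have "app u i = - (of_real m * u i)" using True that by (simp add: w_def eq_neg_iff_add_eq_0)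
        moreover have "(\<Sum>j\<in>I. M i j * u j) = app u i + of_real l * u i" using app_M[OF that, of u] by simp
        ultimately show ?thesis by (simp add: left_diff_distrib)
      qed
    qed (use bound m in \<open>simp add: nsq_def\<close>)
  next
    case False
    show thesis
    proof (rule that[of w "of_real (l + m)"])
      show "\<exists>i\<in>I. w i \<noteq> 0" using False by auto
      show "(\<Sum>j\<in>I. M i j * w j) = of_real (l + m) * w i" if "i \<in> I" for i
      proof -
        have "app w i = app (app u) i + of_real m * app u i" unfolding w_def by (rule app_add)
        also have "\<dots> = of_real m * w i" using BB[OF that] m(2) by (simp add: w_def algebra_simps)
        finally show ?thesis using app_M[OF that, of w] by (simp add: algebra_simps)
      qed
    qed (use bound m in \<open>simp add: nsq_def\<close>)
  qed
qed


section \<open>The operator in Fourier coordinates\<close>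

lemma H_per_weak_deriv:
  assumes "u \<in> H_per L p" "j \<le> p"
  shows "has_weak_deriv L j u (weak_deriv L j u)"
proof -
  have "\<exists>g. has_weak_deriv L j u g" using assms unfolding H_per_def by blast
  thus ?thesis unfolding weak_deriv_def by (rule someI_ex)
qed

lemma weak_deriv_L2_per: "u \<in> H_per L p \<Longrightarrow> j \<le> p \<Longrightarrow> weak_deriv L j u \<in> L2_per L"
  using H_per_weak_deriv unfolding has_weak_deriv_def by blast

locale periodic_operator =
  fixes L :: real and p :: nat and f :: "nat \<Rightarrow> real \<Rightarrow> complex"
  assumes L: "L > 0" and p: "p \<ge> 1"
    and smooth: "\<And>j. j < p \<Longrightarrow> smooth_fun (f j)" and period: "\<And>j. j < p \<Longrightarrow> has_period L (f j)"
begin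

text \<open>Off its leading term, the operator acts on Fourier coefficients by the infinite matrix
  \<open>conv_kernel\<close>. Its entries are dominated by \<open>coef_size\<close>, a function of \<open>n - m\<close>, up to
  polynomial growth in \<open>m\<close> of order \<open>p - 1\<close>; the definition of \<open>weighted\<close> absorbs that growth.\<close>

definition conv_kernel :: "int \<Rightarrow> int \<Rightarrow> complex" where
  "conv_kernel n m = (\<Sum>j<p. fcoef L (f j) (n - m) * freq L m ^ j)"

definition coef_size :: "int \<Rightarrow> real" where
  "coef_size k = (\<Sum>j<p. norm (fcoef L (f j) k))"

definition growth :: real where
  "growth = (1 + 2 * pi / L) ^ p"

definition weighted :: "(real \<Rightarrow> complex) \<Rightarrow> int \<Rightarrow> real" where
  "weighted u m = (1 + \<bar>real_of_int m\<bar>) ^ (p - 1) * norm (fcoef L u m)"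

lemma coef_size_nonneg: "coef_size k \<ge> 0"
  by (simp add: coef_size_def sum_nonneg)

lemma growth_pos: "growth > 0"
  using L unfolding growth_def by (intro zero_less_power add_pos_pos) auto

lemma weighted_nonneg: "weighted u m \<ge> 0"
  by (simp add: weighted_def)

lemma norm_fcoef_le_weighted: "norm (fcoef L u m) \<le> weighted u m"
proof -
  have "1 \<le> (1 + \<bar>real_of_int m\<bar>) ^ (p - 1)" by (rule one_le_power) simp
  from mult_right_mono[OF this norm_ge_zero[of "fcoef L u m"]] show ?thesis unfolding weighted_def mult_1_left .
qed

lemma conv_kernel_bound: "norm (conv_kernel n m * fcoef L u m) \<le> growth * (coef_size (n - m) * weighted u m)"
proof -
  let ?w = "1 + \<bar>real_of_int m\<bar>"
  have pow: "norm (freq L m) ^ j \<le> growth * ?w ^ (p - 1)" if "j < p" for j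
  proof -
    have "norm (freq L m) = 2 * pi / L * \<bar>real_of_int m\<bar>"
      using L by (simp add: freq_def norm_mult norm_divide)
    also have "\<dots> \<le> (1 + 2 * pi / L) * ?w"
      by (rule mult_mono) (use L in simp_all)
    finally have "norm (freq L m) ^ j \<le> ((1 + 2 * pi / L) * ?w) ^ j"
      by (rule power_mono) simp
    also have "\<dots> = (1 + 2 * pi / L) ^ j * ?w ^ j" by (rule power_mult_distrib)
    also have "\<dots> \<le> growth * ?w ^ (p - 1)"
    proof -
      have "(1 + 2 * pi / L) ^ j \<le> growth"
        unfolding growth_def by (rule power_increasing) (use that L in simp_all)
      moreover have "?w ^ j \<le> ?w ^ (p - 1)"
        by (rule power_increasing) (use that in simp_all)
      ultimately show ?thesis using growth_pos by (intro mult_mono) simp_all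
    qed
    finally show ?thesis .
  qed
  have "norm (conv_kernel n m) \<le> (\<Sum>j<p. norm (fcoef L (f j) (n - m)) * norm (freq L m) ^ j)"
    unfolding conv_kernel_def by (rule order_trans[OF norm_sum]) (simp add: norm_mult norm_power)
  also have "\<dots> \<le> (\<Sum>j<p. norm (fcoef L (f j) (n - m)) * (growth * ?w ^ (p - 1)))"
    by (intro sum_mono mult_left_mono pow) auto
  also have "\<dots> = coef_size (n - m) * (growth * ?w ^ (p - 1))"
    by (simp add: coef_size_def sum_distrib_right)
  finally have "norm (conv_kernel n m) * norm (fcoef L u m) \<le>
      coef_size (n - m) * (growth * ?w ^ (p - 1)) * norm (fcoef L u m)"
    by (rule mult_right_mono) simp
  thus ?thesis by (simp add: norm_mult weighted_def mult_ac)
qed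

lemma coef_size_summable:
  assumes "\<And>j. j < p \<Longrightarrow> (\<lambda>k. norm (fcoef L (f j) k) * v k) summable_on UNIV"
  shows "(\<lambda>k. coef_size k * v k) summable_on UNIV"
proof -
  have "((\<lambda>k. \<Sum>j\<in>{..<p}. norm (fcoef L (f j) k) * v k) has_sum
      (\<Sum>j\<in>{..<p}. \<Sum>\<^sub>\<infinity>k. norm (fcoef L (f j) k) * v k)) UNIV"
    using assms by (intro has_sum_sum_index has_sum_infsum) auto
  thus ?thesis unfolding coef_size_def sum_distrib_right by (rule has_sum_imp_summable)
qed

lemma coef_size_sum: "((\<lambda>m. coef_size (n - m)) has_sum (\<Sum>\<^sub>\<infinity>k. coef_size k)) UNIV"
proof -
  have "(\<lambda>k. norm (fcoef L (f j) k) * 1) summable_on UNIV" if "j < p" for j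
    using smooth_fcoef_summable[OF L smooth[OF that] period[OF that], of 0] by simp
  from coef_size_summable[OF this] have "coef_size summable_on UNIV" by simp
  hence "(coef_size has_sum (\<Sum>\<^sub>\<infinity>k. coef_size k)) UNIV" by (rule has_sum_infsum)
  thus ?thesis using has_sum_int_shift by blast
qed

lemma diff_op_L2_per:
  assumes "u \<in> H_per L p"
  shows "diff_op L p f u \<in> L2_per L"
  unfolding diff_op_def
  by (intro L2_per_add L2_per_sum smooth_mult_L2_per weak_deriv_L2_per[OF assms] smooth period) auto

text \<open>The weak derivatives enter through their Fourier coefficients only, so the arbitrary choice
  of representatives in \<open>weak_deriv\<close> does no harm. The same identity serves the
  eigenvector and the trigonometric polynomials.\<close>

lemma fcoef_diff_op:
  assumes u: "u \<in> H_per L p"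
  shows "((\<lambda>m. conv_kernel n m * fcoef L u m) has_sum
    (fcoef L (diff_op L p f u) n - freq L n ^ p * fcoef L u n)) UNIV"
proof -
  let ?g = "\<lambda>j. weak_deriv L j u"
  have coef: "fcoef L (?g j) m = freq L m ^ j * fcoef L u m" if "j \<le> p" for j m
    by (rule fcoef_weak_deriv[OF L H_per_weak_deriv[OF u that]])
  have int: "integrable (lebesgue_on {0..L}) (?g j)" if "j \<le> p" for j
    by (rule L2_per_integrable[OF weak_deriv_L2_per[OF u that]])
  have intp: "integrable (lebesgue_on {0..L}) (\<lambda>x. f j x * ?g j x)" if "j < p" for j
    by (rule L2_per_prod_integrable[OF smooth_L2_per[OF smooth[OF that] period[OF that]]])
      (use weak_deriv_L2_per[OF u] that in auto)
  have "fcoef L (diff_op L p f u) n = fcoef L (?g p) n + (\<Sum>j<p. fcoef L (\<lambda>x. f j x * ?g j x) n)"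
  proof -
    have "fcoef L (\<lambda>x. \<Sum>j<p. 1 * (f j x * ?g j x)) n = (\<Sum>j<p. 1 * fcoef L (\<lambda>x. f j x * ?g j x) n)"
      by (rule fcoef_lincomb) (use intp in auto)
    moreover have "(\<integral>x. (?g p x + (\<Sum>j<p. f j x * ?g j x)) * wave L n x \<partial>lebesgue_on {0..L}) =
        (\<integral>x. ?g p x * wave L n x \<partial>lebesgue_on {0..L}) +
        (\<integral>x. (\<Sum>j<p. f j x * ?g j x) * wave L n x \<partial>lebesgue_on {0..L})"
      unfolding distrib_right
      by (intro Bochner_Integration.integral_add integrable_mult_wave int Bochner_Integration.integrable_sum intp)
        auto
    ultimately show ?thesis by (simp add: fcoef_def diff_op_def add_divide_distrib)
  qed
  hence eq: "fcoef L (diff_op L p f u) n - freq L n ^ p * fcoef L u n =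
      (\<Sum>j<p. fcoef L (\<lambda>x. f j x * ?g j x) n)" by (simp add: coef)
  have "((\<lambda>m. \<Sum>j<p. fcoef L (f j) (n - m) * fcoef L (?g j) m) has_sum
      (\<Sum>j<p. fcoef L (\<lambda>x. f j x * ?g j x) n)) UNIV"
  proof (rule has_sum_sum_index)
    fix j assume "j \<in> {..<p}"
    hence j: "j < p" by simp
    show "((\<lambda>m. fcoef L (f j) (n - m) * fcoef L (?g j) m) has_sum fcoef L (\<lambda>x. f j x * ?g j x) n) UNIV"
      using smooth_fcoef_summable[OF L smooth[OF j] period[OF j], of 0] j
      by (intro fcoef_mult L L2_per_integrable[OF smooth_L2_per] smooth period int) simp_all
  qed
  moreover have "(\<Sum>j<p. fcoef L (f j) (n - m) * fcoef L (?g j) m) = conv_kernel n m * fcoef L u m" for m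
    by (simp add: conv_kernel_def coef sum_distrib_right mult.assoc)
  ultimately show ?thesis unfolding eq by simp
qed

text \<open>The weak derivative of order \<open>p - 1\<close> is integrable, so its coefficients are bounded. This is
  the a priori information from which the bootstrap starts.\<close>

lemma weighted_bounded:
  assumes u: "u \<in> H_per L p"
  obtains B where "\<And>n. weighted u n \<le> B"
proof -
  let ?g = "weak_deriv L (p - 1) u"
  have g: "has_weak_deriv L (p - 1) u ?g" by (rule H_per_weak_deriv[OF u]) simp
  have ig: "integrable (lebesgue_on {0..L}) u" "integrable (lebesgue_on {0..L}) ?g"
    using g unfolding has_weak_deriv_def by (auto intro: L2_per_integrable)
  define A where "A = (\<integral>x. norm (u x) \<partial>lebesgue_on {0..L}) / L"
  define B where "B = (\<integral>x. norm (?g x) \<partial>lebesgue_on {0..L}) / L"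
  have "weighted u n \<le> A + (L / pi) ^ (p - 1) * B" for n
  proof -
    have "weighted u n \<le> (1 + (L / pi) ^ (p - 1) * norm (freq L n) ^ (p - 1)) * norm (fcoef L u n)"
      unfolding weighted_def by (rule mult_right_mono[OF weight_le_freq[OF L]]) simp
    also have "\<dots> = norm (fcoef L u n) + (L / pi) ^ (p - 1) * norm (fcoef L ?g n)"
      unfolding fcoef_weak_deriv[OF L g] by (simp add: norm_mult norm_power distrib_right)
    also have "\<dots> \<le> A + (L / pi) ^ (p - 1) * B"
      unfolding A_def B_def by (intro add_mono mult_left_mono norm_fcoef_le L ig) (use L in simp)
    finally show ?thesis .
  qed
  thus thesis by (rule that)
qed

text \<open>Solve the eigenvalue equation for the leading term, estimate the rest by \<open>coef_size\<close>, and
  apply \<open>weighted_convolution_bound\<close>. The term \<open>l * fcoef L \<phi> n\<close> and the summand \<open>1\<close> of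
  \<open>weight_le_freq\<close> become the diagonal part \<open>\<alpha>\<close> of \<open>F\<close>.\<close>

lemma eigenvector_weighted_decay:
  assumes \<phi>: "\<phi> \<in> H_per L p" and eig: "\<And>n. fcoef L (diff_op L p f \<phi>) n = l * fcoef L \<phi> n"
    and v1: "\<And>n. 1 \<le> v n" and vmul: "\<And>m k. v (m + k) \<le> v m * v k"
    and sumv: "\<And>j. j < p \<Longrightarrow> (\<lambda>k. norm (fcoef L (f j) k) * v k) summable_on UNIV"
  obtains B where "\<And>n. v n * weighted \<phi> n \<le> B"
proof -
  define a where "a = (L / pi) ^ p"
  define \<alpha> where "\<alpha> = 1 + a * norm l"
  define \<beta> where "\<beta> = a * growth"
  define F where "F k = \<beta> * coef_size k + (if k = 0 then \<alpha> else 0)" for k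
  have a0: "a \<ge> 0" using L by (simp add: a_def)
  have \<alpha>0: "\<alpha> \<ge> 0" and \<beta>0: "\<beta> \<ge> 0" using a0 growth_pos by (simp_all add: \<alpha>_def \<beta>_def)
  obtain B0 where B0: "\<And>n. weighted \<phi> n \<le> B0" using weighted_bounded[OF \<phi>] by blast
  have step: "(1 + \<bar>real_of_int n\<bar>) * weighted \<phi> n \<le> (\<Sum>\<^sub>\<infinity>m. F (n - m) * weighted \<phi> m)" for n
  proof -
    have "(\<lambda>m. coef_size (n - m) * B0) summable_on UNIV"
      using coef_size_sum[of n] by (intro summable_on_cmult_left has_sum_imp_summable)
    hence "(\<lambda>m. coef_size (n - m) * weighted \<phi> m) summable_on UNIV"
      by (rule summable_on_comparison_test)
        (auto intro!: mult_left_mono B0 mult_nonneg_nonneg simp: coef_size_nonneg weighted_nonneg)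
    then obtain T where T: "((\<lambda>m. coef_size (n - m) * weighted \<phi> m) has_sum T) UNIV"
      unfolding summable_on_def by blast
    have sum: "norm (l * fcoef L \<phi> n - freq L n ^ p * fcoef L \<phi> n) \<le> growth * T"
      using norm_infsum_le[OF fcoef_diff_op[OF \<phi>, of n] has_sum_cmult_right[OF T] conv_kernel_bound]
      unfolding eig .
    have "((\<lambda>m. \<beta> * (coef_size (n - m) * weighted \<phi> m) + (if m = n then \<alpha> * weighted \<phi> n else 0))
        has_sum (\<beta> * T + \<alpha> * weighted \<phi> n)) UNIV"
      by (intro has_sum_add has_sum_cmult_right T has_sum_finite_neutralI[where B = "{n}"]) auto
    moreover have "F (n - m) * weighted \<phi> m =
        \<beta> * (coef_size (n - m) * weighted \<phi> m) + (if m = n then \<alpha> * weighted \<phi> n else 0)" for m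
      by (auto simp: F_def distrib_right)
    ultimately have inf: "(\<Sum>\<^sub>\<infinity>m. F (n - m) * weighted \<phi> m) = \<beta> * T + \<alpha> * weighted \<phi> n"
      by (simp add: infsumI)
    have "(1 + \<bar>real_of_int n\<bar>) * weighted \<phi> n = (1 + \<bar>real_of_int n\<bar>) ^ p * norm (fcoef L \<phi> n)"
    proof -
      have "Suc (p - 1) = p" using p by simp
      hence "(1 + \<bar>real_of_int n\<bar>) ^ p = (1 + \<bar>real_of_int n\<bar>) * (1 + \<bar>real_of_int n\<bar>) ^ (p - 1)"
        by (metis power_Suc)
      thus ?thesis by (simp only: weighted_def mult.assoc)
    qed
    also have "\<dots> \<le> (1 + a * norm (freq L n) ^ p) * norm (fcoef L \<phi> n)"
      unfolding a_def by (rule mult_right_mono[OF weight_le_freq[OF L]]) simp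
    also have "\<dots> = norm (fcoef L \<phi> n) + a * norm (freq L n ^ p * fcoef L \<phi> n)"
      by (simp add: norm_mult norm_power distrib_right)
    also have "\<dots> \<le> norm (fcoef L \<phi> n) + a * (norm l * norm (fcoef L \<phi> n) + growth * T)"
    proof -
      have "norm (freq L n ^ p * fcoef L \<phi> n) \<le> norm (l * fcoef L \<phi> n) + growth * T"
        using norm_triangle_ineq2[of "freq L n ^ p * fcoef L \<phi> n" "l * fcoef L \<phi> n"] sum
        by (simp only: norm_minus_commute)
      thus ?thesis using a0 by (simp add: norm_mult mult_left_mono)
    qed
    also have "\<dots> = \<alpha> * norm (fcoef L \<phi> n) + \<beta> * T"
      by (simp add: \<alpha>_def \<beta>_def algebra_simps)
    also have "\<dots> \<le> \<alpha> * weighted \<phi> n + \<beta> * T"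
      using \<alpha>0 norm_fcoef_le_weighted by (simp add: mult_left_mono)
    finally show ?thesis unfolding inf by simp
  qed
  have sumF: "(\<lambda>k. F k * v k) summable_on UNIV"
  proof -
    have "(\<lambda>k. \<beta> * (coef_size k * v k) + (if k = 0 then \<alpha> * v 0 else 0)) summable_on UNIV"
      by (intro summable_on_add summable_on_cmult_right coef_size_summable sumv
          has_sum_imp_summable[OF has_sum_finite_neutralI[where B = "{0}"]]) auto
    moreover have "F k * v k = \<beta> * (coef_size k * v k) + (if k = 0 then \<alpha> * v 0 else 0)" for k
      by (auto simp: F_def distrib_right)
    ultimately show ?thesis by simp
  qed
  have F0: "0 \<le> F n" for n using \<alpha>0 \<beta>0 by (simp add: F_def coef_size_nonneg)
  show thesis
    by (rule weighted_convolution_bound[OF weighted_nonneg B0 F0 v1 vmul sumF step that])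
qed

end

section \<open>Symmetry\<close>

lemma L2_inner_cnj: "L2_inner L u v = cnj (L2_inner L v u)"
proof -
  have "(\<integral>x. u x * cnj (v x) \<partial>lebesgue_on {0..L}) = (\<integral>x. cnj (v x * cnj (u x)) \<partial>lebesgue_on {0..L})"
    by (simp add: mult.commute)
  also have "\<dots> = cnj (\<integral>x. v x * cnj (u x) \<partial>lebesgue_on {0..L})" by (rule Bochner_Integration.integral_cnj)
  finally show ?thesis unfolding L2_inner_def set_integral_period .
qed

lemma L2_inner_wave:
  assumes "L > 0"
  shows "L2_inner L u (wave L (- n)) = of_real L * fcoef L u n"
  using assms unfolding L2_inner_def set_integral_period fcoef_def by (simp add: cnj_wave)

lemma self_adjoint_symmetric:
  assumes sa: "self_adjoint_op L D A" and u: "u \<in> D" and v: "v \<in> D" "A v \<in> L2_per L"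
  shows "L2_inner L (A u) v = L2_inner L u (A v)"
proof -
  have "(v, A v) \<in> op_graph L D A" using v by (simp add: op_graph_def)
  hence "(v, A v) \<in> adjoint_graph L D A" using sa by (simp add: self_adjoint_op_def)
  thus ?thesis using u by (simp add: adjoint_graph_def)
qed

lemma trig_poly_smooth_period:
  assumes "L > 0"
  shows "smooth_fun (\<lambda>x. \<Sum>m\<in>A. c m * wave L (- m) x)" "has_period L (\<lambda>x. \<Sum>m\<in>A. c m * wave L (- m) x)"
  using has_period_wave[OF assms]
  by (intro smooth_fun_lincomb smooth_fun_wave, simp add: has_period_def)

text \<open>The usual computation of \<open>(A \<phi>, \<phi>)\<close> in two ways; the square norm \<open>I\<close> of \<open>\<phi>\<close> over one period
  can be cancelled by \<open>AE_zero_period_imp_AE_zero\<close>.\<close>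

lemma eigenvalue_self_adjoint_real:
  assumes L: "L > 0" and sa: "self_adjoint_op L D A" and eig: "eigenvector_op D A l \<phi>"
    and D: "D \<subseteq> L2_per L" and A: "A \<phi> \<in> L2_per L"
  shows "l = of_real (Re l)"
proof -
  have \<phi>: "\<phi> \<in> D" "\<phi> \<in> L2_per L" and nz: "\<not> (AE x in lebesgue. \<phi> x = 0)"
    and ae: "AE x in lebesgue. A \<phi> x = l * \<phi> x"
    using eig D by (auto simp: eigenvector_op_def)
  have ae': "AE x in lebesgue_on {0..L}. A \<phi> x = l * \<phi> x"
    using ae by (subst AE_restrict_space_iff) auto
  define I where "I = (\<integral>x. (norm (\<phi> x))\<^sup>2 \<partial>lebesgue_on {0..L})"
  have meas: "\<phi> \<in> borel_measurable (lebesgue_on {0..L})" "A \<phi> \<in> borel_measurable (lebesgue_on {0..L})"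
    using \<phi> A by (auto intro: L2_per_measurable)
  have inner: "L2_inner L (A \<phi>) \<phi> = l * of_real I"
  proof -
    have "L2_inner L (A \<phi>) \<phi> = (\<integral>x. l * of_real ((norm (\<phi> x))\<^sup>2) \<partial>lebesgue_on {0..L})"
      unfolding L2_inner_def set_integral_period
    proof (rule integral_cong_AE)
      show "(\<lambda>x. A \<phi> x * cnj (\<phi> x)) \<in> borel_measurable (lebesgue_on {0..L})"
        "(\<lambda>x. l * of_real ((norm (\<phi> x))\<^sup>2)) \<in> borel_measurable (lebesgue_on {0..L})"
      proof -
        have "cnj \<in> borel_measurable borel" "complex_of_real \<in> borel_measurable borel"
          by (intro borel_measurable_continuous_onI continuous_intros)+
        from borel_measurable_times[OF meas(2) measurable_compose[OF meas(1) this(1)]]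
          borel_measurable_times[OF borel_measurable_const
            measurable_compose[OF borel_measurable_integrable[OF L2_per_square[OF \<phi>(2)]] this(2)]]
        show "(\<lambda>x. A \<phi> x * cnj (\<phi> x)) \<in> borel_measurable (lebesgue_on {0..L})"
          "(\<lambda>x. l * of_real ((norm (\<phi> x))\<^sup>2)) \<in> borel_measurable (lebesgue_on {0..L})" .
      qed
      show "AE x in lebesgue_on {0..L}. A \<phi> x * cnj (\<phi> x) = l * of_real ((norm (\<phi> x))\<^sup>2)"
        using ae' by eventually_elim (simp add: complex_norm_square del: of_real_power)
    qed
    also have "\<dots> = l * of_real I" unfolding I_def integral_mult_right_zero integral_complex_of_real ..
    finally show ?thesis .
  qed
  have "I \<noteq> 0"
  proof
    assume "I = 0"
    hence "AE x in lebesgue_on {0..L}. (norm (\<phi> x))\<^sup>2 = 0"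
      using integral_nonneg_eq_0_iff_AE[OF L2_per_square[OF \<phi>(2)]] by (simp add: I_def)
    hence "AE x in lebesgue_on {0..L}. \<phi> x = 0" by simp
    thus False using AE_zero_period_imp_AE_zero[OF L L2_per_period[OF \<phi>(2)]] nz by blast
  qed
  have "L2_inner L (A \<phi>) \<phi> = L2_inner L \<phi> (A \<phi>)"
    by (rule self_adjoint_symmetric[where D = D, OF sa \<phi>(1) \<phi>(1) A])
  also have "\<dots> = cnj (L2_inner L (A \<phi>) \<phi>)" by (rule L2_inner_cnj)
  finally have "l * of_real I = cnj l * of_real I" by (simp add: inner)
  hence "l = cnj l" using \<open>I \<noteq> 0\<close> by simp
  thus ?thesis by (simp add: complex_eq_iff)
qed

section \<open>The truncated operators\<close>

context periodic_operator
begin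

definition trunc_matrix :: "int \<Rightarrow> int \<Rightarrow> complex" where
  "trunc_matrix n m = (if n = m then freq L n ^ p else 0) + conv_kernel n m"

lemma fcoef_diff_op_trig_poly:
  assumes A: "finite A"
  shows "fcoef L (diff_op L p f (\<lambda>x. \<Sum>m\<in>A. c m * wave L (- m) x)) n = (\<Sum>m\<in>A. trunc_matrix n m * c m)"
proof -
  let ?u = "\<lambda>x. \<Sum>m\<in>A. c m * wave L (- m) x"
  have u: "?u \<in> H_per L p" by (intro smooth_H_per L trig_poly_smooth_period)
  have coef: "fcoef L ?u m = (if m \<in> A then c m else 0)" for m by (rule fcoef_trig_poly[OF L A])
  have "((\<lambda>m. conv_kernel n m * fcoef L ?u m) has_sum (\<Sum>m\<in>A. conv_kernel n m * c m)) UNIV"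
    unfolding coef using A by (intro has_sum_finite_neutralI[where B = A]) auto
  with fcoef_diff_op[OF u, of n]
  have "fcoef L (diff_op L p f ?u) n - freq L n ^ p * fcoef L ?u n = (\<Sum>m\<in>A. conv_kernel n m * c m)"
    by (rule has_sum_unique)
  moreover have "(\<Sum>m\<in>A. (if n = m then freq L n ^ p else 0) * c m) = freq L n ^ p * fcoef L ?u n"
  proof -
    have "(\<Sum>m\<in>A. (if n = m then freq L n ^ p else 0) * c m) = (\<Sum>m\<in>A. if n = m then freq L n ^ p * c m else 0)"
      by (intro sum.cong) auto
    thus ?thesis unfolding coef using A by simp
  qed
  ultimately show ?thesis by (simp add: trunc_matrix_def distrib_right sum.distrib algebra_simps)
qed

text \<open>Exponentials lie in the domain, and up to the factor \<open>L\<close> the entries are the inner products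
  of their images with exponentials.\<close>

lemma trunc_matrix_hermitian:
  assumes sa: "self_adjoint_op L (H_per L p) (diff_op L p f)"
  shows "trunc_matrix m n = cnj (trunc_matrix n m)"
proof -
  have w: "wave L (- k) \<in> H_per L p" for k by (intro smooth_H_per L smooth_fun_wave has_period_wave)
  have coef: "fcoef L (diff_op L p f (wave L (- k))) j = trunc_matrix j k" for j k
    using fcoef_diff_op_trig_poly[of "{k}" "\<lambda>_. 1" j] by simp
  have "of_real L * trunc_matrix m n = L2_inner L (diff_op L p f (wave L (- n))) (wave L (- m))"
    by (simp add: L2_inner_wave[OF L] coef)
  also have "\<dots> = L2_inner L (wave L (- n)) (diff_op L p f (wave L (- m)))"
    by (intro self_adjoint_symmetric[OF sa] w diff_op_L2_per)
  also have "\<dots> = cnj (L2_inner L (diff_op L p f (wave L (- m))) (wave L (- n)))"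
    by (rule L2_inner_cnj)
  also have "\<dots> = of_real L * cnj (trunc_matrix n m)"
    by (simp add: L2_inner_wave[OF L] coef)
  finally show ?thesis using L by simp
qed

lemma spectrum_truncI:
  assumes nz: "\<exists>i\<in>{- int N..int N}. c i \<noteq> 0"
    and eig: "\<And>i. i \<in> {- int N..int N} \<Longrightarrow> (\<Sum>j=-int N..int N. trunc_matrix i j * c j) = \<mu> * c i"
  shows "\<mu> \<in> spectrum_trunc L p f N"
proof -
  let ?I = "{- int N..int N}"
  define u where "u = (\<lambda>x. \<Sum>m\<in>?I. c m * wave L (- m) x)"
  have coef: "fcoef L u m = (if m \<in> ?I then c m else 0)" for m
    unfolding u_def by (rule fcoef_trig_poly[OF L]) simp
  have trunc: "fourier_trunc L N u = u"
  proof
    fix x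
    have "fourier_trunc L N u x = (\<Sum>n\<in>?I. fcoef L u n * wave L (- n) x)"
      by (rule fourier_trunc_fcoef[OF L])
    also have "\<dots> = (\<Sum>n\<in>?I. c n * wave L (- n) x)"
      by (intro sum.cong refl) (simp add: coef)
    finally show "fourier_trunc L N u x = u x" by (simp only: u_def)
  qed
  have "u \<in> L2_per L" unfolding u_def by (intro smooth_L2_per trig_poly_smooth_period L)
  hence "u \<in> fourier_trunc L N ` L2_per L" using trunc by (metis imageI)
  moreover have "u \<noteq> (\<lambda>_. 0)"
  proof
    assume "u = (\<lambda>_. 0)"
    hence "fcoef L u i = 0" for i by (simp add: fcoef_def)
    thus False using nz coef by metis
  qed
  moreover have "trunc_op L p f N u = (\<lambda>x. \<mu> * u x)"
  proof
    fix x
    have "trunc_op L p f N u x = (\<Sum>n\<in>?I. fcoef L (diff_op L p f u) n * wave L (- n) x)"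
      unfolding trunc_op_def trunc by (rule fourier_trunc_fcoef[OF L])
    also have "\<dots> = (\<Sum>n\<in>?I. \<mu> * c n * wave L (- n) x)"
    proof (rule sum.cong[OF refl])
      fix n assume "n \<in> ?I"
      hence "fcoef L (diff_op L p f u) n = \<mu> * c n"
        unfolding u_def by (simp only: fcoef_diff_op_trig_poly finite_atLeastAtMost_int eig)
      thus "fcoef L (diff_op L p f u) n * wave L (- n) x = \<mu> * c n * wave L (- n) x" by simp
    qed
    also have "\<dots> = \<mu> * u x" by (simp add: u_def sum_distrib_left mult.assoc)
    finally show "trunc_op L p f N u x = \<mu> * u x" .
  qed
  ultimately show ?thesis unfolding spectrum_trunc_def by blast
qed

lemma fcoef_eigenvector:
  assumes "eigenvector_op (H_per L p) (diff_op L p f) l \<phi>"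
  shows "fcoef L (diff_op L p f \<phi>) n = l * fcoef L \<phi> n"
proof -
  have \<phi>: "\<phi> \<in> H_per L p" and ae: "AE x in lebesgue. diff_op L p f \<phi> x = l * \<phi> x"
    using assms by (auto simp: eigenvector_op_def)
  have L2: "\<phi> \<in> L2_per L" using \<phi> by (simp add: H_per_def)
  have ae': "AE x in lebesgue_on {0..L}. diff_op L p f \<phi> x = l * \<phi> x"
    using ae by (subst AE_restrict_space_iff) auto
  have i1: "integrable (lebesgue_on {0..L}) (\<lambda>x. diff_op L p f \<phi> x * wave L n x)"
    by (intro integrable_mult_wave L2_per_integrable diff_op_L2_per \<phi>)
  have i2: "integrable (lebesgue_on {0..L}) (\<lambda>x. l * (\<phi> x * wave L n x))"
    by (rule integrable_mult_right[OF integrable_mult_wave[OF L2_per_integrable[OF L2]]])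
  have "(\<integral>x. diff_op L p f \<phi> x * wave L n x \<partial>lebesgue_on {0..L}) =
      (\<integral>x. l * (\<phi> x * wave L n x) \<partial>lebesgue_on {0..L})"
  proof (rule integral_cong_AE)
    show "AE x in lebesgue_on {0..L}. diff_op L p f \<phi> x * wave L n x = l * (\<phi> x * wave L n x)"
      using ae' by eventually_elim simp
  qed (use i1 i2 in \<open>auto intro: borel_measurable_integrable\<close>)
  thus ?thesis unfolding fcoef_def by simp
qed

text \<open>The full system holds exactly, so what is left over is the part of the row sum with
  \<open>\<bar>m\<bar> > N\<close>.\<close>

lemma truncation_residual:
  assumes \<phi>: "\<phi> \<in> H_per L p" and eig: "\<And>n. fcoef L (diff_op L p f \<phi>) n = l * fcoef L \<phi> n"
    and tail: "\<And>m. \<bar>m\<bar> > int N \<Longrightarrow> weighted \<phi> m \<le> \<epsilon>" and \<epsilon>: "\<epsilon> \<ge> 0" and n: "n \<in> {- int N..int N}"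
  shows "norm ((\<Sum>m=-int N..int N. trunc_matrix n m * fcoef L \<phi> m) - l * fcoef L \<phi> n) \<le>
    growth * (\<Sum>\<^sub>\<infinity>k. coef_size k) * \<epsilon>"
proof -
  let ?I = "{- int N..int N}"
  let ?t = "\<lambda>m. conv_kernel n m * fcoef L \<phi> m"
  define S where "S = (\<Sum>m\<in>?I. ?t m)"
  have all: "(?t has_sum (l * fcoef L \<phi> n - freq L n ^ p * fcoef L \<phi> n)) UNIV"
    using fcoef_diff_op[OF \<phi>, of n] unfolding eig .
  have fin: "((\<lambda>m. - (if m \<in> ?I then ?t m else 0)) has_sum (- S)) UNIV"
    unfolding S_def by (rule has_sum_finite_neutralI[where B = ?I]) (auto simp: sum_negf)
  have rest: "((\<lambda>m. ?t m + - (if m \<in> ?I then ?t m else 0)) has_sum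
      (l * fcoef L \<phi> n - freq L n ^ p * fcoef L \<phi> n + - S)) UNIV"
    by (rule has_sum_add[OF all fin])
  have majorant: "((\<lambda>m. growth * (coef_size (n - m) * \<epsilon>)) has_sum
      (growth * ((\<Sum>\<^sub>\<infinity>k. coef_size k) * \<epsilon>))) UNIV"
    by (intro has_sum_cmult_right has_sum_cmult_left coef_size_sum)
  have "norm (?t m + - (if m \<in> ?I then ?t m else 0)) \<le> growth * (coef_size (n - m) * \<epsilon>)" for m
  proof (cases "m \<in> ?I")
    case True
    thus ?thesis using growth_pos coef_size_nonneg[of "n - m"] \<epsilon> by simp
  next
    case False
    hence "weighted \<phi> m \<le> \<epsilon>" by (intro tail) auto
    hence "growth * (coef_size (n - m) * weighted \<phi> m) \<le> growth * (coef_size (n - m) * \<epsilon>)"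
      using growth_pos coef_size_nonneg[of "n - m"] by (intro mult_left_mono) auto
    with conv_kernel_bound[of n m \<phi>] have "norm (?t m) \<le> growth * (coef_size (n - m) * \<epsilon>)"
      by (rule order_trans)
    thus ?thesis using False by (simp only: if_False minus_zero add_0_right)
  qed
  from norm_infsum_le[OF rest majorant this]
  have "norm (l * fcoef L \<phi> n - freq L n ^ p * fcoef L \<phi> n + - S) \<le>
      growth * ((\<Sum>\<^sub>\<infinity>k. coef_size k) * \<epsilon>)" .
  moreover have "(\<Sum>m\<in>?I. trunc_matrix n m * fcoef L \<phi> m) = freq L n ^ p * fcoef L \<phi> n + S"
  proof -
    have "(\<Sum>m\<in>?I. (if n = m then freq L n ^ p else 0) * fcoef L \<phi> m) =
        (\<Sum>m\<in>?I. if n = m then freq L n ^ p * fcoef L \<phi> m else 0)"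
      by (intro sum.cong) auto
    also have "\<dots> = freq L n ^ p * fcoef L \<phi> n" using n by simp
    finally show ?thesis unfolding trunc_matrix_def S_def by (simp add: distrib_right sum.distrib)
  qed
  hence "(\<Sum>m\<in>?I. trunc_matrix n m * fcoef L \<phi> m) - l * fcoef L \<phi> n =
      - (l * fcoef L \<phi> n - freq L n ^ p * fcoef L \<phi> n + - S)" by simp
  ultimately show ?thesis by (simp only: norm_minus_cancel mult.assoc)
qed

text \<open>The eigenvalue \<open>\<mu> N\<close> is chosen before the tail bound \<open>\<epsilon>\<close>, so one sequence serves all weights.
  The factor \<open>2 N + 1\<close> is the square root of the number of rows, bounded generously. By
  completeness some coefficient of \<open>\<phi>\<close> is nonzero, and it bounds the norm of the truncated
  vector from below.\<close>

lemma truncation_eigenvalue_near: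
  assumes sa: "self_adjoint_op L (H_per L p) (diff_op L p f)"
    and ev: "eigenvector_op (H_per L p) (diff_op L p f) l \<phi>"
  shows "\<exists>\<mu> N1 C. C \<ge> 0 \<and> (\<forall>N\<ge>N1. \<mu> N \<in> spectrum_trunc L p f N) \<and>
    (\<forall>N\<ge>N1. \<forall>\<epsilon>\<ge>0. (\<forall>m. \<bar>m\<bar> > int N \<longrightarrow> weighted \<phi> m \<le> \<epsilon>) \<longrightarrow>
       cmod (l - \<mu> N) \<le> C * (2 * real N + 1) * \<epsilon>)"
proof -
  have \<phi>: "\<phi> \<in> H_per L p" and nz: "\<not> (AE x in lebesgue. \<phi> x = 0)"
    using ev by (auto simp: eigenvector_op_def)
  have L2: "\<phi> \<in> L2_per L" using \<phi> by (simp add: H_per_def)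
  have sub: "H_per L p \<subseteq> L2_per L" by (auto simp: H_per_def)
  define l' where "l' = Re l"
  have l: "l = of_real l'"
    unfolding l'_def by (rule eigenvalue_self_adjoint_real[OF L sa ev sub diff_op_L2_per[OF \<phi>]])
  note eig = fcoef_eigenvector[OF ev]
  obtain n1 where n1: "fcoef L \<phi> n1 \<noteq> 0"
    using fcoef_zero_imp_AE_zero[OF L L2_per_integrable[OF L2]]
      AE_zero_period_imp_AE_zero[OF L L2_per_period[OF L2]] nz by blast
  define G where "G = growth * (\<Sum>\<^sub>\<infinity>k. coef_size k)"
  have G0: "G \<ge> 0" unfolding G_def using growth_pos coef_size_nonneg by (simp add: infsum_nonneg)
  let ?res = "\<lambda>N. \<Sum>n=-int N..int N. (cmod ((\<Sum>m=-int N..int N. trunc_matrix n m * fcoef L \<phi> m) - l * fcoef L \<phi> n))\<^sup>2"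
  have ex: "\<exists>\<mu>. \<mu> \<in> spectrum_trunc L p f N \<and>
      (cmod (l - \<mu>))\<^sup>2 * (\<Sum>n=-int N..int N. (cmod (fcoef L \<phi> n))\<^sup>2) \<le> ?res N" if N: "N \<ge> nat \<bar>n1\<bar>" for N
  proof -
    have nzv: "\<exists>i\<in>{- int N..int N}. fcoef L \<phi> i \<noteq> 0" using n1 N by (intro bexI[of _ n1]) auto
    show ?thesis
    proof (rule hermitian_approx_eigenvalue[OF finite_atLeastAtMost_int trunc_matrix_hermitian[OF sa] nzv, where l = l'])
      fix \<mu> c
      assume "\<exists>i\<in>{- int N..int N}. c i \<noteq> 0"
        "\<And>i. i \<in> {- int N..int N} \<Longrightarrow> (\<Sum>j=-int N..int N. trunc_matrix i j * c j) = \<mu> * c i"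
      hence "\<mu> \<in> spectrum_trunc L p f N" by (rule spectrum_truncI)
      moreover assume "(cmod (complex_of_real l' - \<mu>))\<^sup>2 * (\<Sum>n=-int N..int N. (cmod (fcoef L \<phi> n))\<^sup>2) \<le>
        (\<Sum>n=-int N..int N. (cmod ((\<Sum>m=-int N..int N. trunc_matrix n m * fcoef L \<phi> m) - complex_of_real l' * fcoef L \<phi> n))\<^sup>2)"
      ultimately show ?thesis unfolding l[symmetric] by blast
    qed
  qed
  define \<mu> where "\<mu> N = (SOME \<mu>. \<mu> \<in> spectrum_trunc L p f N \<and>
      (cmod (l - \<mu>))\<^sup>2 * (\<Sum>n=-int N..int N. (cmod (fcoef L \<phi> n))\<^sup>2) \<le> ?res N)" for N
  have \<mu>: "\<mu> N \<in> spectrum_trunc L p f N"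
    "(cmod (l - \<mu> N))\<^sup>2 * (\<Sum>n=-int N..int N. (cmod (fcoef L \<phi> n))\<^sup>2) \<le> ?res N" if "N \<ge> nat \<bar>n1\<bar>" for N
    using someI_ex[OF ex[OF that]] unfolding \<mu>_def by blast+
  define x where "x = cmod (fcoef L \<phi> n1)"
  have x: "x > 0" using n1 by (simp add: x_def)
  have bound: "cmod (l - \<mu> N) \<le> G / x * (2 * real N + 1) * \<epsilon>"
    if N: "N \<ge> nat \<bar>n1\<bar>" and \<epsilon>: "\<epsilon> \<ge> 0" and tail: "\<And>m. \<bar>m\<bar> > int N \<Longrightarrow> weighted \<phi> m \<le> \<epsilon>" for N \<epsilon>
  proof -
    have "(cmod (l - \<mu> N) * x)\<^sup>2 = (cmod (l - \<mu> N))\<^sup>2 * (cmod (fcoef L \<phi> n1))\<^sup>2"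
      by (simp add: power_mult_distrib x_def)
    also have "\<dots> \<le> (cmod (l - \<mu> N))\<^sup>2 * (\<Sum>n=-int N..int N. (cmod (fcoef L \<phi> n))\<^sup>2)"
      by (rule mult_left_mono[OF member_le_sum]) (use N in auto)
    also have "\<dots> \<le> ?res N" by (rule \<mu>(2)[OF N])
    also have "\<dots> \<le> (\<Sum>n=-int N..int N. (G * \<epsilon>)\<^sup>2)"
      using truncation_residual[OF \<phi> eig tail \<epsilon>] unfolding G_def by (intro sum_mono power_mono) auto
    also have "\<dots> = (2 * real N + 1) * (G * \<epsilon>)\<^sup>2" by simp
    also have "\<dots> \<le> (2 * real N + 1)\<^sup>2 * (G * \<epsilon>)\<^sup>2"
      by (rule mult_right_mono) (simp_all add: power2_eq_square)
    also have "\<dots> = ((2 * real N + 1) * (G * \<epsilon>))\<^sup>2" by (simp add: power_mult_distrib)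
    finally have "cmod (l - \<mu> N) * x \<le> (2 * real N + 1) * (G * \<epsilon>)"
      by (rule power2_le_imp_le) (use G0 \<epsilon> in simp)
    thus ?thesis using x by (simp add: field_simps)
  qed
  show ?thesis
    by (rule exI[of _ \<mu>], rule exI[of _ "nat \<bar>n1\<bar>"], rule exI[of _ "G / x"], intro conjI allI impI)
      (use G0 x \<mu>(1) bound in auto)
qed

end

section \<open>Rates of convergence\<close>

text \<open>Half of \<open>\<epsilon>\<close> is spent on the contour shift, the other half on summability.\<close>

lemma exp_weight_summable:
  assumes L: "L > 0" and u: "has_period L u" "analytic_on_strip d u" and \<epsilon>: "0 < \<epsilon>" "\<epsilon> < d"
  shows "(\<lambda>k. norm (fcoef L u k) * exp (2 * pi * (d - \<epsilon>) / L * \<bar>real_of_int k\<bar>)) summable_on UNIV"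
proof -
  define \<delta> where "\<delta> = d - \<epsilon> / 2"
  define b where "b = pi * \<epsilon> / L"
  have b: "b > 0" using L \<epsilon> by (simp add: b_def)
  have \<delta>: "0 < \<delta>" "\<delta> < d" using \<epsilon> by (auto simp: \<delta>_def)
  have rate: "- (2 * pi * \<delta> / L) + 2 * pi * (d - \<epsilon>) / L = - b"
    using L by (simp add: \<delta>_def b_def field_simps)
  obtain C where C: "C \<ge> 0" "\<And>n. norm (fcoef L u n) \<le> C * exp (- (2 * pi * \<delta> / L) * \<bar>real_of_int n\<bar>)"
    using analytic_fcoef_decay[OF L \<delta> u] by blast
  have "summable (\<lambda>n. C * exp (- b) ^ n)" using b by (intro summable_mult summable_geometric) simp
  hence "(\<lambda>k. C * exp (- b) ^ nat \<bar>k\<bar>) summable_on (UNIV :: int set)"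
    by (rule summable_on_int_abs) (use C(1) in simp)
  thus ?thesis
  proof (rule summable_on_comparison_test)
    fix k :: int
    have "norm (fcoef L u k) * exp (2 * pi * (d - \<epsilon>) / L * \<bar>real_of_int k\<bar>) \<le>
        C * exp (- (2 * pi * \<delta> / L) * \<bar>real_of_int k\<bar>) * exp (2 * pi * (d - \<epsilon>) / L * \<bar>real_of_int k\<bar>)"
      by (rule mult_right_mono[OF C(2)]) simp
    also have "\<dots> = C * exp ((- (2 * pi * \<delta> / L) + 2 * pi * (d - \<epsilon>) / L) * \<bar>real_of_int k\<bar>)"
      by (simp only: mult.assoc exp_add[symmetric] distrib_right)
    also have "\<dots> = C * exp (- b) ^ nat \<bar>k\<bar>"
      unfolding rate by (simp add: exp_of_nat_mult[symmetric] mult.commute)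
    finally show "norm (fcoef L u k) * exp (2 * pi * (d - \<epsilon>) / L * \<bar>real_of_int k\<bar>) \<le> C * exp (- b) ^ nat \<bar>k\<bar>" .
  qed simp
qed

context periodic_operator
begin

text \<open>Monotonicity turns the weighted bound into one that is uniform on the tail \<open>\<bar>m\<bar> > N\<close>. The
  weight is given as \<open>g \<bar>m\<bar>\<close> so that the polynomial and the exponential case are treated alike.\<close>

lemma weighted_tail:
  assumes v: "mono g" "\<And>n. g n > 0" and B: "\<And>m. g \<bar>m\<bar> * weighted \<phi> m \<le> B" and m: "\<bar>m\<bar> > int N"
  shows "weighted \<phi> m \<le> B / g (int N)"
proof -
  have "g (int N) * weighted \<phi> m \<le> g \<bar>m\<bar> * weighted \<phi> m"
    using monoD[OF v(1), of "int N" "\<bar>m\<bar>"] m weighted_nonneg by (intro mult_right_mono) auto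
  also have "\<dots> \<le> B" by (rule B)
  finally show ?thesis using v(2)[of "int N"] by (simp add: pos_le_divide_eq mult.commute)
qed

text \<open>One sequence of truncated eigenvalues that converges at every rate which the coefficients
  allow.\<close>

lemma eigenvalue_convergence:
  assumes sa: "self_adjoint_op L (H_per L p) (diff_op L p f)"
    and ev: "eigenvector_op (H_per L p) (diff_op L p f) l \<phi>"
  shows "\<exists>\<mu>. (\<forall>\<^sub>F N in sequentially. \<mu> N \<in> spectrum_trunc L p f N) \<and>
    (\<forall>q. \<exists>C>0. \<forall>\<^sub>F N in sequentially. cmod (l - \<mu> N) \<le> C * real N powr (- real q)) \<and>
    (\<forall>d \<epsilon>. 0 < \<epsilon> \<and> \<epsilon> < d \<and> (\<forall>j<p. analytic_on_strip d (f j)) \<longrightarrow>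
       (\<exists>C>0. \<forall>\<^sub>F N in sequentially.
          cmod (l - \<mu> N) \<le> C * real N * exp (- (2 * pi * (d - \<epsilon>) / L) * real N)))"
proof -
  have \<phi>: "\<phi> \<in> H_per L p" using ev by (auto simp: eigenvector_op_def)
  note eig = fcoef_eigenvector[OF ev]
  obtain \<mu> N1 C where C: "C \<ge> 0" and spec: "\<forall>N\<ge>N1. \<mu> N \<in> spectrum_trunc L p f N"
    and near: "\<forall>N\<ge>N1. \<forall>\<epsilon>\<ge>0. (\<forall>m. \<bar>m\<bar> > int N \<longrightarrow> weighted \<phi> m \<le> \<epsilon>) \<longrightarrow>
       cmod (l - \<mu> N) \<le> C * (2 * real N + 1) * \<epsilon>"
    using truncation_eigenvalue_near[OF sa ev] by blast
  have rate: "\<exists>K>0. \<forall>N\<ge>max 1 N1. cmod (l - \<mu> N) \<le> K * real N / g (int N)"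
    if g: "mono g" "\<And>n. g n > 0" and B: "\<And>m. g \<bar>m\<bar> * weighted \<phi> m \<le> B" for g :: "int \<Rightarrow> real" and B
  proof (intro exI conjI allI impI)
    have "0 \<le> g \<bar>0\<bar> * weighted \<phi> 0"
      by (intro mult_nonneg_nonneg weighted_nonneg less_imp_le g(2))
    hence B0: "B \<ge> 0" using B[of 0] by (rule order_trans)
    show "3 * (C * B) + 1 > 0" using B0 C by (simp add: add_nonneg_pos)
    fix N assume N: "N \<ge> max 1 N1"
    have q0: "B / g (int N) \<ge> 0" using B0 g(2)[of "int N"] by simp
    have "\<forall>m. \<bar>m\<bar> > int N \<longrightarrow> weighted \<phi> m \<le> B / g (int N)"
      by (intro allI impI weighted_tail[OF g B])
    moreover have "N1 \<le> N" using N by simp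
    ultimately have "cmod (l - \<mu> N) \<le> C * (2 * real N + 1) * (B / g (int N))"
      using near q0 by blast
    also have "\<dots> \<le> C * (3 * real N) * (B / g (int N))"
      by (intro mult_right_mono mult_left_mono q0 C) (use N in simp)
    also have "\<dots> = 3 * (C * B) * (real N / g (int N))" by simp
    also have "\<dots> \<le> (3 * (C * B) + 1) * (real N / g (int N))"
      by (rule mult_right_mono) (use g(2)[of "int N"] in simp_all)
    finally show "cmod (l - \<mu> N) \<le> (3 * (C * B) + 1) * real N / g (int N)" by simp
  qed
  show ?thesis
  proof (intro exI[of _ \<mu>] conjI allI impI)
    show "\<forall>\<^sub>F N in sequentially. \<mu> N \<in> spectrum_trunc L p f N"
      using eventually_ge_at_top[of N1] by eventually_elim (use spec in blast)
  next
    fix q :: nat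
    define v where "v n = (1 + \<bar>real_of_int n\<bar>) ^ Suc q" for n
    have vmul: "v (m + k) \<le> v m * v k" for m k
    proof -
      have "1 + \<bar>real_of_int (m + k)\<bar> \<le> (1 + \<bar>real_of_int m\<bar>) * (1 + \<bar>real_of_int k\<bar>)"
      proof -
        have "\<bar>real_of_int (m + k)\<bar> \<le> \<bar>real_of_int m\<bar> + \<bar>real_of_int k\<bar>" by simp
        moreover have "0 \<le> \<bar>real_of_int m\<bar> * \<bar>real_of_int k\<bar>" by simp
        moreover have "(1 + \<bar>real_of_int m\<bar>) * (1 + \<bar>real_of_int k\<bar>) =
            1 + \<bar>real_of_int m\<bar> + \<bar>real_of_int k\<bar> + \<bar>real_of_int m\<bar> * \<bar>real_of_int k\<bar>"
          by (simp add: algebra_simps)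
        ultimately show ?thesis by linarith
      qed
      thus ?thesis unfolding v_def power_mult_distrib[symmetric] by (rule power_mono) simp
    qed
    have v1: "1 \<le> v n" for n unfolding v_def by (rule one_le_power) simp
    have vsum: "(\<lambda>k. norm (fcoef L (f j) k) * v k) summable_on UNIV" if "j < p" for j
      unfolding v_def by (rule smooth_fcoef_summable[OF L smooth[OF that] period[OF that]])
    obtain B where B: "\<And>n. v n * weighted \<phi> n \<le> B"
      by (rule eigenvector_weighted_decay[OF \<phi> eig v1 vmul vsum that])
    define g where "g n = (1 + max 0 (real_of_int n)) ^ Suc q" for n :: int
    have g1: "mono g" unfolding g_def by (intro monoI power_mono) auto
    have g2: "g n > 0" for n
      unfolding g_def by (rule zero_less_power) (simp add: add_pos_nonneg)
    have g3: "g \<bar>m\<bar> * weighted \<phi> m \<le> B" for m using B[of m] by (simp add: g_def v_def)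
    obtain K where K: "K > 0" "\<And>N. N \<ge> max 1 N1 \<Longrightarrow> cmod (l - \<mu> N) \<le> K * real N / g (int N)"
      using rate[OF g1 g2 g3] by blast
    have "\<forall>\<^sub>F N in sequentially. cmod (l - \<mu> N) \<le> K * real N powr (- real q)"
      using eventually_ge_at_top[of "max 1 N1"]
    proof eventually_elim
      case (elim N)
      hence N: "real N > 0" by simp
      have "real N ^ Suc q \<le> g (int N)" unfolding g_def by (rule power_mono) auto
      hence "K * real N / g (int N) \<le> K * real N / real N ^ Suc q"
        using K(1) N by (intro divide_left_mono mult_pos_pos) (auto simp: g_def intro: zero_less_power)
      also have "\<dots> = K * real N powr (- real q)"
        using N by (simp add: powr_minus powr_realpow field_simps)
      finally show ?case using K(2)[OF elim] by simp
    qed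
    thus "\<exists>C>0. \<forall>\<^sub>F N in sequentially. cmod (l - \<mu> N) \<le> C * real N powr (- real q)"
      using K(1) by blast
  next
    fix d \<epsilon> :: real
    assume "0 < \<epsilon> \<and> \<epsilon> < d \<and> (\<forall>j<p. analytic_on_strip d (f j))"
    hence \<epsilon>: "0 < \<epsilon>" "\<epsilon> < d" and an: "\<And>j. j < p \<Longrightarrow> analytic_on_strip d (f j)" by auto
    define a where "a = 2 * pi * (d - \<epsilon>) / L"
    have a0: "a \<ge> 0" using \<epsilon> L by (simp add: a_def)
    define v where "v n = exp (a * \<bar>real_of_int n\<bar>)" for n
    have vmul: "v (m + k) \<le> v m * v k" for m k
    proof -
      have "a * \<bar>real_of_int (m + k)\<bar> \<le> a * \<bar>real_of_int m\<bar> + a * \<bar>real_of_int k\<bar>"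
        using mult_left_mono[OF abs_triangle_ineq[of "real_of_int m" "real_of_int k"] a0]
        by (simp add: distrib_left)
      thus ?thesis by (simp add: v_def exp_add[symmetric])
    qed
    have v1: "1 \<le> v n" for n using a0 by (simp add: v_def)
    have vsum: "(\<lambda>k. norm (fcoef L (f j) k) * v k) summable_on UNIV" if "j < p" for j
      unfolding v_def a_def by (rule exp_weight_summable[OF L period[OF that] an[OF that] \<epsilon>])
    obtain B where B: "\<And>n. v n * weighted \<phi> n \<le> B"
      by (rule eigenvector_weighted_decay[OF \<phi> eig v1 vmul vsum that])
    define g where "g n = exp (a * real_of_int n)" for n :: int
    have g1: "mono g" unfolding g_def using a0 by (intro monoI) (simp add: mult_left_mono)
    have g2: "g n > 0" for n by (simp add: g_def)
    have g3: "g \<bar>m\<bar> * weighted \<phi> m \<le> B" for m using B[of m] by (simp add: g_def v_def)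
    obtain K where K: "K > 0" "\<And>N. N \<ge> max 1 N1 \<Longrightarrow> cmod (l - \<mu> N) \<le> K * real N / g (int N)"
      using rate[OF g1 g2 g3] by blast
    have "\<forall>\<^sub>F N in sequentially. cmod (l - \<mu> N) \<le> K * real N * exp (- a * real N)"
      using eventually_ge_at_top[of "max 1 N1"]
    proof eventually_elim
      case (elim N)
      show ?case using K(2)[OF elim] by (simp add: g_def exp_minus divide_inverse)
    qed
    thus "\<exists>C>0. \<forall>\<^sub>F N in sequentially. cmod (l - \<mu> N) \<le> C * real N * exp (- (2 * pi * (d - \<epsilon>) / L) * real N)"
      using K(1) unfolding a_def by blast
  qed
qed

end

section \<open>Convergence inside an eigenvalue cluster\<close>

text \<open>Conjugation by \<open>exp (\<i> \<mu> x)\<close> forms linear combinations of the coefficients with the constant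
  \<open>1\<close>, which is written as \<open>wave L 0\<close>.\<close>

lemma smooth_period_conj_coeff:
  assumes L: "L > 0" and a: "\<And>j. j < p \<Longrightarrow> smooth_fun (a j) \<and> has_period L (a j)"
  shows "smooth_fun (conj_coeff p \<mu> a m)" "has_period L (conj_coeff p \<mu> a m)"
proof -
  define b where "b j = (if j = p then wave L 0 else a j)" for j
  define c where "c j = of_nat (j choose m) * (\<i> * of_real \<mu>) ^ (j - m)" for j
  have eq: "conj_coeff p \<mu> a m = (\<lambda>x. \<Sum>j=m..p. c j * b j x)"
    unfolding conj_coeff_def[abs_def] b_def c_def by (intro ext sum.cong refl) simp
  have b: "smooth_fun (b j)" "has_period L (b j)" if "j \<in> {m..p}" for j
    using a[of j] that by (auto simp: b_def smooth_fun_wave has_period_wave[OF L])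
  show "smooth_fun (conj_coeff p \<mu> a m)" unfolding eq by (intro smooth_fun_lincomb b)
  show "has_period L (conj_coeff p \<mu> a m)"
    unfolding eq has_period_def using b(2) by (auto simp: has_period_def intro!: sum.cong)
qed

text \<open>By the separation hypothesis, eigenvalues of the truncation outside the cluster keep the distance
  \<open>2 r\<close> from \<open>l\<close>.\<close>

lemma eventually_in_cluster:
  assumes cl: "eigenvalue_cluster L p f l r k \<Lambda> N0"
    and \<mu>: "\<forall>\<^sub>F N in sequentially. \<mu> N \<in> spectrum_trunc L p f N"
    and near: "\<forall>\<^sub>F N in sequentially. cmod (l - \<mu> N) < 2 * r"
  shows "\<exists>i. \<forall>\<^sub>F N in sequentially. i N \<in> {1..k} \<and> \<Lambda> N (i N) = \<mu> N"
proof -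
  have "\<forall>\<^sub>F N in sequentially. \<exists>j. j \<in> {1..k} \<and> \<Lambda> N j = \<mu> N"
    using \<mu> near eventually_gt_at_top[of N0]
  proof eventually_elim
    case (elim N)
    show ?case
    proof (rule ccontr)
      assume "\<not> ?thesis"
      hence "\<mu> N \<in> spectrum_trunc L p f N - (\<Union>i\<in>{1..k}. {\<Lambda> N i})" using elim(1) by auto
      hence "dist_to_set l (spectrum_trunc L p f N - (\<Union>i\<in>{1..k}. {\<Lambda> N i})) \<le> ereal (cmod (l - \<mu> N))"
        unfolding dist_to_set_def by (rule INF_lower)
      moreover have "ereal (2 * r) \<le> dist_to_set l (spectrum_trunc L p f N - (\<Union>i\<in>{1..k}. {\<Lambda> N i}))"
        using cl elim(3) by (simp add: eigenvalue_cluster_def)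
      ultimately have "ereal (2 * r) \<le> ereal (cmod (l - \<mu> N))" by (rule order_trans[rotated])
      thus False using elim(2) by simp
    qed
  qed
  then have "\<forall>\<^sub>F N in sequentially. (SOME j. j \<in> {1..k} \<and> \<Lambda> N j = \<mu> N) \<in> {1..k} \<and>
      \<Lambda> N (SOME j. j \<in> {1..k} \<and> \<Lambda> N j = \<mu> N) = \<mu> N"
    by (rule eventually_mono) (rule someI_ex)
  thus ?thesis by (rule exI[where x = "\<lambda>N. SOME j. j \<in> {1..k} \<and> \<Lambda> N j = \<mu> N"])
qed


theorem theorem3p5:
  fixes p :: nat and L \<mu> r :: real and l :: complex
    and ft f :: "nat \<Rightarrow> real \<Rightarrow> complex" and \<phi> :: "real \<Rightarrow> complex"
  assumes "p \<ge> 1" and "L > 0"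
    and "\<forall>j<p. smooth_fun (ft j) \<and> has_period L (ft j)"
    and "0 \<le> \<mu>" and "\<mu> < 2 * pi / L"
    and "\<forall>j<p. f j = conj_coeff p \<mu> ft j"
    and "self_adjoint_op L (H_per L p) (diff_op L p f)"
    and "l \<in> spectrum_diff_op L p f"
    and "r > 0"
    and "eigenvector_op (H_per L p) (diff_op L p f) l \<phi>"
  shows
    "((\<forall>j<p. smooth_fun (f j)) \<longrightarrow>
       (\<exists>C1 :: nat \<Rightarrow> real. (\<forall>q\<ge>1. C1 q > 0) \<and>
         (\<forall>k \<Lambda> N0. k \<ge> 2 \<and> N0 \<ge> 1 \<and> eigenvalue_cluster L p f l r k \<Lambda> N0 \<longrightarrow>
           (\<exists>i :: nat \<Rightarrow> nat. (\<forall>\<^sub>F N in sequentially. i N \<in> {1..k}) \<and>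
             (\<forall>q\<ge>1. \<forall>\<^sub>F N in sequentially.
                cmod (l - \<Lambda> N (i N)) \<le> C1 q * real N powr (- real q))))))
     \<and>
     (\<forall>d>0. (\<forall>j<p. analytic_on_strip d (f j)) \<longrightarrow>
       (\<exists>C2 :: real \<Rightarrow> real. (\<forall>\<epsilon>. 0 < \<epsilon> \<and> \<epsilon> < d \<longrightarrow> C2 \<epsilon> > 0) \<and>
         (\<forall>k \<Lambda> N0. k \<ge> 2 \<and> N0 \<ge> 1 \<and> eigenvalue_cluster L p f l r k \<Lambda> N0 \<longrightarrow>
           (\<exists>i :: nat \<Rightarrow> nat. (\<forall>\<^sub>F N in sequentially. i N \<in> {1..k}) \<and>
             (\<forall>\<epsilon>. 0 < \<epsilon> \<and> \<epsilon> < d \<longrightarrow> (\<forall>\<^sub>F N in sequentially.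
                cmod (l - \<Lambda> N (i N)) \<le>
                  C2 \<epsilon> * real N ^ (2 * p + 1) *
                  exp (- (2 * pi * (d - \<epsilon>) / (real k * L)) * real N)))))))"
proof -
  note L = \<open>L > 0\<close>
  have f: "smooth_fun (f j)" "has_period L (f j)" if "j < p" for j
    using smooth_period_conj_coeff[OF L, of p ft \<mu> j] assms(3,6) that by auto
  interpret periodic_operator L p f
    by unfold_locales (use assms(1) L f in auto)
  obtain \<nu> where spec: "\<forall>\<^sub>F N in sequentially. \<nu> N \<in> spectrum_trunc L p f N"
    and poly: "\<forall>q. \<exists>C>0. \<forall>\<^sub>F N in sequentially. cmod (l - \<nu> N) \<le> C * real N powr (- real q)"
    and expo: "\<forall>d \<epsilon>. 0 < \<epsilon> \<and> \<epsilon> < d \<and> (\<forall>j<p. analytic_on_strip d (f j)) \<longrightarrow>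
       (\<exists>C>0. \<forall>\<^sub>F N in sequentially.
          cmod (l - \<nu> N) \<le> C * real N * exp (- (2 * pi * (d - \<epsilon>) / L) * real N))"
    using eigenvalue_convergence[OF assms(7,10)] by (elim exE conjE, intro that)
  \<comment> \<open>The polynomial rate with \<open>q = 1\<close> already makes the selection, so both parts share it.\<close>
  have near: "\<forall>\<^sub>F N in sequentially. cmod (l - \<nu> N) < 2 * r"
  proof -
    obtain C where C: "C > 0" "\<forall>\<^sub>F N in sequentially. cmod (l - \<nu> N) \<le> C * real N powr (- real 1)"
      using poly by blast
    have "(\<lambda>N. C * real N powr (- real 1)) \<longlonglongrightarrow> C * 0"
      by (intro tendsto_mult tendsto_const tendsto_neg_powr filterlim_real_sequentially) simp
    hence "\<forall>\<^sub>F N in sequentially. C * real N powr (- real 1) < 2 * r"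
      using order_tendstoD(2)[of _ "C * 0" sequentially "2 * r"] \<open>r > 0\<close> by simp
    with C(2) show ?thesis by eventually_elim linarith
  qed
  have select: "\<exists>i. \<forall>\<^sub>F N in sequentially. i N \<in> {1..k} \<and> \<Lambda> N (i N) = \<nu> N"
    if "eigenvalue_cluster L p f l r k \<Lambda> N0" for k \<Lambda> N0
    by (rule eventually_in_cluster[OF that spec near])
  have "\<exists>C1. \<forall>q. C1 q > 0 \<and> (\<forall>\<^sub>F N in sequentially. cmod (l - \<nu> N) \<le> C1 q * real N powr (- real q))"
    by (rule choice) (rule poly)
  then obtain C1 where C1: "\<And>q. C1 q > 0"
      "\<And>q. \<forall>\<^sub>F N in sequentially. cmod (l - \<nu> N) \<le> C1 q * real N powr (- real q)" by blast
  show ?thesis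
  proof (intro conjI impI allI)
    show "\<exists>C1 :: nat \<Rightarrow> real. (\<forall>q\<ge>1. C1 q > 0) \<and>
         (\<forall>k \<Lambda> N0. k \<ge> 2 \<and> N0 \<ge> 1 \<and> eigenvalue_cluster L p f l r k \<Lambda> N0 \<longrightarrow>
           (\<exists>i :: nat \<Rightarrow> nat. (\<forall>\<^sub>F N in sequentially. i N \<in> {1..k}) \<and>
             (\<forall>q\<ge>1. \<forall>\<^sub>F N in sequentially.
                cmod (l - \<Lambda> N (i N)) \<le> C1 q * real N powr (- real q))))"
    proof (intro exI[of _ C1] conjI allI impI C1(1))
      fix k \<Lambda> N0 assume "k \<ge> 2 \<and> N0 \<ge> 1 \<and> eigenvalue_cluster L p f l r k \<Lambda> N0"
      then obtain i where i: "\<forall>\<^sub>F N in sequentially. i N \<in> {1..k} \<and> \<Lambda> N (i N) = \<nu> N"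
        using select by blast
      show "\<exists>i :: nat \<Rightarrow> nat. (\<forall>\<^sub>F N in sequentially. i N \<in> {1..k}) \<and>
             (\<forall>q\<ge>1. \<forall>\<^sub>F N in sequentially.
                cmod (l - \<Lambda> N (i N)) \<le> C1 q * real N powr (- real q))"
      proof (intro exI[of _ i] conjI allI impI)
        show "\<forall>\<^sub>F N in sequentially. i N \<in> {1..k}" using i by (rule eventually_mono) simp
        show "\<forall>\<^sub>F N in sequentially. cmod (l - \<Lambda> N (i N)) \<le> C1 q * real N powr (- real q)" for q
          using i C1(2)[of q] by eventually_elim simp
      qed
    qed
  next
    fix d :: real assume "d > 0" and an: "\<forall>j<p. analytic_on_strip d (f j)"
    have "\<forall>\<epsilon>. \<exists>C. 0 < \<epsilon> \<and> \<epsilon> < d \<longrightarrow> C > 0 \<and> (\<forall>\<^sub>F N in sequentially.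
        cmod (l - \<nu> N) \<le> C * real N * exp (- (2 * pi * (d - \<epsilon>) / L) * real N))"
      using expo an by blast
    from choice[OF this] obtain C2 where C2: "\<And>\<epsilon>. 0 < \<epsilon> \<Longrightarrow> \<epsilon> < d \<Longrightarrow> C2 \<epsilon> > 0"
      "\<And>\<epsilon>. 0 < \<epsilon> \<Longrightarrow> \<epsilon> < d \<Longrightarrow> \<forall>\<^sub>F N in sequentially.
        cmod (l - \<nu> N) \<le> C2 \<epsilon> * real N * exp (- (2 * pi * (d - \<epsilon>) / L) * real N)" by blast
    show "\<exists>C2 :: real \<Rightarrow> real. (\<forall>\<epsilon>. 0 < \<epsilon> \<and> \<epsilon> < d \<longrightarrow> C2 \<epsilon> > 0) \<and>
         (\<forall>k \<Lambda> N0. k \<ge> 2 \<and> N0 \<ge> 1 \<and> eigenvalue_cluster L p f l r k \<Lambda> N0 \<longrightarrow>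
           (\<exists>i :: nat \<Rightarrow> nat. (\<forall>\<^sub>F N in sequentially. i N \<in> {1..k}) \<and>
             (\<forall>\<epsilon>. 0 < \<epsilon> \<and> \<epsilon> < d \<longrightarrow> (\<forall>\<^sub>F N in sequentially.
                cmod (l - \<Lambda> N (i N)) \<le>
                  C2 \<epsilon> * real N ^ (2 * p + 1) *
                  exp (- (2 * pi * (d - \<epsilon>) / (real k * L)) * real N)))))"
    proof (rule exI[of _ C2], intro conjI allI impI)
      show "C2 \<epsilon> > 0" if "0 < \<epsilon> \<and> \<epsilon> < d" for \<epsilon> using C2(1) that by blast
      fix k \<Lambda> N0 assume k: "k \<ge> 2 \<and> N0 \<ge> 1 \<and> eigenvalue_cluster L p f l r k \<Lambda> N0"
      then obtain i where i: "\<forall>\<^sub>F N in sequentially. i N \<in> {1..k} \<and> \<Lambda> N (i N) = \<nu> N"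
        using select by blast
      show "\<exists>i :: nat \<Rightarrow> nat. (\<forall>\<^sub>F N in sequentially. i N \<in> {1..k}) \<and>
             (\<forall>\<epsilon>. 0 < \<epsilon> \<and> \<epsilon> < d \<longrightarrow> (\<forall>\<^sub>F N in sequentially.
                cmod (l - \<Lambda> N (i N)) \<le>
                  C2 \<epsilon> * real N ^ (2 * p + 1) *
                  exp (- (2 * pi * (d - \<epsilon>) / (real k * L)) * real N)))"
      proof (intro exI[of _ i] conjI allI impI)
        show "\<forall>\<^sub>F N in sequentially. i N \<in> {1..k}" using i by (rule eventually_mono) simp
        fix \<epsilon> assume "0 < \<epsilon> \<and> \<epsilon> < d"
        hence \<epsilon>: "0 < \<epsilon>" "\<epsilon> < d" by auto
        show "\<forall>\<^sub>F N in sequentially. cmod (l - \<Lambda> N (i N)) \<le> C2 \<epsilon> * real N ^ (2 * p + 1) *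
                  exp (- (2 * pi * (d - \<epsilon>) / (real k * L)) * real N)"
          using i C2(2)[OF \<epsilon>] eventually_ge_at_top[of 1]
        proof eventually_elim
          case (elim N)
          have "real N ^ 1 \<le> real N ^ (2 * p + 1)"
            by (rule power_increasing) (use elim(3) in auto)
          moreover have "2 * pi * (d - \<epsilon>) / (real k * L) \<le> 2 * pi * (d - \<epsilon>) / L"
            using k L \<epsilon> by (intro divide_left_mono) auto
          hence "- (2 * pi * (d - \<epsilon>) / L) * real N \<le> - (2 * pi * (d - \<epsilon>) / (real k * L)) * real N"
            by (intro mult_right_mono) auto
          ultimately have "C2 \<epsilon> * real N * exp (- (2 * pi * (d - \<epsilon>) / L) * real N) \<le>
              C2 \<epsilon> * real N ^ (2 * p + 1) * exp (- (2 * pi * (d - \<epsilon>) / (real k * L)) * real N)"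
            using C2(1)[OF \<epsilon>] by (intro mult_mono) auto
          thus ?case using elim(1,2) by simp
        qed
      qed
    qed
  qed
qed

end
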